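(* For every $\varepsilon>0$ there is an algorithm for the sample-based matroid prophet inequality problem that uses $O_\varepsilon(\log^4 n)$ samples from each distribution and is $(\frac14-\varepsilon)$-competitive for every matroid on a ground set of $n$ items and every collection of independent value distributions. That is, for every matroid $\mathcal M=(U,\mathcal I)$ with $U=[n]$ and all distributions $\mathcal D_1,\dots,\mathcal D_n$ on $\mathbb R_{\ge 0}$, the (feasible) set $A$ it outputs satisfies $$\mathbb E\Big[\sum_{i\in A} v_i\Big]\ \ge\ \Big(\tfrac14-\varepsilon\Big)\,\mathbb E\Big[\max_{S\in\mathcal I}\sum_{i\in S} v_i\Big].$$
   Context: Prophet inequality problem: there is a ground set of items $U=[n]$, a downward-closed family of feasible sets $\mathcal F\subseteq 2^U$ (here the independent sets $\mathcal I$ of a matroid), and for each $i\in U$ a distribution $\mathcal D_i$ over nonnegative reals. Values $v_i\sim\mathcal D_i$ are drawn independently. Items arrive in the order $1,2,\dots,n$; when item $i$ arrives its value $v_i$ is revealed and the algorithm must irrevocably decide whether to add $i$ to its output $A$, maintaining $A\in\mathcal F$ at all times. An algorithm is $c$-competitive if for all $\mathcal D_1,\dots,\mathcal D_n$, $\mathbb E[\sum_{i\in A}v_i]\ge c\,\mathbb E[\max_{S\in\mathcal F}\sum_{i\in S}v_i]$, where the expectation is over the values, the algorithm's internal randomness and its samples. In the limited-information (sample-based) setting the algorithm does not know the distributions; instead, before the online phase it receives a number of independent samples from each $\mathcal D_i$; it "uses $k$ samples" if it receives $k$ samples from each $\mathcal D_i$. The notation $O_\varepsilon(\cdot)$ hides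 factors depending only on $\varepsilon$. *)

theory Defs
  imports "HOL-Probability.Probability" "HOL-Library.Landau_Symbols"
begin

definition matroid :: "'a set \<Rightarrow> 'a set set \<Rightarrow> bool" where
  "matroid U \<I> \<longleftrightarrow>
     finite U \<and> \<I> \<subseteq> Pow U \<and> {} \<in> \<I> \<and>
     (\<forall>S\<in>\<I>. \<forall>T\<subseteq>S. T \<in> \<I>) \<and>
     (\<forall>S\<in>\<I>. \<forall>T\<in>\<I>. card S < card T \<longrightarrow> (\<exists>x\<in>T - S. insert x S \<in> \<I>))"

text \<open>
  An online algorithm for a fixed instance size, feasibility family and number of samples.
  Its internal randomness is a seed drawn once, independently of everything else, from an
  arbitrary probability space with outcomes in \<^typ>\<open>nat \<Rightarrow> real\<close>. In \<open>accept A i r s w\<close>, \<open>r\<close> is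
  the seed, \<open>s (j, l)\<close> is the \<open>l\<close>-th sample of item \<open>j\<close>, and \<open>w\<close> is the vector of the values
  revealed up to and including the arrival of item \<open>i\<close>. Earlier decisions are determined by
  these data, so they are not passed separately.
\<close>

record online_alg =
  seed :: "(nat \<Rightarrow> real) measure"
  accept :: "nat \<Rightarrow> (nat \<Rightarrow> real) \<Rightarrow> (nat \<times> nat \<Rightarrow> real) \<Rightarrow> (nat \<Rightarrow> real) \<Rightarrow> bool"

text \<open>
  The items selected among the first \<open>m\<close>. The restriction hides the values of all items that
  have not arrived yet.
\<close>

definition selected ::
    "online_alg \<Rightarrow> nat \<Rightarrow> (nat \<Rightarrow> real) \<Rightarrow> (nat \<times> nat \<Rightarrow> real) \<Rightarrow> (nat \<Rightarrow> real) \<Rightarrow> nat set" where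
  "selected A m r s v = {i \<in> {1..m}. accept A i r s (restrict v {1..i})}"

text \<open>
  Feasibility is required for every outcome, not just almost surely, and after every arrival.
  Measurability is needed because \<^const>\<open>nn_integral\<close> of a non-measurable function is only a
  lower integral.
\<close>

definition online_algorithm :: "nat \<Rightarrow> nat \<Rightarrow> nat set set \<Rightarrow> online_alg \<Rightarrow> bool" where
  "online_algorithm n k \<F> A \<longleftrightarrow>
     prob_space (seed A) \<and>
     (\<forall>i\<in>{1..n}.
        Measurable.pred
          (seed A \<Otimes>\<^sub>M ((\<Pi>\<^sub>M p\<in>{1..n} \<times> {1..k}. (borel :: real measure)) \<Otimes>\<^sub>M
                     (\<Pi>\<^sub>M j\<in>{1..i}. (borel :: real measure))))
          (\<lambda>(r, s, w). accept A i r s w)) \<and>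
     (\<forall>r\<in>space (seed A). \<forall>s \<in> {1..n} \<times> {1..k} \<rightarrow>\<^sub>E {0..}. \<forall>v \<in> {1..n} \<rightarrow>\<^sub>E {0..}.
        \<forall>m\<le>n. selected A m r s v \<in> \<F>)"

definition nonneg_distribution :: "real measure \<Rightarrow> bool" where
  "nonneg_distribution D \<longleftrightarrow> prob_space D \<and> sets D = sets borel \<and> (AE x in D. 0 \<le> x)"

text \<open>
  Expectations are taken in \<^typ>\<open>ennreal\<close>, so distributions of infinite mean are covered.
\<close>

definition expected_alg ::
    "nat \<Rightarrow> nat \<Rightarrow> (nat \<Rightarrow> real measure) \<Rightarrow> online_alg \<Rightarrow> ennreal" where
  "expected_alg n k D A =
     (\<integral>\<^sup>+ (r, s, v). ennreal (\<Sum>i\<in>selected A n r s v. v i)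
        \<partial>(seed A \<Otimes>\<^sub>M ((\<Pi>\<^sub>M p\<in>{1..n} \<times> {1..k}. D (fst p)) \<Otimes>\<^sub>M (\<Pi>\<^sub>M i\<in>{1..n}. D i))))"

definition expected_opt ::
    "nat \<Rightarrow> nat set set \<Rightarrow> (nat \<Rightarrow> real measure) \<Rightarrow> ennreal" where
  "expected_opt n \<F> D =
     (\<integral>\<^sup>+ v. ennreal (MAX S\<in>\<F>. \<Sum>i\<in>S. v i) \<partial>(\<Pi>\<^sub>M i\<in>{1..n}. D i))"

text \<open>
  Negative \<open>c\<close> is truncated to \<open>0\<close> by \<^const>\<open>ennreal\<close>; the claim is then trivial either way.
\<close>

definition competitive :: "real \<Rightarrow> nat \<Rightarrow> nat \<Rightarrow> nat set set \<Rightarrow> online_alg \<Rightarrow> bool" where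
  "competitive c n k \<F> A \<longleftrightarrow>
     (\<forall>D. (\<forall>i\<in>{1..n}. nonneg_distribution (D i)) \<longrightarrow>
        ennreal c * expected_opt n \<F> D \<le> expected_alg n k D A)"

end

theory Submission imports Defs begin

text \<open>
  \<^bold>\<open>Thresholds.\<close> Of \<open>4C\<close> samples per item, a fair coin makes each one a training slot or not. An
  item is active at a value if adding a copy of it to the training slots above that value enlarges
  their rank in the polymatroid \<open>C * rk\<close>. Going down through all slots, each unblocked one is with
  probability 1/2 a training slot, using up capacity, and otherwise a test slot that is active. So
  the tests inside a flat \<open>F\<close> are essentially dominated by \<open>C * rk F\<close> fair coins, and the expected
  number of active items in \<open>F\<close> is with high probability at most \<open>(1 + e) / 2 * rk F\<close>. Exchanging
  the online value with a training slot and using that greedy is optimal on a polymatroid, the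
  active items carry about half of the optimum.

  \<^bold>\<open>Selection.\<close> Conditionally on the thresholds the active set is a random set whose mean lies in
  about half of the matroid polytope. A chain of sets \<open>U = N\<^sub>0 \<supseteq> N\<^sub>1 \<supseteq> \<dots>\<close> is built from
  the remaining samples: \<open>N\<^sub>d\<^sub>+\<^sub>1\<close> collects, in up to \<open>T\<close> rounds, the items of \<open>N\<^sub>d\<close> that the other
  active items of \<open>N\<^sub>d\<close> together with the items collected so far span with estimated probability
  above \<open>1/2 + 3e\<close>. An item of \<open>N\<^sub>d - N\<^sub>d\<^sub>+\<^sub>1\<close> is accepted if it is active and not spanned by the
  previous active items of \<open>N\<^sub>d\<close> together with \<open>N\<^sub>d\<^sub>+\<^sub>1\<close>. A rank count shows that ranks shrink by
  the factor \<open>1 - e\<close> per level, so logarithmically many levels suffice. The number of rounds is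
  random: the spanning probability of a fixed item only grows along the rounds, hence its last
  increment, the one that \<open>N\<^sub>d\<^sub>+\<^sub>1\<close> does not control, is at most \<open>1 / T\<close> on average. So every active
  item survives with probability about 1/2.
\<close>

section \<open>Rank and span in a matroid\<close>

text \<open>The factor 1/4 is a product of two halves that pull against each other. About
  \<open>2C\<close> of the \<open>4C\<close> slots of an item are training slots and about
  \<open>2C\<close> are tests. Since the tests inside \<open>F\<close> compete for capacity
  \<open>C * rk F\<close>, the mean number of active items is about half the rank; but the optima of
  \<open>C\<close> columns are spread over about \<open>2C\<close> exchangeable slots per item, so
  only half of the optimum stays active. Half occupancy is in turn what makes ranks contract when
  the items spanned with probability above one half are collected. Multiplying the capacity by
  \<open>C\<close>, of order log n, turns the tail bound for rank r into \<open>q ^ r\<close> with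
  \<open>q\<close> of order n^-2, which beats the number of flats of that rank. The obstacle in the
  selection is that the last round tests against the set it starts from, whereas survival refers to
  the set it produces. Iterating to a fixed point would close this gap, but this argument gives no
  logarithmic bound on the rounds needed; the random stop makes the gap small on average instead.
  Levels, rounds per level and columns per round are each of order log n, so log^3 n samples
  suffice, inside the allowed log^4 n.\<close>

locale finite_matroid =
  fixes U :: "'a set" and Ind :: "'a set set"
  assumes matroid: "matroid U Ind"
begin

lemma finite_U: "finite U" and Ind_sub: "X \<in> Ind \<Longrightarrow> X \<subseteq> U" and empty_Ind: "{} \<in> Ind"
  and Ind_down: "X \<in> Ind \<Longrightarrow> Y \<subseteq> X \<Longrightarrow> Y \<in> Ind"
  and Ind_aug: "X \<in> Ind \<Longrightarrow> Y \<in> Ind \<Longrightarrow> card X < card Y \<Longrightarrow> \<exists>x\<in>Y - X. insert x X \<in> Ind"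
  using matroid unfolding matroid_def by auto

lemma finite_Ind: "finite Ind"
  using finite_U Ind_sub by (intro finite_subset[of Ind "Pow U"]) auto

lemma finite_in_Ind: "X \<in> Ind \<Longrightarrow> finite X"
  using Ind_sub finite_U finite_subset by blast

definition rk :: "'a set \<Rightarrow> nat" where
  "rk S = Max (card ` {X \<in> Ind. X \<subseteq> S})"

definition spn :: "'a set \<Rightarrow> 'a set" where
  "spn S = {x \<in> U. rk (insert x S) = rk S}"

lemma rk_ge: "X \<in> Ind \<Longrightarrow> X \<subseteq> S \<Longrightarrow> card X \<le> rk S"
  unfolding rk_def using finite_Ind by (auto intro!: Max_ge)

lemma rk_obtain: obtains X where "X \<in> Ind" "X \<subseteq> S" "card X = rk S"
proof -
  have "rk S \<in> card ` {X \<in> Ind. X \<subseteq> S}"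
    unfolding rk_def using finite_Ind empty_Ind by (intro Max_in) auto
  then show thesis using that by auto
qed

lemma rk_mono: "S \<subseteq> T \<Longrightarrow> rk S \<le> rk T"
proof -
  assume "S \<subseteq> T"
  moreover obtain X where "X \<in> Ind" "X \<subseteq> S" "card X = rk S" by (rule rk_obtain)
  ultimately show "rk S \<le> rk T" using rk_ge[of X T] by simp
qed

lemma rk_le_card: "finite S \<Longrightarrow> rk S \<le> card S"
proof -
  assume "finite S"
  moreover obtain X where "X \<in> Ind" "X \<subseteq> S" "card X = rk S" by (rule rk_obtain)
  ultimately show "rk S \<le> card S" using card_mono[of S X] by simp
qed

lemma rk_empty [simp]: "rk {} = 0"
  using rk_le_card[of "{}"] by simp

lemma rk_Ind: "X \<in> Ind \<Longrightarrow> rk X = card X"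
  using rk_ge[of X X] rk_le_card[of X] finite_in_Ind[of X] by auto

lemma Ind_iff_rk: "finite X \<Longrightarrow> rk X = card X \<Longrightarrow> X \<in> Ind"
proof -
  assume *: "finite X" "rk X = card X"
  obtain Y where "Y \<in> Ind" "Y \<subseteq> X" "card Y = rk X" by (rule rk_obtain)
  then show "X \<in> Ind" using * card_subset_eq[of X Y] by simp
qed

lemma Ind_extend:
  assumes "X \<in> Ind" "X \<subseteq> S"
  obtains Y where "Y \<in> Ind" "X \<subseteq> Y" "Y \<subseteq> S" "card Y = rk S"
proof -
  have "\<exists>Y\<in>Ind. X \<subseteq> Y \<and> Y \<subseteq> S \<and> card Y = rk S" using assms
  proof (induction "rk S - card X" arbitrary: X rule: less_induct)
    case less
    show ?case
    proof (cases "card X < rk S")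
      case True
      obtain Z where Z: "Z \<in> Ind" "Z \<subseteq> S" "card Z = rk S" by (rule rk_obtain)
      then obtain x where x: "x \<in> Z - X" "insert x X \<in> Ind"
        using Ind_aug[OF less.prems(1) Z(1)] True by auto
      have "card (insert x X) = Suc (card X)" using x finite_in_Ind[OF less.prems(1)] by auto
      then have "rk S - card (insert x X) < rk S - card X" using True by auto
      from less.hyps[OF this x(2)] show ?thesis using x Z(2) less.prems(2) by auto
    next
      case False
      then show ?thesis using rk_ge[OF less.prems] less.prems by auto
    qed
  qed
  then show thesis using that by auto
qed

text \<open>A basis of the intersection extends to a basis of the union, whose traces on
  \<open>S\<close> and \<open>T\<close> are independent and overlap at least in the basis of the
  intersection.\<close>

lemma rk_submod: "rk (S \<union> T) + rk (S \<inter> T) \<le> rk S + rk T"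
proof -
  obtain X where X: "X \<in> Ind" "X \<subseteq> S \<inter> T" "card X = rk (S \<inter> T)" by (rule rk_obtain)
  have XST: "X \<subseteq> S \<union> T" using X(2) by blast
  obtain Y where Y: "Y \<in> Ind" "X \<subseteq> Y" "Y \<subseteq> S \<union> T" "card Y = rk (S \<union> T)"
    by (rule Ind_extend[OF X(1) XST])
  have fY: "finite Y" by (rule finite_in_Ind[OF Y(1)])
  have "card Y + card X \<le> card (Y \<inter> S \<union> Y \<inter> T) + card ((Y \<inter> S) \<inter> (Y \<inter> T))"
    using X Y fY by (intro add_mono card_mono) auto
  also have "\<dots> = card (Y \<inter> S) + card (Y \<inter> T)"
    using fY by (intro card_Un_Int[symmetric]) auto
  also have "\<dots> \<le> rk S + rk T"
    by (intro add_mono rk_ge Ind_down[OF Y(1)]) auto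
  finally show ?thesis using X Y by simp
qed

lemma rk_insert_le: "rk (insert x S) \<le> Suc (rk S)"
  using rk_submod[of "{x}" S] rk_le_card[of "{x}"] by auto

lemma rk_insert: "x \<in> U \<Longrightarrow> rk (insert x S) = (if x \<in> spn S then rk S else Suc (rk S))"
  using rk_insert_le[of x S] rk_mono[OF subset_insertI, of S x] unfolding spn_def by auto

lemma subset_spn: "S \<subseteq> U \<Longrightarrow> S \<subseteq> spn S"
  unfolding spn_def by (auto simp: insert_absorb)

lemma spn_mono: assumes "S \<subseteq> T" shows "spn S \<subseteq> spn T"
proof
  fix x assume x: "x \<in> spn S"
  show "x \<in> spn T"
  proof (cases "x \<in> T")
    case True then show ?thesis using x unfolding spn_def by (auto simp: insert_absorb)
  next
    case False
    have "rk (insert x S \<union> T) + rk (insert x S \<inter> T) \<le> rk (insert x S) + rk T" by (rule rk_submod)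
    moreover have "insert x S \<union> T = insert x T" "insert x S \<inter> T = S" using assms False by auto
    ultimately show ?thesis using x rk_mono[OF subset_insertI, of T x] unfolding spn_def by auto
  qed
qed

lemma rk_Un_spn: assumes "B \<subseteq> spn S" shows "rk (S \<union> B) = rk S"
proof -
  have "finite B" using assms finite_U finite_subset unfolding spn_def by fastforce
  then show ?thesis using assms
  proof (induction B rule: finite_induct)
    case (insert x B)
    have "x \<in> spn (S \<union> B)" using insert.prems spn_mono[of S "S \<union> B"] by auto
    then show ?case using insert unfolding spn_def by auto
  qed simp
qed

lemma subset_spn_if_rk_eq: "S \<subseteq> T \<Longrightarrow> T \<subseteq> U \<Longrightarrow> rk T = rk S \<Longrightarrow> T \<subseteq> spn S"
proof
  fix x assume *: "S \<subseteq> T" "T \<subseteq> U" "rk T = rk S" "x \<in> T"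
  have "rk S \<le> rk (insert x S)" "rk (insert x S) \<le> rk T" by (rule rk_mono, use * in blast)+
  then show "x \<in> spn S" using * unfolding spn_def by auto
qed

lemma rk_spn: "S \<subseteq> U \<Longrightarrow> rk (spn S) = rk S"
  using rk_Un_spn[of "spn S" S] subset_spn[of S] by (simp add: Un_absorb1)

lemma Ind_insert: "X \<in> Ind \<Longrightarrow> x \<in> U \<Longrightarrow> x \<notin> spn X \<Longrightarrow> insert x X \<in> Ind"
  using rk_insert[of x X] rk_Ind[of X] Ind_sub[of X] subset_spn[of X] finite_in_Ind[of X]
  by (intro Ind_iff_rk) (auto simp: card_insert_if)

lemma rk_Un_le_card:
  assumes "finite B" "B \<subseteq> U"
  shows "rk (A \<union> B) \<le> rk A + card {e \<in> B. e \<notin> spn A}"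
  using assms
proof (induction B rule: finite_induct)
  case (insert x B)
  have IH: "rk (A \<union> B) \<le> rk A + card {e \<in> B. e \<notin> spn A}" using insert by auto
  show ?case
  proof (cases "x \<in> spn A")
    case True
    then have "x \<in> spn (A \<union> B)" using spn_mono[of A "A \<union> B"] by auto
    then have "rk (A \<union> insert x B) = rk (A \<union> B)" unfolding spn_def by auto
    moreover have "{e \<in> insert x B. e \<notin> spn A} = {e \<in> B. e \<notin> spn A}" using True by auto
    ultimately show ?thesis using IH by simp
  next
    case False
    have "{e \<in> insert x B. e \<notin> spn A} = insert x {e \<in> B. e \<notin> spn A}" using False by auto
    then have "card {e \<in> insert x B. e \<notin> spn A} = Suc (card {e \<in> B. e \<notin> spn A})"
      using insert by simp
    then show ?thesis using IH rk_insert_le[of x "A \<union> B"] by simp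
  qed
qed simp

text \<open>Extend a basis of \<open>S\<close> to a basis of \<open>T\<close> and keep only the new
  elements. Over any \<open>A\<close> containing \<open>S\<close> they replace \<open>T\<close>, so
  a rank gain can be charged to \<open>rk T - rk S\<close> elements instead of to all of
  \<open>T - S\<close>.\<close>

lemma rk_complement_obtain:
  assumes "S \<subseteq> T" "T \<subseteq> U"
  obtains B where "B \<subseteq> T" "card B + rk S = rk T" "\<And>A. S \<subseteq> A \<Longrightarrow> rk (A \<union> T) = rk (A \<union> B)"
proof -
  obtain X where X: "X \<in> Ind" "X \<subseteq> S" "card X = rk S" by (rule rk_obtain)
  have XT: "X \<subseteq> T" using X(2) assms(1) by blast
  obtain Y where Y: "Y \<in> Ind" "X \<subseteq> Y" "Y \<subseteq> T" "card Y = rk T"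
    by (rule Ind_extend[OF X(1) XT])
  have "rk T = rk Y" using rk_Ind[OF Y(1)] Y(4) by metis
  then have T: "T \<subseteq> spn Y" by (rule subset_spn_if_rk_eq[OF Y(3) assms(2)])
  show thesis
  proof (rule that[of "Y - X"])
    show "Y - X \<subseteq> T" using Y by auto
    show "card (Y - X) + rk S = rk T"
      using card_mono[OF finite_in_Ind[OF Y(1)] Y(2)] card_Diff_subset[OF finite_in_Ind[OF X(1)] Y(2)]
      unfolding X(3) Y(4) by linarith
    fix A assume A: "S \<subseteq> A"
    have "Y \<subseteq> A \<union> (Y - X)" using X A by auto
    then have "T \<subseteq> spn (A \<union> (Y - X))" using T spn_mono by blast
    then have "rk (A \<union> (Y - X) \<union> T) = rk (A \<union> (Y - X))" by (rule rk_Un_spn)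
    moreover have "A \<union> (Y - X) \<union> T = A \<union> T" using Y by auto
    ultimately show "rk (A \<union> T) = rk (A \<union> (Y - X))" by simp
  qed
qed

text \<open>Lets a union bound over all \<open>F\<close> run over independent sets, with
  \<open>spn B\<close> in place of \<open>F\<close>.\<close>

lemma spanning_Ind_obtain:
  assumes "F \<subseteq> U"
  obtains B where "B \<in> Ind" "B \<subseteq> F" "card B = rk F" "F \<subseteq> spn B"
proof -
  obtain X where X: "X \<in> Ind" "X \<subseteq> F" "card X = rk F" by (rule rk_obtain)
  have "rk F = rk X" using rk_Ind[OF X(1)] X(3) by metis
  then show thesis using that[OF X] subset_spn_if_rk_eq[OF X(2) assms] by blast
qed

subsection \<open>Blocking in the polymatroid of capacity \<open>C\<close>\<close>

text \<open>The multiplicity vectors \<open>c\<close> with \<open>c(F) \<le> C * rk F\<close> for all \<open>F\<close> form an integral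
  polymatroid, and \<open>rho C m\<close> is the size of a largest such vector below \<open>m\<close>. An item is blocked
  by \<open>m\<close> when one more copy of it does not increase this size.\<close>

definition cut :: "nat \<Rightarrow> ('a \<Rightarrow> nat) \<Rightarrow> 'a set \<Rightarrow> nat" where
  "cut C m F = C * rk F + sum m (U - F)"

definition rho :: "nat \<Rightarrow> ('a \<Rightarrow> nat) \<Rightarrow> nat" where
  "rho C m = Min (cut C m ` Pow U)"

definition blocked :: "nat \<Rightarrow> ('a \<Rightarrow> nat) \<Rightarrow> 'a \<Rightarrow> bool" where
  "blocked C m i \<longleftrightarrow> (\<exists>F\<subseteq>U. i \<in> F \<and> cut C m F = rho C m)"

lemma rho_le: "F \<subseteq> U \<Longrightarrow> rho C m \<le> cut C m F"
  unfolding rho_def using finite_U by (auto intro!: Min_le)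

lemma rho_obtain: obtains F where "F \<subseteq> U" "cut C m F = rho C m"
proof -
  have "rho C m \<in> cut C m ` Pow U" unfolding rho_def using finite_U by (intro Min_in) auto
  then show thesis using that by auto
qed

lemma rho_ge: "(\<And>F. F \<subseteq> U \<Longrightarrow> c \<le> cut C m F) \<Longrightarrow> c \<le> rho C m"
proof -
  assume *: "\<And>F. F \<subseteq> U \<Longrightarrow> c \<le> cut C m F"
  obtain F where "F \<subseteq> U" "cut C m F = rho C m" by (rule rho_obtain)
  then show "c \<le> rho C m" using *[of F] by simp
qed

lemma cut_submod:
  assumes "F \<subseteq> U" "G \<subseteq> U"
  shows "cut C m (F \<union> G) + cut C m (F \<inter> G) \<le> cut C m F + cut C m G"
proof -
  have "sum m (U - (F \<union> G)) + sum m (U - (F \<inter> G)) = sum m (U - F) + sum m (U - G)"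
    using sum.union_inter[of "U - F" "U - G" m] finite_U
    by (simp add: Diff_Int Diff_Un add.commute)
  moreover have "C * rk (F \<union> G) + C * rk (F \<inter> G) \<le> C * rk F + C * rk G"
    using rk_submod[of F G] by (metis add_mult_distrib2 mult_le_mono2)
  ultimately show ?thesis unfolding cut_def by linarith
qed

text \<open>Unite a tight set \<open>F\<close> of \<open>m\<close> with a tight set \<open>G\<close>
  of \<open>m'\<close>. By submodularity and tightness of \<open>F\<close>, passing from
  \<open>G\<close> to the union does not raise the cut of \<open>m\<close>; the additional counts
  are charged only outside the set, so they do not raise it either. The union is tight for
  \<open>m'\<close> and contains \<open>i\<close>.\<close>

lemma blocked_mono:
  assumes "blocked C m i" and le: "\<And>j. j \<in> U \<Longrightarrow> m j \<le> m' j"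
  shows "blocked C m' i"
proof -
  obtain F where F: "F \<subseteq> U" "i \<in> F" "cut C m F = rho C m" using assms unfolding blocked_def by auto
  obtain G where G: "G \<subseteq> U" "cut C m' G = rho C m'" by (rule rho_obtain)
  define d where "d j = m' j - m j" for j
  have dm: "cut C m' A = cut C m A + sum d (U - A)" for A
    unfolding cut_def d_def using le by (simp add: sum.distrib[symmetric])
  have "rho C m \<le> cut C m (F \<inter> G)" by (rule rho_le) (use F in auto)
  then have "cut C m (F \<union> G) \<le> cut C m G" using cut_submod[OF F(1) G(1), of C m] F(3) by linarith
  moreover have "sum d (U - (F \<union> G)) \<le> sum d (U - G)" using finite_U by (intro sum_mono2) auto
  ultimately have "cut C m' (F \<union> G) \<le> rho C m'" unfolding dm using G(2) dm[of G] by linarith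
  moreover have "rho C m' \<le> cut C m' (F \<union> G)" using F G by (intro rho_le) auto
  ultimately show ?thesis unfolding blocked_def using F G by (intro exI[of _ "F \<union> G"]) auto
qed

text \<open>A further copy of \<open>i\<close> raises by one exactly the cuts of the sets that avoid
  \<open>i\<close>. The minimum therefore stays if some minimizer contains \<open>i\<close>, and
  grows by one otherwise.\<close>

lemma rho_increment:
  assumes "i \<in> U"
  shows "rho C (m(i := Suc (m i))) = rho C m + (if blocked C m i then 0 else 1)"
proof -
  let ?m = "m(i := Suc (m i))"
  have c: "cut C ?m F = cut C m F + (if i \<in> F then 0 else 1)" if "F \<subseteq> U" for F
  proof (cases "i \<in> F")
    case True
    then show ?thesis unfolding cut_def by (auto intro!: sum.cong)
  next
    case False
    then have "U - F = insert i (U - F - {i})" using assms by auto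
    then have "sum ?m (U - F) = Suc (m i) + sum m (U - F - {i})"
      and "sum m (U - F) = m i + sum m (U - F - {i})"
      using finite_U sum.insert[of "U - F - {i}" i ?m] sum.insert[of "U - F - {i}" i m] by auto
    then show ?thesis unfolding cut_def using False by simp
  qed
  obtain G where G: "G \<subseteq> U" "cut C m G = rho C m" by (rule rho_obtain)
  show ?thesis
  proof (cases "blocked C m i")
    case True
    then obtain F where F: "F \<subseteq> U" "i \<in> F" "cut C m F = rho C m" unfolding blocked_def by auto
    have "rho C ?m \<le> rho C m" using rho_le[OF F(1), of C ?m] c[OF F(1)] F by simp
    moreover have "rho C m \<le> rho C ?m"
    proof (rule rho_ge)
      fix F assume "F \<subseteq> U"
      then show "rho C m \<le> cut C ?m F" using c[of F] rho_le[of F C m] by simp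
    qed
    ultimately show ?thesis using True by simp
  next
    case False
    then have "i \<notin> G" using G unfolding blocked_def by auto
    then have "rho C ?m \<le> Suc (rho C m)" using rho_le[OF G(1), of C ?m] c[OF G(1)] G by simp
    moreover have "Suc (rho C m) \<le> rho C ?m"
    proof (rule rho_ge)
      fix F assume F: "F \<subseteq> U"
      show "Suc (rho C m) \<le> cut C ?m F"
        using False F c[OF F] rho_le[OF F, of C m] unfolding blocked_def by (cases "i \<in> F") auto
    qed
    ultimately show ?thesis using False by simp
  qed
qed

lemma rho_zero [simp]: "rho C (\<lambda>_. 0) = 0"
  using rho_le[of "{}" C "\<lambda>_. 0"] by (simp add: cut_def)

text \<open>A loop can be added to a tight set at no cost in rank. Hence loops are never active, and
  every later argument may assume a non-loop.\<close>

lemma loop_blocked: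
  assumes "i \<in> U" "i \<in> spn {}" shows "blocked C m i"
proof -
  obtain G where G: "G \<subseteq> U" "cut C m G = rho C m" by (rule rho_obtain)
  have "i \<in> spn G" using assms spn_mono[of "{}" G] by auto
  then have "rk (insert i G) = rk G" unfolding spn_def by auto
  moreover have "sum m (U - insert i G) \<le> sum m (U - G)" using finite_U by (intro sum_mono2) auto
  ultimately have "cut C m (insert i G) \<le> rho C m" using G unfolding cut_def by auto
  then show ?thesis unfolding blocked_def using G assms rho_le[of "insert i G" C m]
    by (intro exI[of _ "insert i G"]) auto
qed

text \<open>\<open>rho C (only F m)\<close> is the potential for the walk over the slots: the
  capacity already used inside \<open>F\<close>, at most \<open>C * rk F\<close>, while blocking
  itself refers to the whole matroid.\<close>

definition only :: "'a set \<Rightarrow> ('a \<Rightarrow> nat) \<Rightarrow> 'a \<Rightarrow> nat" where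
  "only F m = (\<lambda>j. if j \<in> F then m j else 0)"

lemma rho_only_le: "F \<subseteq> U \<Longrightarrow> rho C (only F m) \<le> C * rk F"
  using rho_le[of F C "only F m"] by (simp add: cut_def only_def)

lemma rho_only_increment:
  assumes "i \<in> U"
  shows "rho C (only F m) \<le> rho C (only F (m(i := Suc (m i))))"
    and "i \<in> F \<Longrightarrow> \<not> blocked C m i \<Longrightarrow> rho C (only F (m(i := Suc (m i)))) = Suc (rho C (only F m))"
proof -
  have 1: "only F (m(i := Suc (m i))) = (if i \<in> F then (only F m)(i := Suc (only F m i)) else only F m)"
    by (auto simp: only_def fun_eq_iff)
  show "rho C (only F m) \<le> rho C (only F (m(i := Suc (m i))))"
    unfolding 1 using rho_increment[OF assms, of C "only F m"] by auto
  assume "i \<in> F" "\<not> blocked C m i"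
  moreover have "\<not> blocked C (only F m) i"
    using blocked_mono[of C "only F m" i m] \<open>\<not> blocked C m i\<close> by (fastforce simp: only_def)
  ultimately show "rho C (only F (m(i := Suc (m i)))) = Suc (rho C (only F m))"
    unfolding 1 using rho_increment[OF assms, of C "only F m"] by auto
qed

subsection \<open>Optimality of the greedy rule\<close>

fun counts :: "('e \<Rightarrow> 'a) \<Rightarrow> 'e list \<Rightarrow> 'a \<Rightarrow> nat" where
  "counts item [] = (\<lambda>_. 0)"
| "counts item (e # es) = (counts item es)(item e := Suc (counts item es (item e)))"

lemma sum_counts: "finite A \<Longrightarrow> sum (counts item es) A = length (filter (\<lambda>e. item e \<in> A) es)"
proof (induction es)
  case (Cons e es)
  show ?case
  proof (cases "item e \<in> A")
    case True
    have "sum (counts item (e # es)) A = Suc (counts item es (item e)) + sum (counts item es) (A - {item e})"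
      using True Cons.prems by (subst sum.remove[of A "item e"]) (auto intro!: sum.cong)
    also have "\<dots> = Suc (sum (counts item es) A)"
      using True Cons.prems by (subst sum.remove[of A "item e" "counts item es"]) auto
    finally show ?thesis using Cons True by simp
  next
    case False
    then have "sum (counts item (e # es)) A = sum (counts item es) A" by (auto intro!: sum.cong)
    then show ?thesis using Cons False by simp
  qed
qed simp

text \<open>The list is processed from its end, so the heaviest slot comes last. The surplus
  \<open>rho - card P\<close> of the greedy selection over its competitor \<open>P\<close> is what carries the
  Abel summation.\<close>

lemma greedy_list_optimal:
  fixes w :: "'e \<Rightarrow> ennreal"
  assumes "distinct es" "item ` set es \<subseteq> U" "sorted_wrt (\<lambda>e f. w e \<le> w f) es"
    and W: "\<And>e. e \<in> set es \<Longrightarrow> W \<le> w e"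
    and P: "\<And>F. F \<subseteq> U \<Longrightarrow> card {e \<in> P. item e \<in> F} \<le> C * rk F" and fP: "finite P"
  shows "(\<Sum>e\<in>P \<inter> set es. w e) + of_nat (rho C (counts item es) - card (P \<inter> set es)) * W
      \<le> (\<Sum>q<length es. if blocked C (counts item (drop (Suc q) es)) (item (es ! q)) then 0 else w (es ! q))"
  using assms(1-4)
proof (induction es arbitrary: W)
  case (Cons e es)
  let ?c = "counts item es" and ?c' = "counts item (e # es)"
  let ?S = "\<lambda>es. \<Sum>q<length es. if blocked C (counts item (drop (Suc q) es)) (item (es ! q)) then 0 else w (es ! q)"
  have eU: "item e \<in> U" using Cons.prems by auto
  \<comment> \<open>The surplus is a truncated difference; feasibility of \<open>P\<close> against
    every cut shows that nothing is truncated.\<close>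
  have pre: "card (P \<inter> set es) \<le> rho C (counts item es)" if "distinct es" "item ` set es \<subseteq> U" for es
  proof (rule rho_ge)
    fix F assume F: "F \<subseteq> U"
    have "card (P \<inter> set es) \<le> card ({e \<in> P. item e \<in> F} \<union> {e \<in> set es. item e \<in> U - F})"
      using fP that by (intro card_mono) auto
    also have "\<dots> \<le> card {e \<in> P. item e \<in> F} + card {e \<in> set es. item e \<in> U - F}"
      by (rule card_Un_le)
    also have "card {e \<in> set es. item e \<in> U - F} = length (filter (\<lambda>e. item e \<in> U - F) es)"
      using that(1) by (metis distinct_card distinct_filter set_filter)
    also have "\<dots> = sum (counts item es) (U - F)" using finite_U by (subst sum_counts) auto
    finally show "card (P \<inter> set es) \<le> cut C (counts item es) F" using P[OF F] unfolding cut_def by linarith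
  qed
  have IH: "(\<Sum>e\<in>P \<inter> set es. w e) + of_nat (rho C ?c - card (P \<inter> set es)) * w e \<le> ?S es"
    using Cons.prems by (intro Cons.IH) auto
  have rho: "rho C ?c' = rho C ?c + (if blocked C ?c (item e) then 0 else 1)"
    using rho_increment[OF eU, of C ?c] by simp
  have len: "?S (e # es) = (if blocked C ?c (item e) then 0 else w e) + ?S es"
    unfolding length_Cons sum.lessThan_Suc_shift nth_Cons_Suc drop_Suc_Cons nth_Cons_0 drop0 by simp
  have Pe: "P \<inter> set (e # es) = (if e \<in> P then insert e (P \<inter> set es) else P \<inter> set es)" by auto
  have ne: "e \<notin> P \<inter> set es" using Cons.prems by auto
  let ?p = "card (P \<inter> set es)" and ?p' = "card (P \<inter> set (e # es))"
  let ?b = "if blocked C ?c (item e) then 0 else (1::nat)" and ?a = "if e \<in> P then 1 else (0::nat)"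
  have p': "?p' = ?p + ?a" using ne Pe by auto
  have le1: "?p \<le> rho C ?c" using Cons.prems by (intro pre) auto
  have le2: "?p' \<le> rho C ?c'" using Cons.prems by (intro pre) auto
  \<comment> \<open>Each surplus unit is worth at most \<open>w e\<close>, the lightest weight so
    far. An unblocked \<open>e\<close> adds a unit, and \<open>P\<close> taking \<open>e\<close>
    spends one.\<close>
  have eq: "rho C ?c' - ?p' + ?a = (rho C ?c - ?p) + ?b" using le1 le2 p' rho by linarith
  have sm: "(\<Sum>e\<in>P \<inter> set (e # es). w e) = of_nat ?a * w e + (\<Sum>e\<in>P \<inter> set es. w e)"
    using ne unfolding Pe by auto
  have "of_nat (rho C ?c' - ?p') * W \<le> of_nat (rho C ?c' - ?p') * w e"
    using Cons.prems(4)[of e] by (intro mult_left_mono) auto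
  then have "(\<Sum>e\<in>P \<inter> set (e # es). w e) + of_nat (rho C ?c' - ?p') * W
      \<le> (of_nat ?a * w e + (\<Sum>e\<in>P \<inter> set es. w e)) + of_nat (rho C ?c' - ?p') * w e"
    unfolding sm by (rule add_left_mono)
  also have "\<dots> = (\<Sum>e\<in>P \<inter> set es. w e) + of_nat (rho C ?c' - ?p' + ?a) * w e"
    unfolding of_nat_add distrib_right by (simp only: ac_simps)
  also have "\<dots> = ((\<Sum>e\<in>P \<inter> set es. w e) + of_nat (rho C ?c - ?p) * w e) + of_nat ?b * w e"
    unfolding eq of_nat_add distrib_right by (simp only: ac_simps)
  also have "\<dots> \<le> ?S es + of_nat ?b * w e" using IH by (intro add_right_mono)
  also have "\<dots> = ?S (e # es)" unfolding len by (cases "blocked C ?c (item e)") (auto simp: add.commute)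
  finally show ?case .
qed simp

lemma sorted_list_exists:
  assumes "finite E" and total: "\<And>x y. R x y \<or> R y x" and trans: "\<And>x y z. R x y \<Longrightarrow> R y z \<Longrightarrow> R x z"
  shows "\<exists>es. set es = E \<and> distinct es \<and> sorted_wrt R es"
  using assms(1)
proof (induction "card E" arbitrary: E)
  case (Suc c)
  have "\<exists>e\<in>A. \<forall>f\<in>A. R e f" if "finite A" "A \<noteq> {}" for A
    using that
  proof (induction A rule: finite_ne_induct)
    case (singleton x) then show ?case using total[of x x] by auto
  next
    case (insert x A)
    then obtain e where "e \<in> A" "\<forall>f\<in>A. R e f" by auto
    then have A: "R e f" if "f \<in> A" for f using that by blast
    show ?case
    proof (cases "R e x")
      case True then show ?thesis using A \<open>e \<in> A\<close> by (intro bexI[of _ e]) auto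
    next
      case False
      then have "R x e" using total[of x e] by blast
      then show ?thesis using A trans[of x e] total[of x x] by (intro bexI[of _ x]) auto
    qed
  qed
  then obtain e where e: "e \<in> E" "\<forall>f\<in>E. R e f" using Suc.hyps(2) Suc.prems by (metis card.empty nat.distinct(1))
  have "c = card (E - {e})" "finite (E - {e})" using Suc.hyps(2) Suc.prems e by auto
  from Suc.hyps(1)[OF this] obtain es where "set es = E - {e}" "distinct es" "sorted_wrt R es" by blast
  then show ?case using e by (intro exI[of _ "e # es"]) auto
qed auto

lemma counts_eq_card: "distinct es \<Longrightarrow> counts item es j = card {e \<in> set es. item e = j}"
proof (induction es)
  case (Cons e es)
  have "{f \<in> set (e # es). item f = j} = (if item e = j then insert e {f \<in> set es. item f = j} else {f \<in> set es. item f = j})"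
    by auto
  then show ?case using Cons by auto
qed simp

text \<open>\<open>R e f\<close> says that \<open>f\<close> is at least as heavy as
  \<open>e\<close>, so the counts contain the slots strictly above \<open>e\<close>. All of these
  come after \<open>e\<close> in any sorted list, hence an item blocked by the strict counts is also
  blocked by the list counts. This removes the arbitrary order among ties.\<close>

lemma greedy_optimal:
  fixes w :: "'e \<Rightarrow> ennreal"
  assumes E: "finite E" "item ` E \<subseteq> U"
    and total: "\<And>x y. R x y \<or> R y x" and trans: "\<And>x y z. R x y \<Longrightarrow> R y z \<Longrightarrow> R x z"
    and w: "\<And>e f. e \<in> E \<Longrightarrow> f \<in> E \<Longrightarrow> R e f \<Longrightarrow> w e \<le> w f"
    and P: "\<And>F. F \<subseteq> U \<Longrightarrow> card {e \<in> P. item e \<in> F} \<le> C * rk F" and sub: "P \<subseteq> E"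
  shows "(\<Sum>e\<in>P. w e) \<le> (\<Sum>e\<in>E. if blocked C (\<lambda>j. card {f \<in> E. item f = j \<and> \<not> R f e}) (item e) then 0 else w e)"
proof -
  obtain es where es: "set es = E" "distinct es" "sorted_wrt R es"
  proof -
    have "\<exists>es. set es = E \<and> distinct es \<and> sorted_wrt R es"
    proof (rule sorted_list_exists[OF E(1)])
      show "R x y \<or> R y x" for x y by (rule total)
      show "R x z" if "R x y" "R y z" for x y z using that by (rule trans)
    qed
    then show ?thesis using that by blast
  qed
  have srt: "sorted_wrt (\<lambda>e f. w e \<le> w f) es"
    by (rule sorted_wrt_mono_rel[OF _ es(3)]) (use w es in auto)
  have "(\<Sum>e\<in>P. w e) = (\<Sum>e\<in>P \<inter> set es. w e) + of_nat (rho C (counts item es) - card (P \<inter> set es)) * 0"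
    using sub es by (simp add: Int_absorb2)
  also have "\<dots> \<le> (\<Sum>q<length es. if blocked C (counts item (drop (Suc q) es)) (item (es ! q)) then 0 else w (es ! q))"
    using srt es P E finite_subset[OF sub E(1)] by (intro greedy_list_optimal) auto
  also have "\<dots> \<le> (\<Sum>q<length es. if blocked C (\<lambda>j. card {f \<in> E. item f = j \<and> \<not> R f (es ! q)}) (item (es ! q)) then 0 else w (es ! q))"
  proof (rule sum_mono)
    fix q assume q: "q \<in> {..<length es}"
    let ?e = "es ! q"
    have "f \<in> set (drop (Suc q) es)" if fE: "f \<in> E" and nR: "\<not> R f ?e" for f
    proof -
      obtain p where p: "p < length es" "es ! p = f" using fE unfolding es(1)[symmetric] in_set_conv_nth by blast
      have "p > q"
      proof (rule ccontr)
        assume "\<not> q < p"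
        then consider "p = q" | "p < q" by linarith
        then show False
        proof cases
          case 1 then show ?thesis using p(2) nR total[of f f] by simp
        next
          case 2 then show ?thesis using p(2) nR sorted_wrt_nth_less[OF es(3), of p q] q by simp
        qed
      qed
      then have "drop (Suc q) es ! (p - Suc q) = f" "p - Suc q < length (drop (Suc q) es)"
        using p by simp_all
      then show ?thesis using nth_mem[of "p - Suc q" "drop (Suc q) es"] by simp
    qed
    then have sub: "{f \<in> E. item f = j \<and> \<not> R f ?e} \<subseteq> {f \<in> set (drop (Suc q) es). item f = j}" for j
      by blast
    have "card {f \<in> E. item f = j \<and> \<not> R f ?e} \<le> counts item (drop (Suc q) es) j" for j
      unfolding counts_eq_card[OF distinct_drop[OF es(2)]] by (rule card_mono[OF _ sub]) simp
    then have "blocked C (counts item (drop (Suc q) es)) (item ?e)"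
      if "blocked C (\<lambda>j. card {f \<in> E. item f = j \<and> \<not> R f ?e}) (item ?e)"
      by (rule blocked_mono[OF that])
    then show "(if blocked C (counts item (drop (Suc q) es)) (item ?e) then 0 else w ?e)
       \<le> (if blocked C (\<lambda>j. card {f \<in> E. item f = j \<and> \<not> R f ?e}) (item ?e) then 0 else w ?e)" by auto
  qed
  also have "\<dots> = (\<Sum>e\<in>E. if blocked C (\<lambda>j. card {f \<in> E. item f = j \<and> \<not> R f e}) (item e) then 0 else w e)"
    by (rule sum.reindex_bij_betw[OF bij_betw_nth[OF es(2) refl es(1)[symmetric]]])
  finally show ?thesis .
qed

end

section \<open>Finite products of probability spaces\<close>

text \<open>If \<open>h\<close> depends only on finitely many bits, each preimage is a finite union
  of measurable cells. The combinatorial parts of the algorithm are all of this kind: they see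
  finitely many comparisons.\<close>

lemma measurable_pattern:
  fixes h :: "'a \<Rightarrow> 'c"
  assumes "finite S" and P: "\<And>s. s \<in> S \<Longrightarrow> Measurable.pred M (P s)"
    and h: "\<And>x y. x \<in> space M \<Longrightarrow> y \<in> space M \<Longrightarrow> (\<And>s. s \<in> S \<Longrightarrow> P s x = P s y) \<Longrightarrow> h x = h y"
  shows "h \<in> M \<rightarrow>\<^sub>M count_space UNIV"
proof (rule measurableI)
  fix A :: "'c set" assume "A \<in> sets (count_space UNIV)"
  let ?pat = "\<lambda>x. {s \<in> S. P s x}"
  let ?cell = "\<lambda>T. {x \<in> space M. \<forall>s\<in>S. P s x = (s \<in> T)}"
  have cell: "?cell T \<in> sets M" for T
  proof -
    have "Measurable.pred M (\<lambda>x. \<forall>s\<in>S. P s x = (s \<in> T))"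
      using assms(1) P by (intro pred_intros_finite) auto
    then show ?thesis by (simp add: pred_def)
  qed
  have "h -` A \<inter> space M = (\<Union>T\<in>{T. T \<subseteq> S \<and> (\<exists>x\<in>space M. h x \<in> A \<and> ?pat x = T)}. ?cell T)"
  proof (intro equalityI subsetI)
    fix x assume "x \<in> h -` A \<inter> space M"
    then show "x \<in> (\<Union>T\<in>{T. T \<subseteq> S \<and> (\<exists>x\<in>space M. h x \<in> A \<and> ?pat x = T)}. ?cell T)"
      by (intro UN_I[of "?pat x"]) auto
  next
    fix x assume "x \<in> (\<Union>T\<in>{T. T \<subseteq> S \<and> (\<exists>x\<in>space M. h x \<in> A \<and> ?pat x = T)}. ?cell T)"
    then obtain T y where "y \<in> space M" "h y \<in> A" "?pat y = T" "x \<in> ?cell T" by auto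
    then show "x \<in> h -` A \<inter> space M" using h[of x y] by auto
  qed
  also have "\<dots> \<in> sets M"
    using cell assms(1) by (intro sets.finite_UN) (auto intro: finite_subset[of _ "Pow S"])
  finally show "h -` A \<inter> space M \<in> sets M" .
qed auto

text \<open>Resampling of the coordinates in \<open>J\<close>. Conditioning on the coordinates
  outside \<open>J\<close> becomes an inner integral over the second argument, and dependence on a
  set of coordinates becomes invariance under \<open>mix\<close>.\<close>

definition mix :: "'i set \<Rightarrow> ('i \<Rightarrow> 'b) \<Rightarrow> ('i \<Rightarrow> 'b) \<Rightarrow> 'i \<Rightarrow> 'b" where
  "mix J \<omega> \<omega>' = (\<lambda>i. if i \<in> J then \<omega>' i else \<omega> i)"

locale fin_prod =
  fixes I :: "'i set" and \<mu> :: "'i \<Rightarrow> 'b measure"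
  assumes fin_I: "finite I" and prob_mu: "\<And>i. prob_space (\<mu> i)"
begin

abbreviation Om :: "('i \<Rightarrow> 'b) measure" where "Om \<equiv> PiM I \<mu>"

sublocale P: prob_space Om
  by (rule prob_space_PiM) (rule prob_mu)

sublocale Om: product_prob_space \<mu> I
  using prob_mu by (simp add: product_prob_space_def product_prob_space_axioms_def
      product_sigma_finite_def prob_space_imp_sigma_finite)

lemma mix_space [simp]: "\<omega> \<in> space Om \<Longrightarrow> \<omega>' \<in> space Om \<Longrightarrow> mix J \<omega> \<omega>' \<in> space Om"
  by (auto simp: mix_def space_PiM PiE_def extensional_def Pi_def)

lemma measurable_mix [measurable]: "(\<lambda>(\<omega>, \<omega>'). mix J \<omega> \<omega>') \<in> Om \<Otimes>\<^sub>M Om \<rightarrow>\<^sub>M Om"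
proof (rule measurable_PiM_single')
  show "(\<lambda>p. (case p of (\<omega>, \<omega>') \<Rightarrow> mix J \<omega> \<omega>') i) \<in> Om \<Otimes>\<^sub>M Om \<rightarrow>\<^sub>M \<mu> i" if "i \<in> I" for i
    using that by (cases "i \<in> J") (simp_all add: mix_def case_prod_beta')
qed (auto simp: mix_def space_pair_measure space_PiM PiE_def extensional_def Pi_def split: if_splits)

text \<open>On a box, each coordinate is constrained in exactly one of the two copies and
  contributes the factor 1 in the other.\<close>

lemma distr_mix: "distr (Om \<Otimes>\<^sub>M Om) Om (\<lambda>(\<omega>, \<omega>'). mix J \<omega> \<omega>') = Om"
proof (rule Om.PiM_eqI)
  fix A assume A: "\<And>i. i \<in> I \<Longrightarrow> A i \<in> sets (\<mu> i)"
  let ?X = "Pi\<^sub>E I (\<lambda>i. if i \<in> J then space (\<mu> i) else A i)"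
  let ?Y = "Pi\<^sub>E I (\<lambda>i. if i \<in> J then A i else space (\<mu> i))"
  have *: "?X \<in> sets Om" "?Y \<in> sets Om" "Pi\<^sub>E I A \<in> sets Om"
    using A fin_I by (auto intro!: sets_PiM_I_finite)
  have AS: "A i \<subseteq> space (\<mu> i)" if "i \<in> I" for i using A[OF that] sets.sets_into_space by auto
  have "(\<lambda>(\<omega>, \<omega>'). mix J \<omega> \<omega>') -` Pi\<^sub>E I A \<inter> space (Om \<Otimes>\<^sub>M Om) = ?X \<times> ?Y"
    using AS unfolding space_pair_measure space_PiM
    by (fastforce simp: mix_def PiE_def Pi_def extensional_def split: if_splits)
  then have "emeasure (distr (Om \<Otimes>\<^sub>M Om) Om (\<lambda>(\<omega>, \<omega>'). mix J \<omega> \<omega>')) (Pi\<^sub>E I A) = emeasure Om ?X * emeasure Om ?Y"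
    using * by (simp add: emeasure_distr P.emeasure_pair_measure_Times)
  also have "\<dots> = (\<Prod>i\<in>I. emeasure (\<mu> i) (if i \<in> J then space (\<mu> i) else A i)) *
                 (\<Prod>i\<in>I. emeasure (\<mu> i) (if i \<in> J then A i else space (\<mu> i)))"
    using A fin_I by (subst (1 2) Om.emeasure_PiM) auto
  also have "\<dots> = (\<Prod>i\<in>I. emeasure (\<mu> i) (A i))"
    unfolding prod.distrib[symmetric] using prob_mu
    by (intro prod.cong) (auto simp: prob_space.emeasure_space_1)
  finally show "emeasure (distr (Om \<Otimes>\<^sub>M Om) Om (\<lambda>(\<omega>, \<omega>'). mix J \<omega> \<omega>')) (Pi\<^sub>E I A) = (\<Prod>i\<in>I. emeasure (\<mu> i) (A i))" .
qed (use fin_I in simp_all)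

lemma resample:
  assumes [measurable]: "f \<in> borel_measurable Om"
  shows "(\<integral>\<^sup>+\<omega>. f \<omega> \<partial>Om) = (\<integral>\<^sup>+\<omega>. \<integral>\<^sup>+\<omega>'. f (mix J \<omega> \<omega>') \<partial>Om \<partial>Om)"
proof -
  have "(\<integral>\<^sup>+\<omega>. f \<omega> \<partial>Om) = (\<integral>\<^sup>+p. f ((\<lambda>(\<omega>, \<omega>'). mix J \<omega> \<omega>') p) \<partial>(Om \<Otimes>\<^sub>M Om))"
    by (subst distr_mix[of J, symmetric], subst nn_integral_distr) auto
  also have "\<dots> = (\<integral>\<^sup>+\<omega>. \<integral>\<^sup>+\<omega>'. f (mix J \<omega> \<omega>') \<partial>Om \<partial>Om)"
    by (subst P.nn_integral_fst[symmetric]) auto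
  finally show ?thesis .
qed

lemma measurable_mix2: "\<omega> \<in> space Om \<Longrightarrow> mix J \<omega> \<in> Om \<rightarrow>\<^sub>M Om"
  using measurable_Pair2[OF measurable_mix, of \<omega> J] by simp

lemma measurable_resample:
  "f \<in> borel_measurable Om \<Longrightarrow> (\<lambda>\<omega>. \<integral>\<^sup>+\<omega>'. f (mix J \<omega> \<omega>') \<partial>Om) \<in> borel_measurable Om"
  by (intro P.borel_measurable_nn_integral) (simp add: case_prod_beta' measurable_compose[OF measurable_mix, unfolded case_prod_beta'])

lemma nn_integral_coord: "x \<in> I \<Longrightarrow> A \<in> sets (\<mu> x) \<Longrightarrow> (\<integral>\<^sup>+\<omega>. indicator A (\<omega> x) \<partial>Om) = emeasure (\<mu> x) A"
proof -
  assume x: "x \<in> I" and A: "A \<in> sets (\<mu> x)"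
  have "(\<integral>\<^sup>+y. indicator A y \<partial>distr Om (\<mu> x) (\<lambda>\<omega>. \<omega> x)) = (\<integral>\<^sup>+\<omega>. indicator A (\<omega> x) \<partial>Om)"
    using x A by (intro nn_integral_distr) auto
  then show ?thesis using A unfolding Om.PiM_component[OF x] by simp
qed

text \<open>The two invariances say that \<open>f\<close> reads only coordinates in \<open>J\<close>
  and \<open>g\<close> only coordinates outside.\<close>

lemma nn_integral_indep:
  assumes [measurable]: "f \<in> borel_measurable Om" "g \<in> borel_measurable Om"
    and f: "\<And>\<omega> \<omega>'. \<omega> \<in> space Om \<Longrightarrow> \<omega>' \<in> space Om \<Longrightarrow> f (mix J \<omega> \<omega>') = f \<omega>'"
    and g: "\<And>\<omega> \<omega>'. \<omega> \<in> space Om \<Longrightarrow> \<omega>' \<in> space Om \<Longrightarrow> g (mix J \<omega> \<omega>') = g \<omega>"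
  shows "(\<integral>\<^sup>+\<omega>. f \<omega> * g \<omega> \<partial>Om) = (\<integral>\<^sup>+\<omega>. f \<omega> \<partial>Om) * (\<integral>\<^sup>+\<omega>. g \<omega> \<partial>Om)"
proof -
  have "(\<integral>\<^sup>+\<omega>. f \<omega> * g \<omega> \<partial>Om) = (\<integral>\<^sup>+\<omega>. \<integral>\<^sup>+\<omega>'. f \<omega>' * g \<omega> \<partial>Om \<partial>Om)"
    by (subst resample[of _ J]) (auto intro!: nn_integral_cong simp: f g)
  also have "\<dots> = (\<integral>\<^sup>+\<omega>. (\<integral>\<^sup>+\<omega>'. f \<omega>' \<partial>Om) * g \<omega> \<partial>Om)"
    by (intro nn_integral_cong nn_integral_multc) auto
  also have "\<dots> = (\<integral>\<^sup>+\<omega>. f \<omega> \<partial>Om) * (\<integral>\<^sup>+\<omega>. g \<omega> \<partial>Om)"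
    by (intro nn_integral_cmult) auto
  finally show ?thesis .
qed

lemma distr_pair:
  assumes X[measurable]: "X \<in> Om \<rightarrow>\<^sub>M M1" and Y[measurable]: "Y \<in> Om \<rightarrow>\<^sub>M M2"
    and XJ: "\<And>\<omega> \<omega>'. \<omega> \<in> space Om \<Longrightarrow> \<omega>' \<in> space Om \<Longrightarrow> X (mix J \<omega> \<omega>') = X \<omega>'"
    and YJ: "\<And>\<omega> \<omega>'. \<omega> \<in> space Om \<Longrightarrow> \<omega>' \<in> space Om \<Longrightarrow> Y (mix J \<omega> \<omega>') = Y \<omega>"
  shows "distr Om M1 X \<Otimes>\<^sub>M distr Om M2 Y = distr Om (M1 \<Otimes>\<^sub>M M2) (\<lambda>\<omega>. (X \<omega>, Y \<omega>))"
proof (rule pair_measure_eqI)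
  show "sigma_finite_measure (distr Om M1 X)" "sigma_finite_measure (distr Om M2 Y)"
    by (simp_all add: P.prob_space_distr prob_space_imp_sigma_finite)
  fix A B assume "A \<in> sets (distr Om M1 X)" "B \<in> sets (distr Om M2 Y)"
  then have [measurable]: "A \<in> sets M1" "B \<in> sets M2" by auto
  have em: "emeasure (distr Om N Z) S = (\<integral>\<^sup>+\<omega>. indicator S (Z \<omega>) \<partial>Om)"
    if "Z \<in> Om \<rightarrow>\<^sub>M N" "S \<in> sets N" for N :: "'z measure" and Z S
    using nn_integral_distr[OF that(1), of "indicator S"] that(2) by simp
  have "emeasure (distr Om (M1 \<Otimes>\<^sub>M M2) (\<lambda>\<omega>. (X \<omega>, Y \<omega>))) (A \<times> B)
      = (\<integral>\<^sup>+\<omega>. indicator (A \<times> B) (X \<omega>, Y \<omega>) \<partial>Om)"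
    by (rule em) auto
  also have "\<dots> = (\<integral>\<^sup>+\<omega>. indicator A (X \<omega>) * indicator B (Y \<omega>) \<partial>Om)"
    by (simp add: indicator_times)
  also have "\<dots> = (\<integral>\<^sup>+\<omega>. indicator A (X \<omega>) \<partial>Om) * (\<integral>\<^sup>+\<omega>. indicator B (Y \<omega>) \<partial>Om)"
    by (rule nn_integral_indep[of _ _ J]) (simp_all add: XJ YJ)
  also have "\<dots> = emeasure (distr Om M1 X) A * emeasure (distr Om M2 Y) B"
    by (subst (1 2) em) auto
  finally show "emeasure (distr Om M1 X) A * emeasure (distr Om M2 Y) B
    = emeasure (distr Om (M1 \<Otimes>\<^sub>M M2) (\<lambda>\<omega>. (X \<omega>, Y \<omega>))) (A \<times> B)" ..
qed simp

lemma permute: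
  assumes [measurable]: "f \<in> borel_measurable Om"
    and \<pi>: "bij_betw \<pi> I I" "\<And>i. i \<in> I \<Longrightarrow> \<mu> (\<pi> i) = \<mu> i"
  shows "(\<integral>\<^sup>+\<omega>. f (\<lambda>i\<in>I. \<omega> (\<pi> i)) \<partial>Om) = (\<integral>\<^sup>+\<omega>. f \<omega> \<partial>Om)"
proof -
  have eq: "PiM I (\<lambda>i. \<mu> (\<pi> i)) = Om" using \<pi>(2) by (intro PiM_cong) auto
  have "distr Om (PiM I (\<lambda>i. \<mu> (\<pi> i))) (\<lambda>\<omega>. \<lambda>i\<in>I. \<omega> (\<pi> i)) = PiM I (\<lambda>i. \<mu> (\<pi> i))"
    using \<pi> by (intro distr_PiM_reindex prob_mu) (auto simp: bij_betw_def)
  then have d: "distr Om Om (\<lambda>\<omega>. \<lambda>i\<in>I. \<omega> (\<pi> i)) = Om" unfolding eq .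
  have m: "(\<lambda>\<omega>. \<lambda>i\<in>I. \<omega> (\<pi> i)) \<in> Om \<rightarrow>\<^sub>M Om"
  proof (rule measurable_restrict)
    fix i assume i: "i \<in> I"
    then have "\<pi> i \<in> I" using \<pi>(1) by (auto simp: bij_betw_def)
    from measurable_component_singleton[OF this, of \<mu>]
    show "(\<lambda>\<omega>. \<omega> (\<pi> i)) \<in> Om \<rightarrow>\<^sub>M \<mu> i" unfolding \<pi>(2)[OF i] .
  qed
  show ?thesis by (subst (2) d[symmetric], subst nn_integral_distr[OF m]) auto
qed

lemma reindex:
  assumes s: "inj_on s K" "s ` K \<subseteq> I" and f[measurable]: "f \<in> borel_measurable (PiM K (\<lambda>j. \<mu> (s j)))"
  shows "(\<integral>\<^sup>+\<omega>. f (\<lambda>j\<in>K. \<omega> (s j)) \<partial>Om) = (\<integral>\<^sup>+x. f x \<partial>PiM K (\<lambda>j. \<mu> (s j)))"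
    and "(\<lambda>\<omega>. \<lambda>j\<in>K. \<omega> (s j)) \<in> Om \<rightarrow>\<^sub>M PiM K (\<lambda>j. \<mu> (s j))"
    and "distr Om (PiM K (\<lambda>j. \<mu> (s j))) (\<lambda>\<omega>. \<lambda>j\<in>K. \<omega> (s j)) = PiM K (\<lambda>j. \<mu> (s j))"
proof -
  show d: "distr Om (PiM K (\<lambda>j. \<mu> (s j))) (\<lambda>\<omega>. \<lambda>j\<in>K. \<omega> (s j)) = PiM K (\<lambda>j. \<mu> (s j))"
    using s by (intro distr_PiM_reindex prob_mu) auto
  show m: "(\<lambda>\<omega>. \<lambda>j\<in>K. \<omega> (s j)) \<in> Om \<rightarrow>\<^sub>M PiM K (\<lambda>j. \<mu> (s j))"
    using s(2) by (intro measurable_restrict measurable_component_singleton) auto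
  show "(\<integral>\<^sup>+\<omega>. f (\<lambda>j\<in>K. \<omega> (s j)) \<partial>Om) = (\<integral>\<^sup>+x. f x \<partial>PiM K (\<lambda>j. \<mu> (s j)))"
    using nn_integral_distr[OF m, of f] f unfolding d by simp
qed

section \<open>Independence of local functions and concentration\<close>

lemma indep_coords: "P.indep_vars \<mu> (\<lambda>i \<omega>. \<omega> i) I"
proof (cases "I = {}")
  case True
  then show ?thesis unfolding P.indep_vars_def P.indep_sets_def by auto
next
  case False
  have "distr Om Om (\<lambda>\<omega>. \<lambda>i\<in>I. \<omega> i) = Om"
  proof -
    have "distr Om Om (\<lambda>\<omega>. \<lambda>i\<in>I. \<omega> i) = distr Om Om (\<lambda>\<omega>. \<omega>)"
      by (intro distr_cong) (auto simp: space_PiM PiE_def extensional_restrict)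
    then show ?thesis by (simp add: distr_id2)
  qed
  moreover have "PiM I (\<lambda>i. distr Om (\<mu> i) (\<lambda>\<omega>. \<omega> i)) = Om"
    by (intro PiM_cong Om.PiM_component) auto
  ultimately show ?thesis using False by (subst P.indep_vars_iff_distr_eq_PiM') auto
qed

lemma indep_vars_cong_space:
  assumes X: "P.indep_vars N X L" and XY: "\<And>j \<omega>. j \<in> L \<Longrightarrow> \<omega> \<in> space Om \<Longrightarrow> X j \<omega> = Y j \<omega>"
  shows "P.indep_vars N Y L"
proof -
  have v: "X j -` A \<inter> space Om = Y j -` A \<inter> space Om" if "j \<in> L" for j A
    using XY[OF that] by auto
  have "P.indep_sets (\<lambda>j. {X j -` A \<inter> space Om |A. A \<in> sets (N j)}) L
      = P.indep_sets (\<lambda>j. {Y j -` A \<inter> space Om |A. A \<in> sets (N j)}) L"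
    by (intro P.indep_sets_cong) (simp_all add: v)
  moreover have "P.random_variable (N j) (Y j) = P.random_variable (N j) (X j)" if "j \<in> L" for j
    using XY[OF that] by (intro measurable_cong) simp
  ultimately show ?thesis using X unfolding P.indep_vars_def2 by simp
qed

lemma indep_vars_local:
  assumes f: "\<And>j. j \<in> L \<Longrightarrow> f j \<in> Om \<rightarrow>\<^sub>M N j"
    and loc: "\<And>j \<omega> \<omega>'. j \<in> L \<Longrightarrow> \<omega> \<in> space Om \<Longrightarrow> \<omega>' \<in> space Om \<Longrightarrow> (\<And>i. i \<in> K j \<Longrightarrow> \<omega> i = \<omega>' i) \<Longrightarrow> f j \<omega> = f j \<omega>'"
    and K: "\<And>j. j \<in> L \<Longrightarrow> K j \<subseteq> I" "disjoint_family_on K L"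
  shows "P.indep_vars N f L"
proof -
  obtain \<omega>0 where \<omega>0: "\<omega>0 \<in> space Om" using P.not_empty by blast
  \<comment> \<open>Locality is only a semantic property of \<open>f j\<close>. Filling the other
    coordinates from a fixed outcome turns \<open>f j\<close> into a function of the restriction to
    \<open>K j\<close>.\<close>
  let ?ext = "\<lambda>j x. \<lambda>i\<in>I. if i \<in> K j then x i else \<omega>0 i"
  have ext: "?ext j \<in> PiM (K j) \<mu> \<rightarrow>\<^sub>M Om" for j
  proof -
    have "(\<lambda>x. if i \<in> K j then x i else \<omega>0 i) \<in> PiM (K j) \<mu> \<rightarrow>\<^sub>M \<mu> i" if "i \<in> I" for i
    proof -
      have "\<omega>0 i \<in> space (\<mu> i)" using \<omega>0 that by (auto simp: space_PiM)
      then show ?thesis by (cases "i \<in> K j") auto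
    qed
    then show ?thesis by (intro measurable_restrict) auto
  qed
  have 1: "P.indep_vars N (\<lambda>j \<omega>. f j (?ext j (restrict \<omega> (K j)))) L"
  proof (rule P.indep_vars_compose2[where M' = "\<lambda>j. PiM (K j) \<mu>" and X = "\<lambda>j \<omega>. restrict \<omega> (K j)"
        and Y = "\<lambda>j x. f j (?ext j x)"])
    show "P.indep_vars (\<lambda>j. PiM (K j) \<mu>) (\<lambda>j \<omega>. restrict \<omega> (K j)) L"
      using P.indep_vars_restrict[OF indep_coords K] by simp
    show "(\<lambda>x. f j (?ext j x)) \<in> PiM (K j) \<mu> \<rightarrow>\<^sub>M N j" if "j \<in> L" for j
      using measurable_compose[OF ext f] that by simp
  qed
  have 2: "f j (?ext j (restrict \<omega> (K j))) = f j \<omega>" if j: "j \<in> L" and \<omega>: "\<omega> \<in> space Om" for j \<omega>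
  proof (rule loc[OF j])
    show "?ext j (restrict \<omega> (K j)) \<in> space Om"
      using \<omega> \<omega>0 by (auto simp: space_PiM PiE_def Pi_def)
  qed (use K(1)[OF j] \<omega> in auto)
  show ?thesis by (rule indep_vars_cong_space[OF 1 2])
qed

lemma Hoeffding_events:
  fixes A :: "'l \<Rightarrow> ('i \<Rightarrow> 'b) \<Rightarrow> bool" and p e :: real
  assumes L: "finite L" "L \<noteq> {}" and A[measurable]: "\<And>j. j \<in> L \<Longrightarrow> Measurable.pred Om (A j)"
    and loc: "\<And>j \<omega> \<omega>'. j \<in> L \<Longrightarrow> \<omega> \<in> space Om \<Longrightarrow> \<omega>' \<in> space Om \<Longrightarrow> (\<And>i. i \<in> K j \<Longrightarrow> \<omega> i = \<omega>' i) \<Longrightarrow> A j \<omega> = A j \<omega>'"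
    and K: "\<And>j. j \<in> L \<Longrightarrow> K j \<subseteq> I" "disjoint_family_on K L"
    and p: "\<And>j. j \<in> L \<Longrightarrow> P.prob {\<omega> \<in> space Om. A j \<omega>} = p" and e: "e \<ge> 0"
  shows "emeasure Om {\<omega> \<in> space Om. \<bar>real (card {j \<in> L. A j \<omega>}) - card L * p\<bar> \<ge> e * card L}
    \<le> ennreal (2 * exp (- 2 * e\<^sup>2 * card L))"
proof -
  let ?X = "\<lambda>j \<omega>. indicator {\<omega> \<in> space Om. A j \<omega>} \<omega> :: real"
  have ind: "P.indep_vars (\<lambda>_. borel) ?X L"
  proof (rule indep_vars_local[OF _ _ K])
    fix j \<omega> \<omega>' assume "j \<in> L" "\<omega> \<in> space Om" "\<omega>' \<in> space Om" "\<And>i. i \<in> K j \<Longrightarrow> \<omega> i = \<omega>' i"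
    then show "?X j \<omega> = ?X j \<omega>'" using loc[of j \<omega> \<omega>'] by (simp add: indicator_def)
  qed auto
  interpret H: Hoeffding_ineq Om L ?X "\<lambda>_. 0" "\<lambda>_. 1" "\<Sum>j\<in>L. P.expectation (?X j)"
    by unfold_locales (use L ind in \<open>auto simp: indicator_def\<close>)
  have mu: "(\<Sum>j\<in>L. P.expectation (?X j)) = card L * p"
    using p by (simp add: Int_def conj_commute cong: conj_cong)
  have sum: "(\<Sum>j\<in>L. ?X j \<omega>) = real (card {j \<in> L. A j \<omega>})" if "\<omega> \<in> space Om" for \<omega>
    using L that by (simp add: indicator_def sum.If_cases Int_def)
  have "P.prob {\<omega> \<in> space Om. \<bar>(\<Sum>j\<in>L. ?X j \<omega>) - card L * p\<bar> \<ge> e * card L}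
     \<le> 2 * exp (- 2 * (e * card L)\<^sup>2 / (\<Sum>j\<in>L. (1 - 0)\<^sup>2))"
    using H.Hoeffding_ineq_abs_ge[of "e * card L"] L e unfolding mu by (simp add: card_gt_0_iff)
  also have "- 2 * (e * card L)\<^sup>2 / (\<Sum>j\<in>L. (1 - 0)\<^sup>2) = - 2 * e\<^sup>2 * card L"
    using L by (simp add: power2_eq_square)
  also have "{\<omega> \<in> space Om. \<bar>(\<Sum>j\<in>L. ?X j \<omega>) - card L * p\<bar> \<ge> e * card L}
      = {\<omega> \<in> space Om. \<bar>real (card {j \<in> L. A j \<omega>}) - card L * p\<bar> \<ge> e * card L}"
    using sum by auto
  finally show ?thesis by (simp add: P.emeasure_eq_measure)
qed

end

section \<open>The algorithm\<close>

declare One_nat_def [simp del]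

context finite_matroid
begin

text \<open>The column's own copy of \<open>i\<close> is removed, so that the estimated event is
  independent of whether \<open>i\<close> itself is active.\<close>

definition spanned_cols :: "nat \<Rightarrow> (nat \<Rightarrow> 'a set) \<Rightarrow> nat \<Rightarrow> 'a set \<Rightarrow> 'a set \<Rightarrow> 'a \<Rightarrow> nat set" where
  "spanned_cols K qs c N S i = {b \<in> {c..<c + K}. i \<in> spn ((qs b \<inter> N - {i}) \<union> S)}"

text \<open>Every round looks at a block of \<open>K\<close> columns of its own, so that the set it starts from is
  independent of these columns.\<close>

fun stage :: "nat \<Rightarrow> nat \<Rightarrow> nat \<Rightarrow> real \<Rightarrow> (nat \<Rightarrow> 'a set) \<Rightarrow> nat \<Rightarrow> 'a set \<Rightarrow> nat \<Rightarrow> 'a set" where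
  "stage off K T e qs d N 0 = {}"
| "stage off K T e qs d N (Suc t) = stage off K T e qs d N t \<union>
     {i \<in> N. (1/2 + 3 * e) * K \<le> card (spanned_cols K qs (off + (d * T + t) * K) N (stage off K T e qs d N t) i)}"

text \<open>The successor in \<open>Suc (ts d)\<close> means that at least one round is run: an item
  left outside has then been tested against stage \<open>ts d\<close> by the last round.\<close>

fun chain :: "nat \<Rightarrow> nat \<Rightarrow> nat \<Rightarrow> real \<Rightarrow> (nat \<Rightarrow> 'a set) \<Rightarrow> (nat \<Rightarrow> nat) \<Rightarrow> nat \<Rightarrow> 'a set" where
  "chain off K T e qs ts 0 = U"
| "chain off K T e qs ts (Suc d) = stage off K T e qs d (chain off K T e qs ts d) (Suc (ts d))"

lemma stage_subset: "stage off K T e qs d N t \<subseteq> N"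
  by (induction t) auto

lemma stage_mono: "t \<le> t' \<Longrightarrow> stage off K T e qs d N t \<subseteq> stage off K T e qs d N t'"
  by (induction rule: dec_induct) auto

lemma chain_Suc_subset: "chain off K T e qs ts (Suc d) \<subseteq> chain off K T e qs ts d"
  using stage_subset by (simp del: stage.simps)

lemma chain_antimono: "d \<le> d' \<Longrightarrow> chain off K T e qs ts d' \<subseteq> chain off K T e qs ts d"
  by (induction rule: dec_induct) (use chain_Suc_subset in blast)+

lemma chain_subset: "chain off K T e qs ts d \<subseteq> U"
  using chain_antimono[of 0 d off K T e qs ts] by simp

lemma chain_level_unique:
  assumes "i \<in> chain off K T e qs ts d - chain off K T e qs ts (Suc d)"
    "i \<in> chain off K T e qs ts d' - chain off K T e qs ts (Suc d')"
  shows "d = d'"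
proof (rule ccontr)
  assume "d \<noteq> d'"
  then consider "Suc d \<le> d'" | "Suc d' \<le> d" by linarith
  then show False using assms chain_antimono[of _ _ off K T e qs ts] by cases blast+
qed

text \<open>A stage reads only columns before the block of the round that follows it. This is the
  source of the independence of that block.\<close>

lemma stage_cong:
  assumes "\<And>c. c < off + (d * T + t) * K \<Longrightarrow> qs c = qs' c"
  shows "stage off K T e qs d N t = stage off K T e qs' d N t"
  using assms
proof (induction t)
  case (Suc t)
  have IH: "stage off K T e qs d N t = stage off K T e qs' d N t"
    by (intro Suc.IH Suc.prems) simp
  have "spanned_cols K qs (off + (d * T + t) * K) N S i = spanned_cols K qs' (off + (d * T + t) * K) N S i" for S i
    unfolding spanned_cols_def using Suc.prems by (intro Collect_cong) (auto simp: algebra_simps)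
  then show ?case using IH by simp
qed simp

lemma chain_cong:
  assumes "\<And>c. c < off + d * T * K \<Longrightarrow> qs c = qs' c" "\<And>d'. d' < d \<Longrightarrow> ts d' = ts' d'"
    and ts: "\<And>d'. ts d' < T"
  shows "chain off K T e qs ts d = chain off K T e qs' ts' d"
  using assms(1,2)
proof (induction d)
  case (Suc d)
  have "off + d * T * K \<le> off + Suc d * T * K" by simp
  then have IH: "chain off K T e qs ts d = chain off K T e qs' ts' d"
    by (intro Suc.IH Suc.prems) linarith+
  have "stage off K T e qs d N (Suc (ts d)) = stage off K T e qs' d N (Suc (ts d))" for N
  proof (rule stage_cong)
    fix c assume "c < off + (d * T + Suc (ts d)) * K"
    moreover have "(d * T + Suc (ts d)) * K \<le> Suc d * T * K"
      using ts[of d] by (intro mult_right_mono) auto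
    ultimately show "qs c = qs' c" by (intro Suc.prems(1)) linarith
  qed
  then show ?case using IH Suc.prems(2)[of d] by (simp del: stage.simps)
qed simp

end

text \<open>Lexicographic comparison of value and priority. It is weak, so a tie counts against the
  item that is tested; continuous priorities make ties null events even when the values have
  atoms.\<close>

definition beats :: "real \<times> real \<Rightarrow> real \<times> real \<Rightarrow> bool" where
  "beats x y \<longleftrightarrow> fst y < fst x \<or> (fst x = fst y \<and> snd y \<le> snd x)"

lemma beats_total: "beats x y \<or> beats y x" by (auto simp: beats_def)

lemma beats_trans: "beats x y \<Longrightarrow> beats y z \<Longrightarrow> beats x z" by (auto simp: beats_def)

lemma pred_lex:
  fixes a b c d :: "'z \<Rightarrow> real"
  assumes [measurable]: "a \<in> borel_measurable M" "b \<in> borel_measurable M" "c \<in> borel_measurable M" "d \<in> borel_measurable M"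
  shows "Measurable.pred M (\<lambda>x. b x < a x \<or> a x = b x \<and> d x \<le> c x)"
  by measurable

type_synonym coord = "nat \<times> nat \<times> nat"

text \<open>All the randomness is a vector of reals indexed by \<open>coord\<close>: \<open>(0, j, l)\<close> is the value and
  \<open>(1, j, l)\<close> the tie-breaking priority in slot \<open>l\<close> of item \<open>j\<close>, where slot 0 is the online value
  and the slots \<open>l \<ge> 1\<close> are the samples; \<open>(2, j, l)\<close> is the coin deciding whether slot \<open>l \<le> L\<close>
  is used for training, and \<open>(3, d, 0)\<close> determines after which round level \<open>d\<close> stops.\<close>

locale prophet_alg = finite_matroid "{1..n}" Ind for n :: nat and Ind +
  fixes C L K T Dp :: nat and e :: real
  assumes T_pos: "T > 0"
begin

abbreviation U :: "nat set" where "U \<equiv> {1..n}"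

section \<open>The decision rule and its feasibility\<close>

definition num_samples :: nat where "num_samples = L + Dp * T * K"

definition sig :: "(coord \<Rightarrow> real) \<Rightarrow> nat \<Rightarrow> nat \<Rightarrow> real \<times> real" where
  "sig \<omega> j l = (\<omega> (0, j, l), \<omega> (1, j, l))"

definition train :: "(coord \<Rightarrow> real) \<Rightarrow> nat \<Rightarrow> nat set" where
  "train \<omega> j = {l \<in> {1..L}. \<omega> (2, j, l) > 1/2}"

definition cnt :: "(coord \<Rightarrow> real) \<Rightarrow> real \<times> real \<Rightarrow> nat \<Rightarrow> nat" where
  "cnt \<omega> x j = card {l \<in> train \<omega> j. beats (sig \<omega> j l) x}"

definition act :: "(coord \<Rightarrow> real) \<Rightarrow> nat \<Rightarrow> real \<times> real \<Rightarrow> bool" where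
  "act \<omega> j x \<longleftrightarrow> \<not> blocked C (cnt \<omega> x) j"

definition Q :: "(coord \<Rightarrow> real) \<Rightarrow> nat \<Rightarrow> nat set" where
  "Q \<omega> b = {j \<in> U. act \<omega> j (sig \<omega> j b)}"

text \<open>Uniform on the indices below \<open>T\<close> if the coordinate is uniform on the unit
  interval; the minimum takes care of the endpoint 1, where the floor is \<open>T\<close>.\<close>

definition stp :: "(coord \<Rightarrow> real) \<Rightarrow> nat \<Rightarrow> nat" where
  "stp \<omega> d = min (T - 1) (nat \<lfloor>real T * \<omega> (3, d, 0)\<rfloor>)"

definition NN :: "(nat \<Rightarrow> nat set) \<Rightarrow> (nat \<Rightarrow> nat) \<Rightarrow> nat \<Rightarrow> nat set" where
  "NN qs ts d = chain (Suc L) K T e qs ts d"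

text \<open>The span is taken over all earlier active items of the level, accepted or not, so the
  rule needs no recursion over its own decisions. The level is unique if it exists; items still
  present after \<open>Dp\<close> levels are rejected.\<close>

definition acc :: "(coord \<Rightarrow> real) \<Rightarrow> nat \<Rightarrow> bool" where
  "acc \<omega> i \<longleftrightarrow> i \<in> Q \<omega> 0 \<and> (\<exists>d<Dp. i \<in> NN (Q \<omega>) (stp \<omega>) d - NN (Q \<omega>) (stp \<omega>) (Suc d) \<and>
     i \<notin> spn ((Q \<omega> 0 \<inter> {..<i} \<inter> NN (Q \<omega>) (stp \<omega>) d) \<union> NN (Q \<omega>) (stp \<omega>) (Suc d)))"

lemma stp_less [simp]: "stp \<omega> d < T" using T_pos unfolding stp_def by simp

lemma NN_subset: "NN qs ts d \<subseteq> U" unfolding NN_def by (rule chain_subset)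

lemma NN_cong:
  assumes "\<And>c. c \<in> {Suc L..num_samples} \<Longrightarrow> qs c = qs' c" "\<And>d'. d' < Dp \<Longrightarrow> ts d' = ts' d'"
    "\<And>d'. ts d' < T" "d \<le> Dp"
  shows "NN qs ts d = NN qs' ts' d"
proof -
  \<comment> \<open>\<open>chain_cong\<close> asks for agreement on all columns below a bound. The
    columns up to \<open>L\<close>, never read by the chain, are blanked out to meet this.\<close>
  let ?q = "\<lambda>c. if c < Suc L then {} else qs c" and ?q' = "\<lambda>c. if c < Suc L then {} else qs' c"
  have low: "chain (Suc L) K T e qs ts d = chain (Suc L) K T e (\<lambda>c. if c < Suc L then {} else qs c) ts d" for qs ts d
  proof -
    have st: "stage (Suc L) K T e qs d N t = stage (Suc L) K T e (\<lambda>c. if c < Suc L then {} else qs c) d N t" for d N t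
    proof (induction t)
      case (Suc t)
      have "spanned_cols K qs (Suc L + (d * T + t) * K) N S i = spanned_cols K (\<lambda>c. if c < Suc L then {} else qs c) (Suc L + (d * T + t) * K) N S i" for S i
        unfolding spanned_cols_def by (intro Collect_cong) auto
      then show ?case using Suc by simp
    qed simp
    show ?thesis by (induction d) (simp_all add: st del: stage.simps)
  qed
  have le: "d * T * K \<le> Dp * T * K" using assms(4) by (intro mult_right_mono) auto
  have "chain (Suc L) K T e ?q ts d = chain (Suc L) K T e ?q' ts' d"
  proof (intro chain_cong)
    fix c assume "c < Suc L + d * T * K"
    then have "\<not> c < Suc L \<Longrightarrow> c \<in> {Suc L..num_samples}" using le unfolding num_samples_def atLeastAtMost_iff by linarith
    then show "?q c = ?q' c" using assms(1) by auto
  qed (use assms(2-4) in auto)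
  then show ?thesis unfolding NN_def using low by metis
qed

text \<open>The accepted set is assembled from the innermost level outwards and, inside a level, in
  order of arrival. The set against which an item was tested contains everything assembled before
  it, so each item is unspanned when it is added.\<close>

lemma acc_Ind: "{i \<in> U. acc \<omega> i} \<in> Ind"
proof -
  let ?N = "NN (Q \<omega>) (stp \<omega>)" and ?A = "{i \<in> U. acc \<omega> i}"
  have N_anti: "?N d' \<subseteq> ?N d" if "d \<le> d'" for d d' unfolding NN_def by (rule chain_antimono[OF that])
  have "?A \<inter> ?N d \<in> Ind" if "d \<le> Dp" for d
    using that
  proof (induction d rule: inc_induct)
    case base
    have "i \<notin> ?N Dp" if "acc \<omega> i" for i
      using that N_anti[of "Suc _" Dp] unfolding acc_def by (metis DiffD2 Suc_leI subsetD)
    then have "?A \<inter> ?N Dp = {}" by auto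
    then show ?case using empty_Ind by simp
  next
    case (step d)
    have "(?A \<inter> ?N (Suc d)) \<union> (?A \<inter> ?N d \<inter> {..<m}) \<in> Ind" for m
    proof (induction m)
      case 0 then show ?case using step.IH by simp
    next
      case (Suc m)
      let ?X = "(?A \<inter> ?N (Suc d)) \<union> (?A \<inter> ?N d \<inter> {..<m})"
      show ?case
      proof (cases "m \<in> ?A \<inter> ?N d - ?N (Suc d)")
        case True
        then obtain d' where d': "m \<in> ?N d' - ?N (Suc d')"
          "m \<notin> spn ((Q \<omega> 0 \<inter> {..<m} \<inter> ?N d') \<union> ?N (Suc d'))" unfolding acc_def by auto
        have "d' = d" using chain_level_unique[of m] d'(1) True unfolding NN_def by blast
        moreover have "?X \<subseteq> (Q \<omega> 0 \<inter> {..<m} \<inter> ?N d) \<union> ?N (Suc d)" unfolding acc_def by auto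
        ultimately have "m \<notin> spn ?X" using d'(2) spn_mono by blast
        then have "insert m ?X \<in> Ind" using Suc True by (intro Ind_insert) auto
        moreover have "insert m ?X = (?A \<inter> ?N (Suc d)) \<union> (?A \<inter> ?N d \<inter> {..<Suc m})"
          using True by (auto simp: less_Suc_eq)
        ultimately show ?thesis by simp
      next
        case False
        then have "(?A \<inter> ?N (Suc d)) \<union> (?A \<inter> ?N d \<inter> {..<Suc m}) = ?X"
          by (auto simp: less_Suc_eq)
        then show ?thesis using Suc by simp
      qed
    qed
    from this[of "Suc n"] have "?A \<inter> ?N d \<inter> {..<Suc n} \<in> Ind" using Ind_down by blast
    moreover have "?A \<inter> ?N d \<inter> {..<Suc n} = ?A \<inter> ?N d" by auto
    ultimately show ?case by simp
  qed
  from this[of 0] show ?thesis by (simp add: NN_def Int_absorb2 subset_iff)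
qed

section \<open>Coordinates of the randomness and measurability of the rule\<close>

definition Idx :: "coord set" where
  "Idx = {0, 1} \<times> U \<times> {0..num_samples} \<union> {2} \<times> U \<times> {1..L} \<union> {3} \<times> {..<Dp} \<times> {0}"

lemma finite_Idx: "finite Idx" unfolding Idx_def by auto

lemma Idx_simps [simp]:
  "(0, j, l) \<in> Idx \<longleftrightarrow> j \<in> U \<and> l \<le> num_samples" "(1, j, l) \<in> Idx \<longleftrightarrow> j \<in> U \<and> l \<le> num_samples"
  "(2, j, l) \<in> Idx \<longleftrightarrow> j \<in> U \<and> l \<in> {1..L}" "(3, j, l) \<in> Idx \<longleftrightarrow> j < Dp \<and> l = 0"
  unfolding Idx_def by auto

lemma L_le_num_samples: "L \<le> num_samples" unfolding num_samples_def by simp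

lemma act_cong:
  assumes "\<And>j l. j \<in> U \<Longrightarrow> l \<in> {1..L} \<Longrightarrow> (\<omega> (2, j, l) > 1/2) = (\<omega>' (2, j, l) > 1/2)"
    and "\<And>j l. j \<in> U \<Longrightarrow> l \<in> {1..L} \<Longrightarrow> beats (sig \<omega> j l) x = beats (sig \<omega>' j l) x'"
    and "i \<in> U"
  shows "act \<omega> i x = act \<omega>' i x'"
proof -
  have c: "cnt \<omega> x j = cnt \<omega>' x' j" if "j \<in> U" for j
    unfolding cnt_def train_def using assms(1,2)[OF that] by (intro arg_cong[of _ _ card]) auto
  \<comment> \<open>The count functions agree only on \<open>U\<close>; monotonicity in both
    directions replaces their equality.\<close>
  have "blocked C (cnt \<omega> x) i = blocked C (cnt \<omega>' x') i"
    using blocked_mono[of C "cnt \<omega> x" i "cnt \<omega>' x'"] blocked_mono[of C "cnt \<omega>' x'" i "cnt \<omega> x"] c by auto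
  then show ?thesis unfolding act_def by simp
qed

lemma Q_cong:
  assumes "\<And>x. x \<in> Idx \<Longrightarrow> \<omega> x = \<omega>' x" "b \<le> num_samples"
  shows "Q \<omega> b = Q \<omega>' b"
  unfolding Q_def using assms L_le_num_samples
  by (intro Collect_cong conj_cong refl act_cong) (auto simp: sig_def)

text \<open>These are the bits that decide on \<open>i\<close>. The restriction to online activities
  of items up to \<open>i\<close> is what makes the rule online.\<close>

lemma acc_pattern:
  assumes q: "\<And>c j. c \<in> {Suc L..num_samples} \<Longrightarrow> j \<in> U \<Longrightarrow> act \<omega> j (sig \<omega> j c) = act \<omega>' j (sig \<omega>' j c)"
    and q0: "\<And>j. j \<in> U \<Longrightarrow> j \<le> i \<Longrightarrow> act \<omega> j (sig \<omega> j 0) = act \<omega>' j (sig \<omega>' j 0)"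
    and st: "\<And>d. d < Dp \<Longrightarrow> stp \<omega> d = stp \<omega>' d"
  shows "acc \<omega> i = acc \<omega>' i"
proof -
  have "Q \<omega> c = Q \<omega>' c" if "c \<in> {Suc L..num_samples}" for c unfolding Q_def using q[OF that] by auto
  then have N: "NN (Q \<omega>) (stp \<omega>) d = NN (Q \<omega>') (stp \<omega>') d" if "d \<le> Dp" for d
    using that st by (intro NN_cong) auto
  have 1: "Q \<omega> 0 \<inter> {..<i} = Q \<omega>' 0 \<inter> {..<i}" and 2: "i \<in> Q \<omega> 0 \<longleftrightarrow> i \<in> Q \<omega>' 0"
    using q0 unfolding Q_def by auto
  show ?thesis unfolding acc_def 1 2 using N by (metis Suc_leI less_imp_le)
qed

abbreviation BB :: "(coord \<Rightarrow> real) measure" where "BB \<equiv> PiM Idx (\<lambda>_. borel)"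

lemma pred_beats:
  assumes "j \<in> U" "l \<le> num_samples" "j' \<in> U" "l' \<le> num_samples"
  shows "Measurable.pred BB (\<lambda>\<omega>. beats (sig \<omega> j l) (sig \<omega> j' l'))"
proof -
  have [measurable]: "(\<lambda>\<omega>. \<omega> (0, j, l)) \<in> borel_measurable BB" "(\<lambda>\<omega>. \<omega> (1, j, l)) \<in> borel_measurable BB"
    "(\<lambda>\<omega>. \<omega> (0, j', l')) \<in> borel_measurable BB" "(\<lambda>\<omega>. \<omega> (1, j', l')) \<in> borel_measurable BB"
    by (rule measurable_component_singleton, use assms in simp)+
  show ?thesis unfolding beats_def sig_def fst_conv snd_conv by (rule pred_lex) fact+
qed

lemma pred_label:
  assumes "j \<in> U" "l \<in> {1..L}" shows "Measurable.pred BB (\<lambda>\<omega>. \<omega> (2, j, l) > 1/2)"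
proof -
  have [measurable]: "(2, j, l) \<in> Idx" using assms by auto
  show ?thesis by simp
qed

lemma pred_stp:
  assumes "d < Dp" shows "Measurable.pred BB (\<lambda>\<omega>. stp \<omega> d = t)"
proof -
  have [measurable]: "(3, d, 0) \<in> Idx" using assms by auto
  show ?thesis unfolding stp_def by simp
qed

lemma pred_act:
  assumes "j \<in> U" "b \<le> num_samples"
  shows "Measurable.pred BB (\<lambda>\<omega>. act \<omega> j (sig \<omega> j b))"
proof (rule measurable_pattern)
  let ?S = "{True, False} \<times> U \<times> {1..L}"
  let ?P = "\<lambda>(k, j', l) \<omega>. if k then \<omega> (2, j', l) > 1/2 else beats (sig \<omega> j' l) (sig \<omega> j b)"
  show "finite ?S" by simp
  show "Measurable.pred BB (?P s)" if "s \<in> ?S" for s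
    using that pred_label pred_beats assms L_le_num_samples by (auto split: prod.splits)
  show "act \<omega> j (sig \<omega> j b) = act \<omega>' j (sig \<omega>' j b)"
    if *: "\<And>s. s \<in> ?S \<Longrightarrow> ?P s \<omega> = ?P s \<omega>'" for \<omega> \<omega>'
  proof (rule act_cong)
    show "(\<omega> (2, j, l) > 1/2) = (\<omega>' (2, j, l) > 1/2)" if "j \<in> U" "l \<in> {1..L}" for j l
      using *[of "(True, j, l)"] that by simp
    show "beats (sig \<omega> j' l) (sig \<omega> j b) = beats (sig \<omega>' j' l) (sig \<omega>' j b)" if "j' \<in> U" "l \<in> {1..L}" for j' l
      using *[of "(False, j', l)"] that by simp
  qed fact
qed

lemma pred_acc: "Measurable.pred BB (\<lambda>\<omega>. acc \<omega> i)"
proof (rule measurable_pattern)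
  let ?S = "Inl ` (U \<times> {0..num_samples}) \<union> Inr ` ({..<Dp} \<times> {..<T})"
  let ?P = "\<lambda>s \<omega>. case s of Inl (j, c) \<Rightarrow> act \<omega> j (sig \<omega> j c) | Inr (d, t) \<Rightarrow> stp \<omega> d = t"
  show "finite ?S" by simp
  show "Measurable.pred BB (?P s)" if "s \<in> ?S" for s
    using that pred_act pred_stp by auto
  show "acc \<omega> i = acc \<omega>' i" if *: "\<And>s. s \<in> ?S \<Longrightarrow> ?P s \<omega> = ?P s \<omega>'" for \<omega> \<omega>'
  proof (rule acc_pattern)
    show "stp \<omega> d = stp \<omega>' d" if "d < Dp" for d
      using *[of "Inr (d, stp \<omega> d)"] that by simp
    show "act \<omega> j (sig \<omega> j c) = act \<omega>' j (sig \<omega>' j c)" if "c \<in> {Suc L..num_samples}" "j \<in> U" for c j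
      using *[of "Inl (j, c)"] that by simp
    show "act \<omega> j (sig \<omega> j 0) = act \<omega>' j (sig \<omega>' j 0)" if "j \<in> U" "j \<le> i" for j
      using *[of "Inl (j, 0)"] that by simp
  qed
qed

text \<open>Rebuilds the vector over \<open>coord\<close> from seed, samples and revealed values.
  Seeds are indexed by naturals, so priorities, coins and stopping coordinates are stored under
  their codes.\<close>

definition assemble :: "(nat \<Rightarrow> real) \<Rightarrow> (nat \<times> nat \<Rightarrow> real) \<Rightarrow> (nat \<Rightarrow> real) \<Rightarrow> coord \<Rightarrow> real" where
  "assemble r s w = (\<lambda>(\<kappa>, j, l). if \<kappa> = 0 then (if l = 0 then w j else s (j, l)) else r (to_nat (\<kappa>, j, l)))"

definition unif :: "real measure" where "unif = uniform_measure lborel {0..1}"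

definition seed_coords :: "coord set" where "seed_coords = {x \<in> Idx. fst x \<noteq> 0}"

definition the_alg :: online_alg where
  "the_alg = \<lparr>seed = PiM (to_nat ` seed_coords) (\<lambda>_. unif), accept = (\<lambda>i r s w. acc (assemble r s w) i)\<rparr>"

lemma prob_unif: "prob_space unif" unfolding unif_def by (intro prob_space_uniform_measure) auto

lemma sets_unif [simp, measurable_cong]: "sets unif = sets borel" unfolding unif_def by simp

lemma acc_assemble_cong:
  assumes "i \<in> U" "\<And>j. j \<le> i \<Longrightarrow> j \<in> U \<Longrightarrow> w j = w' j"
  shows "acc (assemble r s w) i = acc (assemble r s w') i"
proof -
  have sg: "sig (assemble r s w) j l = sig (assemble r s w') j l" if "l > 0 \<or> j \<le> i" "j \<in> U" for j l
    unfolding sig_def assemble_def using that assms(2)[of j] by auto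
  have a: "act (assemble r s w) j x = act (assemble r s w') j x" if "j \<in> U" for j x
    by (rule act_cong[OF _ _ that]) (auto simp: sg, simp_all add: assemble_def)
  show ?thesis
  proof (rule acc_pattern)
    show "stp (assemble r s w) d = stp (assemble r s w') d" for d unfolding stp_def assemble_def by simp
  qed (use a sg in auto)
qed

lemma selected_the_alg: "m \<le> n \<Longrightarrow> selected the_alg m r s v = {i \<in> {1..m}. acc (assemble r s v) i}"
  unfolding selected_def
proof (intro Collect_cong conj_cong refl)
  fix i assume "m \<le> n" "i \<in> {1..m}"
  then show "accept the_alg i r s (restrict v {1..i}) = acc (assemble r s v) i"
    using acc_assemble_cong[of i "restrict v {1..i}" v r s] by (simp add: the_alg_def)
qed

lemma online_the_alg: "online_algorithm n num_samples Ind the_alg"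
  unfolding online_algorithm_def
proof (intro conjI ballI allI impI)
  show "prob_space (seed the_alg)" unfolding the_alg_def by (simp add: prob_space_PiM prob_unif)
next
  fix i assume i: "i \<in> {1..n}"
  let ?M = "seed the_alg \<Otimes>\<^sub>M ((\<Pi>\<^sub>M p\<in>{1..n} \<times> {1..num_samples}. (borel :: real measure)) \<Otimes>\<^sub>M (\<Pi>\<^sub>M j\<in>{1..i}. (borel :: real measure)))"
  \<comment> \<open>Values that have not arrived are set to 0 to obtain a measurable map into
    \<open>BB\<close>; \<open>acc_assemble_cong\<close> shows that this choice does not influence
    the decision on \<open>i\<close>.\<close>
  let ?w = "\<lambda>w j. if j \<in> {1..i} then w j else 0"
  let ?\<Phi> = "\<lambda>(r, s, w). \<lambda>x\<in>Idx. assemble r s (?w w) x"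
  have "?\<Phi> \<in> ?M \<rightarrow>\<^sub>M BB"
  proof -
    have "(\<lambda>(r, s, w). assemble r s (?w w) x) \<in> ?M \<rightarrow>\<^sub>M borel" if "x \<in> Idx" for x
    proof -
      obtain \<kappa> j l where x: "x = (\<kappa>, j, l)" by (cases x)
      consider "\<kappa> = 0" "l = 0" "j \<in> {1..i}" | "\<kappa> = 0" "l = 0" "j \<notin> {1..i}" | "\<kappa> = 0" "l \<noteq> 0" | "\<kappa> \<noteq> 0" by blast
      then show ?thesis
      proof cases
        case 3
        then have "(j, l) \<in> {1..n} \<times> {1..num_samples}" using that unfolding x by auto
        then have "(\<lambda>p. fst (snd p) (j, l)) \<in> ?M \<rightarrow>\<^sub>M borel"
          by (intro measurable_compose[OF measurable_compose[OF measurable_snd measurable_fst] measurable_component_singleton])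
        then show ?thesis unfolding x assemble_def using 3 by (simp add: case_prod_beta')
      next
        case 4
        then have [measurable]: "to_nat (\<kappa>, j, l) \<in> to_nat ` seed_coords" using that unfolding x seed_coords_def by auto
        show ?thesis unfolding x assemble_def the_alg_def using 4 by simp
      qed (auto simp: x assemble_def)
    qed
    then show ?thesis unfolding case_prod_beta' by (intro measurable_restrict) auto
  qed
  from measurable_compose[OF this pred_acc[of i]]
  have "Measurable.pred ?M (\<lambda>p. acc (?\<Phi> p) i)" .
  moreover have "acc (?\<Phi> p) i = (case p of (r, s, w) \<Rightarrow> accept the_alg i r s w)" for p
  proof -
    obtain r s w where p: "p = (r, s, w)" by (cases p)
    have "acc (?\<Phi> p) i = acc (assemble r s (?w w)) i"
    proof (rule acc_pattern)
      fix c j assume "c \<in> {Suc L..num_samples}" "j \<in> U"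
      have "Q (?\<Phi> p) c = Q (assemble r s (?w w)) c" unfolding p using \<open>c \<in> _\<close> by (intro Q_cong) auto
      then show "act (?\<Phi> p) j (sig (?\<Phi> p) j c) = act (assemble r s (?w w)) j (sig (assemble r s (?w w)) j c)"
        using \<open>j \<in> U\<close> unfolding Q_def by blast
    next
      fix j assume "j \<in> U"
      have "Q (?\<Phi> p) 0 = Q (assemble r s (?w w)) 0" unfolding p by (intro Q_cong) auto
      then show "act (?\<Phi> p) j (sig (?\<Phi> p) j 0) = act (assemble r s (?w w)) j (sig (assemble r s (?w w)) j 0)"
        using \<open>j \<in> U\<close> unfolding Q_def by blast
    next
      show "stp (?\<Phi> p) d = stp (assemble r s (?w w)) d" if "d < Dp" for d
        unfolding p stp_def using that by simp
    qed
    also have "\<dots> = acc (assemble r s w) i" by (rule acc_assemble_cong[OF i]) auto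
    finally show ?thesis unfolding p the_alg_def by simp
  qed
  ultimately show "Measurable.pred ?M (\<lambda>(r, s, w). accept the_alg i r s w)" by simp
next
  fix r s v m assume "m \<le> n"
  then have "selected the_alg m r s v \<subseteq> {i \<in> U. acc (assemble r s v) i}"
    by (subst selected_the_alg) auto
  then show "selected the_alg m r s v \<in> Ind" using acc_Ind Ind_down by blast
qed

end

section \<open>Fixed value distributions\<close>

locale prophet_instance = prophet_alg +
  fixes D :: "nat \<Rightarrow> real measure"
  assumes D: "\<And>j. j \<in> {1..n} \<Longrightarrow> nonneg_distribution (D j)"
begin

text \<open>Value coordinates of indices outside \<open>U\<close> receive \<open>unif\<close>, which
  makes every \<open>mu x\<close> a probability measure as \<open>fin_prod\<close> demands.\<close>

definition mu :: "coord \<Rightarrow> real measure" where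
  "mu x = (if fst x = 0 \<and> fst (snd x) \<in> U then D (fst (snd x)) else unif)"

lemma prob_mu: "prob_space (mu x)"
  using D prob_unif unfolding mu_def nonneg_distribution_def by auto

lemma sets_mu [simp, measurable_cong]: "sets (mu x) = sets borel"
  using D unfolding mu_def nonneg_distribution_def by auto

sublocale fin_prod Idx mu
  by (rule fin_prod.intro[OF finite_Idx prob_mu])

lemma sets_Om: "sets Om = sets BB"
  by (intro sets_PiM_cong) auto

lemma measurable_Om_iff: "(f \<in> Om \<rightarrow>\<^sub>M N) = (f \<in> BB \<rightarrow>\<^sub>M N)"
  by (simp add: measurable_cong_sets[OF sets_Om refl])

lemma coord_measurable: "x \<in> Idx \<Longrightarrow> (\<lambda>\<omega>. \<omega> x) \<in> borel_measurable Om"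
  unfolding measurable_Om_iff by (rule measurable_component_singleton)

lemma AE_nonneg: "j \<in> U \<Longrightarrow> l \<le> num_samples \<Longrightarrow> AE \<omega> in Om. 0 \<le> \<omega> (0, j, l)"
proof (rule AE_PiM_component[OF prob_mu])
  assume j: "j \<in> U" "l \<le> num_samples"
  then have m: "mu (0, j, l) = D j" by (simp add: mu_def)
  have "AE x in D j. 0 \<le> x" using D[OF j(1)] unfolding nonneg_distribution_def by blast
  then show "AE x in mu (0, j, l). 0 \<le> x" unfolding m .
qed simp

text \<open>The seed, the samples and the online values are independent, and they are the
  projections of \<open>Om\<close> to three disjoint blocks of coordinates. From here on a single
  product space carries all the randomness.\<close>

lemma expected_alg_eq:
  "expected_alg n num_samples D the_alg = (\<integral>\<^sup>+\<omega>. (\<Sum>i\<in>U. ennreal (\<omega> (0, i, 0)) * indicator {\<omega>. acc \<omega> i} \<omega>) \<partial>Om)"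
proof -
  let ?sR = "\<lambda>a. from_nat a :: coord" and ?sS = "\<lambda>p. (0, fst p, snd p) :: coord" and ?sV = "\<lambda>j. (0, j, 0) :: coord"
  let ?R = "to_nat ` seed_coords" and ?S = "U \<times> {1..num_samples}"
  let ?rR = "\<lambda>\<omega>. \<lambda>a\<in>?R. \<omega> (?sR a)" and ?rS = "\<lambda>\<omega>. \<lambda>p\<in>?S. \<omega> (?sS p)" and ?rV = "\<lambda>\<omega>. \<lambda>j\<in>U. \<omega> (?sV j)"
  have MR: "PiM ?R (\<lambda>a. mu (?sR a)) = seed the_alg" unfolding the_alg_def
    by (auto intro!: PiM_cong simp: seed_coords_def mu_def)
  have MS: "PiM ?S (\<lambda>p. mu (?sS p)) = PiM ?S (\<lambda>p. D (fst p))"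
    by (auto intro!: PiM_cong simp: mu_def)
  have MV: "PiM U (\<lambda>j. mu (?sV j)) = PiM U D"
    by (auto intro!: PiM_cong simp: mu_def)
  have sR: "inj_on ?sR ?R" "?sR ` ?R \<subseteq> Idx" by (auto simp: seed_coords_def inj_on_def)
  have sS: "inj_on ?sS ?S" "?sS ` ?S \<subseteq> Idx" by (auto simp: inj_on_def)
  have sV: "inj_on ?sV U" "?sV ` U \<subseteq> Idx" by (auto simp: inj_on_def)
  have mR: "?rR \<in> Om \<rightarrow>\<^sub>M seed the_alg"
    using reindex(2)[OF sR, of "\<lambda>_. 0"] unfolding MR by simp
  have mS: "?rS \<in> Om \<rightarrow>\<^sub>M PiM ?S (\<lambda>p. D (fst p))"
    using reindex(2)[OF sS, of "\<lambda>_. 0"] unfolding MS by simp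
  have mV: "?rV \<in> Om \<rightarrow>\<^sub>M PiM U D"
    using reindex(2)[OF sV, of "\<lambda>_. 0"] unfolding MV by simp
  let ?F = "\<lambda>(r, s, v). ennreal (\<Sum>i\<in>{i \<in> U. acc (assemble r s v) i}. v i)"
  let ?M3 = "seed the_alg \<Otimes>\<^sub>M (PiM ?S (\<lambda>p. D (fst p)) \<Otimes>\<^sub>M PiM U D)"
  have F: "?F \<in> borel_measurable ?M3"
  proof -
    have vb: "(\<lambda>v. v i) \<in> borel_measurable (PiM U D)" if "i \<in> U" for i
    proof -
      have "(\<lambda>v. v i) \<in> PiM U D \<rightarrow>\<^sub>M D i" by (rule measurable_component_singleton[OF that])
      moreover have "sets (D i) = sets borel" using D[OF that] by (simp add: nonneg_distribution_def)
      ultimately show ?thesis using measurable_cong_sets[OF refl, of "D i" borel] by blast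
    qed
    have sb: "(\<lambda>s. s) \<in> PiM ?S (\<lambda>p. D (fst p)) \<rightarrow>\<^sub>M PiM ?S (\<lambda>_. borel)"
      by (rule measurable_ident_sets, rule sets_PiM_cong) (use D in \<open>auto simp: nonneg_distribution_def\<close>)
    have [measurable]: "Measurable.pred ?M3 (\<lambda>p. acc (assemble (fst p) (fst (snd p)) (snd (snd p))) i)" if i: "i \<in> U" for i
    proof -
      let ?N = "seed the_alg \<Otimes>\<^sub>M (PiM ?S (\<lambda>p. (borel :: real measure)) \<Otimes>\<^sub>M PiM {1..i} (\<lambda>p. (borel :: real measure)))"
      have rb: "(\<lambda>v. restrict v {1..i}) \<in> PiM U D \<rightarrow>\<^sub>M PiM {1..i} (\<lambda>_. borel)"
        using i by (intro measurable_restrict vb) auto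
      have "(\<lambda>p. (fst p, fst (snd p), restrict (snd (snd p)) {1..i})) \<in> ?M3 \<rightarrow>\<^sub>M ?N"
        by (intro measurable_Pair measurable_fst measurable_compose[OF measurable_compose[OF measurable_snd measurable_fst] sb]
            measurable_compose[OF measurable_compose[OF measurable_snd measurable_snd] rb])
      moreover have "Measurable.pred ?N (\<lambda>(r, s, w). accept the_alg i r s w)"
        using online_the_alg i unfolding online_algorithm_def by blast
      ultimately have "Measurable.pred ?M3 (\<lambda>p. accept the_alg i (fst p) (fst (snd p)) (restrict (snd (snd p)) {1..i}))"
        using measurable_compose[of _ ?M3 ?N "\<lambda>(r, s, w). accept the_alg i r s w"] by fastforce
      moreover have "accept the_alg i r s (restrict v {1..i}) = acc (assemble r s v) i" for r s v
        unfolding the_alg_def using acc_assemble_cong[OF i, of "restrict v {1..i}" v r s] by auto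
      ultimately show ?thesis by simp
    qed
    have [measurable]: "(\<lambda>p. snd (snd p) i) \<in> borel_measurable ?M3" if "i \<in> U" for i
      by (rule measurable_compose[OF measurable_compose[OF measurable_snd measurable_snd] vb[OF that]])
    have "?F = (\<lambda>p. ennreal (\<Sum>i\<in>U. if acc (assemble (fst p) (fst (snd p)) (snd (snd p))) i then snd (snd p) i else 0))"
      by (auto simp: fun_eq_iff sum.If_cases Int_def intro!: arg_cong[of _ _ ennreal] sum.cong)
    also have "\<dots> \<in> borel_measurable ?M3"
      by (intro measurable_compose[OF _ measurable_ennreal] borel_measurable_sum) auto
    finally show ?thesis .
  qed
  have "expected_alg n num_samples D the_alg = (\<integral>\<^sup>+p. ?F p \<partial>?M3)"
    unfolding expected_alg_def selected_the_alg[OF order_refl] ..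
  also have "?M3 = distr Om ?M3 (\<lambda>\<omega>. (?rR \<omega>, ?rS \<omega>, ?rV \<omega>))"
  proof -
    have "distr Om (seed the_alg) ?rR \<Otimes>\<^sub>M distr Om (PiM ?S (\<lambda>p. D (fst p)) \<Otimes>\<^sub>M PiM U D) (\<lambda>\<omega>. (?rS \<omega>, ?rV \<omega>))
       = distr Om ?M3 (\<lambda>\<omega>. (?rR \<omega>, ?rS \<omega>, ?rV \<omega>))"
      by (rule distr_pair[OF mR measurable_Pair[OF mS mV], of "{x. fst x \<noteq> 0}"])
        (auto simp: mix_def seed_coords_def fun_eq_iff restrict_def)
    moreover have "distr Om (PiM ?S (\<lambda>p. D (fst p))) ?rS \<Otimes>\<^sub>M distr Om (PiM U D) ?rV
      = distr Om (PiM ?S (\<lambda>p. D (fst p)) \<Otimes>\<^sub>M PiM U D) (\<lambda>\<omega>. (?rS \<omega>, ?rV \<omega>))"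
      by (rule distr_pair[OF mS mV, of "{x. snd (snd x) \<noteq> 0}"])
        (auto simp: mix_def fun_eq_iff restrict_def)
    ultimately show ?thesis
      using reindex(3)[OF sR, of "\<lambda>_. 0"] reindex(3)[OF sS, of "\<lambda>_. 0"] reindex(3)[OF sV, of "\<lambda>_. 0"]
      unfolding MR MS MV by simp
  qed
  also have "(\<integral>\<^sup>+p. ?F p \<partial>\<dots>) = (\<integral>\<^sup>+\<omega>. ?F (?rR \<omega>, ?rS \<omega>, ?rV \<omega>) \<partial>Om)"
    by (rule nn_integral_distr[OF measurable_Pair[OF mR measurable_Pair[OF mS mV]]]) (use F in simp)
  also have "\<dots> = (\<integral>\<^sup>+\<omega>. (\<Sum>i\<in>U. ennreal (\<omega> (0, i, 0)) * indicator {\<omega>. acc \<omega> i} \<omega>) \<partial>Om)"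
  proof (rule nn_integral_cong_AE)
    \<comment> \<open>Only for nonnegative values does \<open>ennreal\<close> commute with the sum
      over the selected items.\<close>
    have "AE \<omega> in Om. \<forall>j\<in>U. 0 \<le> \<omega> (0, j, 0)" using AE_nonneg[of _ 0] by (intro AE_finite_allI) auto
    then show "AE \<omega> in Om. ?F (?rR \<omega>, ?rS \<omega>, ?rV \<omega>) = (\<Sum>i\<in>U. ennreal (\<omega> (0, i, 0)) * indicator {\<omega>. acc \<omega> i} \<omega>)"
    proof (eventually_elim)
      case (elim \<omega>)
      have a: "assemble (?rR \<omega>) (?rS \<omega>) (?rV \<omega>) x = \<omega> x" if "x \<in> Idx" for x
        using that by (cases x) (auto simp: assemble_def seed_coords_def)
      let ?a = "assemble (?rR \<omega>) (?rS \<omega>) (?rV \<omega>)"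
      have Qa: "Q ?a c = Q \<omega> c" if "c \<le> num_samples" for c by (rule Q_cong[OF _ that]) (rule a)
      have ac: "act ?a j (sig ?a j c) = act \<omega> j (sig \<omega> j c)" if "c \<le> num_samples" "j \<in> U" for c j
        using Qa[OF that(1)] that(2) unfolding Q_def by blast
      have "stp ?a d = stp \<omega> d" if "d < Dp" for d
        unfolding stp_def by (subst a) (use that in auto)
      then have "acc ?a i = acc \<omega> i" for i
        by (intro acc_pattern ac) auto
      then have "?F (?rR \<omega>, ?rS \<omega>, ?rV \<omega>) = ennreal (\<Sum>i\<in>{i \<in> U. acc \<omega> i}. \<omega> (0, i, 0))"
        by (auto intro!: arg_cong[of _ _ ennreal] sum.cong)
      also have "\<dots> = (\<Sum>i\<in>{i \<in> U. acc \<omega> i}. ennreal (\<omega> (0, i, 0)))"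
        using elim by (intro sum_ennreal[symmetric]) auto
      also have "\<dots> = (\<Sum>i\<in>U. ennreal (\<omega> (0, i, 0)) * indicator {\<omega>. acc \<omega> i} \<omega>)"
        by (intro sum.mono_neutral_cong_left) auto
      finally show ?case .
    qed
  qed
  finally show ?thesis .
qed

end

section \<open>Occupancy of the active sets\<close>

lemma sum_Pow_power_card:
  fixes q :: "'b::comm_semiring_1"
  assumes "finite A" shows "(\<Sum>B\<in>Pow A. q ^ card B) = (1 + q) ^ card A"
  using assms
proof (induction A rule: finite_induct)
  case (insert x A)
  have "(\<Sum>B\<in>Pow (insert x A). q ^ card B) = (\<Sum>B\<in>Pow A. q ^ card B) + (\<Sum>B\<in>insert x ` Pow A. q ^ card B)"
    unfolding Pow_insert using insert by (intro sum.union_disjoint) auto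
  also have "(\<Sum>B\<in>insert x ` Pow A. q ^ card B) = (\<Sum>B\<in>Pow A. q ^ card (insert x B))"
    using insert by (intro sum.reindex_cong[of "insert x"]) (auto simp: inj_on_def)
  also have "\<dots> = (\<Sum>B\<in>Pow A. q * q ^ card B)"
    using insert finite_subset by (intro sum.cong) (fastforce simp: card_insert_if)+
  finally show ?case using insert by (simp add: sum_distrib_left[symmetric] distrib_right)
qed simp

lemma measurable_indicator_pred:
  assumes [measurable]: "Measurable.pred M P"
  shows "(indicator {x. P x} :: _ \<Rightarrow> ennreal) \<in> borel_measurable M"
proof -
  have "(\<lambda>x. if P x then 1 else 0 :: ennreal) \<in> borel_measurable M" by measurable
  then show ?thesis by (simp add: indicator_def of_bool_def)
qed

lemma nn_integral_indicator_pred: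
  assumes [measurable]: "Measurable.pred M P"
  shows "(\<integral>\<^sup>+x. indicator {x. P x} x \<partial>M) = emeasure M {x \<in> space M. P x}"
proof -
  have "(\<integral>\<^sup>+x. indicator {x. P x} x \<partial>M) = (\<integral>\<^sup>+x. indicator {x \<in> space M. P x} x \<partial>M)"
    by (intro nn_integral_cong) (auto simp: indicator_def)
  then show ?thesis by simp
qed

context prophet_alg
begin

text \<open>\<open>walk F m es lab\<close> runs through the slots \<open>es\<close> in decreasing order, starting from the training
  counts \<open>m\<close>, and counts the test slots with items in \<open>F\<close> that are met unblocked.\<close>

fun walk :: "nat set \<Rightarrow> (nat \<Rightarrow> nat) \<Rightarrow> (nat \<times> nat) list \<Rightarrow> (nat \<times> nat \<Rightarrow> bool) \<Rightarrow> nat" where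
  "walk F m [] lab = 0"
| "walk F m (s # es) lab = (if lab s then walk F (m(fst s := Suc (m (fst s)))) es lab
     else (if fst s \<in> F \<and> \<not> blocked C m (fst s) then 1 else 0) + walk F m es lab)"

definition label :: "(coord \<Rightarrow> real) \<Rightarrow> nat \<times> nat \<Rightarrow> bool" where
  "label \<omega> = (\<lambda>(j, l). \<omega> (2, j, l) > 1/2)"

lemma walk_cong: "(\<And>e. e \<in> set es \<Longrightarrow> lab e = lab' e) \<Longrightarrow> walk F m es lab = walk F m es lab'"
  by (induction es arbitrary: m) auto

text \<open>\<open>act\<close> counts all training slots weakly above the tested one, among them
  those of the prefix. So an active slot is also unblocked by the prefix counts, and the walk counts
  it.\<close>

lemma walk_ge:
  assumes "sorted_wrt (\<lambda>e f. beats (sig \<omega> (fst e) (snd e)) (sig \<omega> (fst f) (snd f))) (pre @ es)"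
    "distinct (pre @ es)" "set (pre @ es) \<subseteq> U \<times> {1..L}"
  shows "card {e \<in> set es. \<not> label \<omega> e \<and> fst e \<in> F \<and> act \<omega> (fst e) (sig \<omega> (fst e) (snd e))}
    \<le> walk F (\<lambda>j. card {f \<in> set pre. label \<omega> f \<and> fst f = j}) es (label \<omega>)"
  using assms
proof (induction es arbitrary: pre)
  case (Cons e es)
  let ?A = "\<lambda>es. {e \<in> set es. \<not> label \<omega> e \<and> fst e \<in> F \<and> act \<omega> (fst e) (sig \<omega> (fst e) (snd e))}"
  let ?m = "\<lambda>pre j. card {f \<in> set pre. label \<omega> f \<and> fst f = j}"
  have IH: "card (?A es) \<le> walk F (?m (pre @ [e])) es (label \<omega>)"
    using Cons.IH[of "pre @ [e]"] Cons.prems by simp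
  show ?case
  proof (cases "label \<omega> e")
    case True
    have "?m (pre @ [e]) = (?m pre)(fst e := Suc (?m pre (fst e)))"
    proof
      fix j
      have "{f \<in> set (pre @ [e]). label \<omega> f \<and> fst f = j} =
         (if fst e = j then insert e {f \<in> set pre. label \<omega> f \<and> fst f = j} else {f \<in> set pre. label \<omega> f \<and> fst f = j})"
        using True by auto
      then show "?m (pre @ [e]) j = ((?m pre)(fst e := Suc (?m pre (fst e)))) j"
        using Cons.prems(2) by auto
    qed
    moreover have "?A (e # es) = ?A es" using True by auto
    ultimately show ?thesis using IH True by simp
  next
    case False
    have eq: "?m (pre @ [e]) = ?m pre" using False by (intro ext arg_cong[of _ _ card]) auto
    have "\<not> blocked C (?m pre) (fst e)" if "act \<omega> (fst e) (sig \<omega> (fst e) (snd e))"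
    proof
      assume "blocked C (?m pre) (fst e)"
      then have "blocked C (cnt \<omega> (sig \<omega> (fst e) (snd e))) (fst e)"
      proof (rule blocked_mono)
        fix j
        have "card {f \<in> set pre. label \<omega> f \<and> fst f = j} \<le> card {l \<in> train \<omega> j. beats (sig \<omega> j l) (sig \<omega> (fst e) (snd e))}"
        proof (rule card_inj_on_le[of snd])
          show "inj_on snd {f \<in> set pre. label \<omega> f \<and> fst f = j}" by (auto simp: inj_on_def)
          show "snd ` {f \<in> set pre. label \<omega> f \<and> fst f = j} \<subseteq> {l \<in> train \<omega> j. beats (sig \<omega> j l) (sig \<omega> (fst e) (snd e))}"
            using Cons.prems unfolding train_def label_def by (fastforce simp: sorted_wrt_append)
        qed (simp add: train_def)
        then show "?m pre j \<le> cnt \<omega> (sig \<omega> (fst e) (snd e)) j" unfolding cnt_def .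
      qed
      then show False using that unfolding act_def by simp
    qed
    moreover have "card (?A (e # es)) \<le> (if fst e \<in> F \<and> act \<omega> (fst e) (sig \<omega> (fst e) (snd e)) then 1 else 0) + card (?A es)"
    proof (cases "fst e \<in> F \<and> act \<omega> (fst e) (sig \<omega> (fst e) (snd e))")
      case True
      then have "?A (e # es) = insert e (?A es)" using False by auto
      then show ?thesis using True by (simp add: card_insert_if)
    next
      case False
      then have "?A (e # es) = ?A es" by auto
      then show ?thesis by simp
    qed
    ultimately show ?thesis using IH False unfolding eq by (auto split: if_splits)
  qed
qed simp

end

context prophet_instance
begin

lemma pred_act_Om: "j \<in> U \<Longrightarrow> b \<le> num_samples \<Longrightarrow> Measurable.pred Om (\<lambda>\<omega>. act \<omega> j (sig \<omega> j b))"
  unfolding measurable_Om_iff by (rule pred_act)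

lemma pred_label_Om: "j \<in> U \<Longrightarrow> l \<in> {1..L} \<Longrightarrow> Measurable.pred Om (\<lambda>\<omega>. \<omega> (2, j, l) > 1/2)"
  unfolding measurable_Om_iff by (rule pred_label)

lemma emeasure_unif_greater: "emeasure unif {1/2<..} = ennreal (1/2)" "emeasure unif {..1/2} = ennreal (1/2)"
proof -
  have 1: "{0..1} \<inter> {1/2<..} = {1/2<..1::real}" "{0..1} \<inter> {..1/2} = {0..1/2::real}" by auto
  have "emeasure lborel ({0..1} \<inter> {1/2::real<..}) = ennreal (1/2)" "emeasure lborel ({0..1} \<inter> {..1/2::real}) = ennreal (1/2)"
    unfolding 1 by simp_all
  then show "emeasure unif {1/2<..} = ennreal (1/2)" "emeasure unif {..1/2} = ennreal (1/2)"
    unfolding unif_def by (simp_all add: divide_ennreal_def)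
qed

lemma measurable_walk:
  assumes "set es \<subseteq> U \<times> {1..L}"
  shows "(\<lambda>\<omega>. walk F m es (label \<omega>)) \<in> Om \<rightarrow>\<^sub>M count_space UNIV"
proof (rule measurable_pattern[where S = "set es" and P = "\<lambda>s \<omega>. label \<omega> s"])
  show "Measurable.pred Om (\<lambda>\<omega>. label \<omega> e)" if "e \<in> set es" for e
    using that assms pred_label_Om[of "fst e" "snd e"] unfolding label_def by (auto simp: case_prod_beta')
qed (auto intro: walk_cong)

text \<open>Whenever an unblocked slot of \<open>F\<close> is met, its fair coin either makes it a training slot, which
  uses up one unit of the capacity \<open>C * rk F\<close>, or a counted test slot.\<close>

lemma walk_mgf:
  assumes y: "1 \<le> y" "y < 2" and F: "F \<subseteq> U" and es: "distinct es" "set es \<subseteq> U \<times> {1..L}"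
  shows "(\<integral>\<^sup>+\<omega>. ennreal (y ^ walk F m es (label \<omega>)) \<partial>Om) \<le> ennreal ((1 / (2 - y)) ^ (C * rk F - rho C (only F m)))"
  using es
proof (induction es arbitrary: m)
  case Nil
  have "1 \<le> (1 / (2 - y)) ^ (C * rk F - rho C (only F m))" using y by (intro one_le_power) simp
  then show ?case by (simp add: P.emeasure_space_1)
next
  case (Cons e es)
  obtain i l where e: "e = (i, l)" by (cases e)
  have i: "i \<in> U" "l \<in> {1..L}" using Cons.prems e by auto
  let ?x = "(2, i, l) :: coord" and ?m = "m(i := Suc (m i))" and ?B = "1 / (2 - y)"
  let ?z = "if i \<in> F \<and> \<not> blocked C m i then 1 else 0 :: nat"
  let ?X = "\<lambda>\<omega>. ennreal (y ^ walk F ?m es (label \<omega>))" and ?Y = "\<lambda>\<omega>. ennreal (y ^ walk F m es (label \<omega>))"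
  have x: "?x \<in> Idx" using i by simp
  have mu: "mu ?x = unif" by (simp add: mu_def)
  have [measurable]: "(\<lambda>\<omega>. \<omega> ?x) \<in> borel_measurable Om" by (rule coord_measurable[OF x])
  have m: "(\<lambda>\<omega>. ennreal (y ^ walk F m es (label \<omega>))) \<in> borel_measurable Om" for m
    using Cons.prems by (intro measurable_compose[OF measurable_walk]) auto
  \<comment> \<open>The slots are distinct, so the rest of the walk does not read the coin of
    \<open>e\<close>.\<close>
  have loc: "walk F m es (label (mix {?x} \<omega> \<omega>')) = walk F m es (label \<omega>)" for m \<omega> \<omega>'
    using Cons.prems e by (intro walk_cong) (auto simp: label_def mix_def)
  have half: "(\<integral>\<^sup>+\<omega>. indicator A (\<omega> ?x) * ennreal (y ^ walk F m es (label \<omega>)) \<partial>Om)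
      = emeasure unif A * (\<integral>\<^sup>+\<omega>. ennreal (y ^ walk F m es (label \<omega>)) \<partial>Om)" if [measurable]: "A \<in> sets borel" for A m
  proof -
    have "(\<integral>\<^sup>+\<omega>. indicator A (\<omega> ?x) * ennreal (y ^ walk F m es (label \<omega>)) \<partial>Om)
       = (\<integral>\<^sup>+\<omega>. indicator A (\<omega> ?x) \<partial>Om) * (\<integral>\<^sup>+\<omega>. ennreal (y ^ walk F m es (label \<omega>)) \<partial>Om)"
      by (rule nn_integral_indep[OF _ m, of _ "{?x}"]) (auto simp: loc, simp add: mix_def)
    then show ?thesis using nn_integral_coord[OF x, of A] that unfolding mu by simp
  qed
  have le1: "rho C (only F m) \<le> rho C (only F ?m)" by (rule rho_only_increment[OF i(1)])
  have B1: "1 \<le> ?B" using y by simp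
  have "(\<integral>\<^sup>+\<omega>. ennreal (y ^ walk F m (e # es) (label \<omega>)) \<partial>Om)
     = (\<integral>\<^sup>+\<omega>. indicator {1/2<..} (\<omega> ?x) * ?X \<omega> + ennreal (y ^ ?z) * (indicator {..1/2} (\<omega> ?x) * ?Y \<omega>) \<partial>Om)"
    using y by (intro nn_integral_cong)
      (auto simp: e label_def power_add indicator_def ennreal_mult[symmetric])
  also have "\<dots> = (\<integral>\<^sup>+\<omega>. indicator {1/2<..} (\<omega> ?x) * ?X \<omega> \<partial>Om) + ennreal (y ^ ?z) * (\<integral>\<^sup>+\<omega>. indicator {..1/2} (\<omega> ?x) * ?Y \<omega> \<partial>Om)"
    using m by (subst nn_integral_add) (auto simp: nn_integral_cmult)
  also have "\<dots> = ennreal (1/2) * (\<integral>\<^sup>+\<omega>. ?X \<omega> \<partial>Om) + ennreal (y ^ ?z) * (ennreal (1/2) * (\<integral>\<^sup>+\<omega>. ?Y \<omega> \<partial>Om))"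
    by (subst (1 2) half) (auto simp: emeasure_unif_greater)
  also have "\<dots> \<le> ennreal (1/2) * ennreal (?B ^ (C * rk F - rho C (only F ?m)))
      + ennreal (y ^ ?z) * (ennreal (1/2) * ennreal (?B ^ (C * rk F - rho C (only F m))))"
    using Cons.prems by (intro add_mono mult_left_mono Cons.IH) auto
  also have "\<dots> = ennreal (1/2 * ?B ^ (C * rk F - rho C (only F ?m)) + y ^ ?z * (1/2 * ?B ^ (C * rk F - rho C (only F m))))"
  proof -
    have gen: "ennreal h * ennreal a + ennreal c * (ennreal h * ennreal b) = ennreal (h * a + c * (h * b))"
      if "h \<ge> 0" "a \<ge> 0" "b \<ge> 0" "c \<ge> 0" for a b c h :: real
      using that by (simp add: ennreal_mult)
    show ?thesis using y by (intro gen) auto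
  qed
  also have "\<dots> \<le> ennreal (?B ^ (C * rk F - rho C (only F m)))"
  proof (intro ennreal_leI)
    show "1/2 * ?B ^ (C * rk F - rho C (only F ?m)) + y ^ ?z * (1/2 * ?B ^ (C * rk F - rho C (only F m)))
       \<le> ?B ^ (C * rk F - rho C (only F m))"
    proof (cases "i \<in> F \<and> \<not> blocked C m i")
      case True
      then have "rho C (only F ?m) = Suc (rho C (only F m))" using rho_only_increment(2)[OF i(1)] by simp
      moreover have "rho C (only F ?m) \<le> C * rk F" by (rule rho_only_le[OF F])
      ultimately obtain k where k: "C * rk F - rho C (only F m) = Suc k" "C * rk F - rho C (only F ?m) = k"
        by (metis Suc_diff_Suc Suc_le_lessD)
      \<comment> \<open>\<open>?B\<close> solves \<open>B = 1/2 + y * B / 2\<close>: it is the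
        expectation of \<open>y ^ X\<close> for the geometric number \<open>X\<close> of tests
        before the next training slot. One such factor pays for each unit of remaining
        capacity.\<close>
      have "1/2 * ?B ^ k + y * (1/2 * ?B ^ Suc k) = ?B ^ Suc k"
        using y by (simp add: field_simps)
      then show ?thesis unfolding k using True by simp
    next
      case False
      have "?B ^ (C * rk F - rho C (only F ?m)) \<le> ?B ^ (C * rk F - rho C (only F m))"
        using le1 B1 by (intro power_increasing) auto
      then show ?thesis using False by auto
    qed
  qed
  finally show ?case .
qed

definition ztest :: "nat set \<Rightarrow> (coord \<Rightarrow> real) \<Rightarrow> nat" where
  "ztest F \<omega> = card {e \<in> U \<times> {1..L}. \<not> label \<omega> e \<and> fst e \<in> F \<and> act \<omega> (fst e) (sig \<omega> (fst e) (snd e))}"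

lemma measurable_ztest: "ztest F \<in> Om \<rightarrow>\<^sub>M count_space UNIV"
proof (rule measurable_pattern[where S = "UNIV \<times> U \<times> {1..L}" and P = "\<lambda>(k, e) \<omega>. if k then label \<omega> e else act \<omega> (fst e) (sig \<omega> (fst e) (snd e))"])
  show "Measurable.pred Om ((\<lambda>(k, e) \<omega>. if k then label \<omega> e else act \<omega> (fst e) (sig \<omega> (fst e) (snd e))) s)"
    if "s \<in> UNIV \<times> U \<times> {1..L}" for s
    using that pred_act_Om pred_label_Om L_le_num_samples unfolding label_def by (auto split: prod.splits)
next
  fix \<omega> \<omega>' assume *: "\<And>s. s \<in> UNIV \<times> U \<times> {1..L} \<Longrightarrow>
    (case s of (k, e) \<Rightarrow> \<lambda>\<omega>. if k then label \<omega> e else act \<omega> (fst e) (sig \<omega> (fst e) (snd e))) \<omega> =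
    (case s of (k, e) \<Rightarrow> \<lambda>\<omega>. if k then label \<omega> e else act \<omega> (fst e) (sig \<omega> (fst e) (snd e))) \<omega>'"
  have "label \<omega> e = label \<omega>' e" "act \<omega> (fst e) (sig \<omega> (fst e) (snd e)) = act \<omega>' (fst e) (sig \<omega>' (fst e) (snd e))"
    if "e \<in> U \<times> {1..L}" for e
    using *[of "(True, e)"] *[of "(False, e)"] that by auto
  then show "ztest F \<omega> = ztest F \<omega>'" unfolding ztest_def by (intro arg_cong[of _ _ card]) auto
qed simp

text \<open>With values and priorities held fixed, the slots have a fixed order and only the coins
  remain random. The walk over this order dominates \<open>ztest\<close>.\<close>

lemma ztest_mgf:
  assumes y: "1 \<le> y" "y < 2" and F: "F \<subseteq> U"
  shows "(\<integral>\<^sup>+\<omega>. ennreal (y ^ ztest F \<omega>) \<partial>Om) \<le> ennreal ((1 / (2 - y)) ^ (C * rk F))"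
proof -
  let ?J = "{x. fst x = 2} :: coord set" and ?b = "ennreal ((1 / (2 - y)) ^ (C * rk F))"
  have "(\<integral>\<^sup>+\<omega>. ennreal (y ^ ztest F \<omega>) \<partial>Om) = (\<integral>\<^sup>+\<omega>. \<integral>\<^sup>+\<omega>'. ennreal (y ^ ztest F (mix ?J \<omega> \<omega>')) \<partial>Om \<partial>Om)"
    by (rule resample[OF measurable_compose[OF measurable_ztest]]) simp
  also have "\<dots> \<le> (\<integral>\<^sup>+\<omega>. ?b \<partial>Om)"
  proof (rule nn_integral_mono)
    fix \<omega>
    let ?R = "\<lambda>e f. beats (sig \<omega> (fst e) (snd e)) (sig \<omega> (fst f) (snd f))"
    have "\<exists>es. set es = U \<times> {1..L} \<and> distinct es \<and> sorted_wrt ?R es"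
    proof (rule sorted_list_exists)
      show "?R x y \<or> ?R y x" for x y by (rule beats_total)
      show "?R x z" if "?R x y" "?R y z" for x y z using that by (rule beats_trans)
    qed simp
    then obtain es where es: "set es = U \<times> {1..L}" "distinct es" "sorted_wrt ?R es" by blast
    have "ztest F (mix ?J \<omega> \<omega>') \<le> walk F (\<lambda>_. 0) es (label \<omega>')" for \<omega>'
    proof -
      have s: "sig (mix ?J \<omega> \<omega>') = sig \<omega>" and l: "label (mix ?J \<omega> \<omega>') = label \<omega>'"
        by (auto simp: fun_eq_iff sig_def label_def mix_def)
      show ?thesis using walk_ge[of "mix ?J \<omega> \<omega>'" "[]" es F] es unfolding ztest_def s l by simp
    qed
    then have "(\<integral>\<^sup>+\<omega>'. ennreal (y ^ ztest F (mix ?J \<omega> \<omega>')) \<partial>Om) \<le> (\<integral>\<^sup>+\<omega>'. ennreal (y ^ walk F (\<lambda>_. 0) es (label \<omega>')) \<partial>Om)"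
      using y by (intro nn_integral_mono ennreal_leI power_increasing) auto
    also have "\<dots> \<le> ennreal ((1 / (2 - y)) ^ (C * rk F - rho C (only F (\<lambda>_. 0))))"
      using walk_mgf[OF y F es(2)] es(1) by simp
    also have "rho C (only F (\<lambda>_. 0)) = 0" by (simp add: only_def)
    finally show "(\<integral>\<^sup>+\<omega>'. ennreal (y ^ ztest F (mix ?J \<omega> \<omega>')) \<partial>Om) \<le> ?b" by simp
  qed
  also have "\<dots> = ?b" by (simp add: P.emeasure_space_1)
  finally show ?thesis .
qed

section \<open>Exchangeable slots and conditional activity probabilities\<close>

definition swap_slot :: "nat \<Rightarrow> nat \<Rightarrow> nat \<Rightarrow> coord \<Rightarrow> coord" where
  "swap_slot i l l' = (\<lambda>(\<kappa>, j, k). if \<kappa> \<le> 1 \<and> j = i then (\<kappa>, j, if k = l then l' else if k = l' then l else k) else (\<kappa>, j, k))"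

text \<open>All slots of an item share their value law and their priority law. Coins are not moved,
  so the exchange is compatible with fixed labels.\<close>

lemma nn_integral_swap_slot:
  assumes f: "f \<in> borel_measurable Om" and i: "i \<in> U" "l \<le> num_samples" "l' \<le> num_samples"
  shows "(\<integral>\<^sup>+\<omega>. f (\<lambda>x\<in>Idx. \<omega> (swap_slot i l l' x)) \<partial>Om) = (\<integral>\<^sup>+\<omega>. f \<omega> \<partial>Om)"
proof (rule permute[OF f])
  have s: "swap_slot i l l' \<in> Idx \<rightarrow> Idx"
    using i unfolding Idx_def swap_slot_def by (auto split: if_splits)
  have "swap_slot i l l' (swap_slot i l l' x) = x" for x by (auto simp: swap_slot_def split: prod.splits)
  then show "bij_betw (swap_slot i l l') Idx Idx" by (intro bij_betwI[OF s s])
  show "mu (swap_slot i l l' x) = mu x" for x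
    unfolding mu_def swap_slot_def by (auto split: prod.splits)
qed

text \<open>From here on, conditioning on the training data means reading them from \<open>\<omega>\<close> and everything
  else from an independent copy \<open>\<omega>'\<close>.\<close>

definition act_prob :: "(coord \<Rightarrow> real) \<Rightarrow> nat \<Rightarrow> real" where
  "act_prob \<omega> i = P.prob {\<omega>' \<in> space Om. act \<omega> i (sig \<omega>' i 0)}"

abbreviation slot_coords :: "nat \<Rightarrow> coord set" where
  "slot_coords l \<equiv> {x. fst x \<le> 1 \<and> snd (snd x) = l}"

lemma act_mix:
  assumes "\<And>j l. (2, j, l) \<notin> J" "\<And>j l. l \<in> train \<omega> j \<Longrightarrow> (0, j, l) \<notin> J \<and> (1, j, l) \<notin> J" "i \<in> U"
  shows "act (mix J \<omega> \<omega>') i x = act \<omega> i x"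
proof -
  have t: "train (mix J \<omega> \<omega>') j = train \<omega> j" for j
    using assms(1) unfolding train_def mix_def by auto
  have "cnt (mix J \<omega> \<omega>') x j = cnt \<omega> x j" for j
    unfolding cnt_def t using assms(2) by (intro arg_cong[of _ _ card]) (auto simp: sig_def mix_def)
  then show ?thesis unfolding act_def by (metis ext)
qed

lemma pred_act_slot:
  assumes "\<omega> \<in> space Om" "i \<in> U" "b \<le> num_samples"
  shows "Measurable.pred Om (\<lambda>\<omega>'. act \<omega> i (sig \<omega>' i b))"
proof (rule measurable_pattern)
  let ?P = "\<lambda>(j, l) \<omega>'. beats (sig \<omega> j l) (sig \<omega>' i b)"
  show "finite (U \<times> {1..L})" by simp
  show "Measurable.pred Om (?P s)" if "s \<in> U \<times> {1..L}" for s
  proof -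
    have "Measurable.pred Om (\<lambda>\<omega>'. beats (sig \<omega> (fst s) (snd s)) (sig \<omega>' i b))"
      unfolding beats_def sig_def fst_conv snd_conv
      by (rule pred_lex) (use assms in \<open>auto intro!: coord_measurable\<close>)
    then show ?thesis by (simp add: case_prod_beta')
  qed
  show "act \<omega> i (sig \<omega>' i b) = act \<omega> i (sig \<omega>'' i b)" if "\<And>s. s \<in> U \<times> {1..L} \<Longrightarrow> ?P s \<omega>' = ?P s \<omega>''" for \<omega>' \<omega>''
    by (rule act_cong[OF _ _ assms(2)]) (use that in auto)
qed

lemma prob_act_slot:
  assumes "\<omega> \<in> space Om" "i \<in> U" "b \<le> num_samples"
  shows "(\<integral>\<^sup>+\<omega>'. indicator {\<omega>'. act \<omega> i (sig \<omega>' i b)} \<omega>' \<partial>Om) = ennreal (act_prob \<omega> i)"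
proof -
  have m: "(\<lambda>\<omega>'. indicator {\<omega>'. act \<omega> i (sig \<omega>' i 0)} \<omega>' :: ennreal) \<in> borel_measurable Om"
    using assms by (intro measurable_indicator_pred pred_act_slot) auto
  have "(\<integral>\<^sup>+\<omega>'. indicator {\<omega>'. act \<omega> i (sig \<omega>' i 0)} \<omega>' \<partial>Om) = emeasure Om {\<omega>' \<in> space Om. act \<omega> i (sig \<omega>' i 0)}"
    by (intro nn_integral_indicator_pred pred_act_slot assms(1,2)) simp
  then have 0: "(\<integral>\<^sup>+\<omega>'. indicator {\<omega>'. act \<omega> i (sig \<omega>' i 0)} \<omega>' \<partial>Om) = ennreal (act_prob \<omega> i)"
    unfolding act_prob_def by (simp add: P.emeasure_eq_measure)
  have "(\<integral>\<^sup>+\<omega>'. indicator {\<omega>'. act \<omega> i (sig \<omega>' i b)} \<omega>' \<partial>Om)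
      = (\<integral>\<^sup>+\<omega>'. indicator {\<omega>'. act \<omega> i (sig \<omega>' i 0)} (\<lambda>x\<in>Idx. \<omega>' (swap_slot i 0 b x)) \<partial>Om)"
    using assms by (intro nn_integral_cong) (auto simp: indicator_def sig_def swap_slot_def)
  also have "\<dots> = ennreal (act_prob \<omega> i)"
    using assms m by (subst nn_integral_swap_slot) (auto simp: 0)
  finally show ?thesis .
qed

lemma act_prob_bounds: "0 \<le> act_prob \<omega> i" "act_prob \<omega> i \<le> 1" unfolding act_prob_def by simp_all

lemma act_prob_cong: "(\<And>x. act \<omega> i x = act \<omega>' i x) \<Longrightarrow> act_prob \<omega> i = act_prob \<omega>' i" unfolding act_prob_def by simp

text \<open>\<open>act_prob\<close> is a probability inside a function of \<omega>; resampling slot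
  0 exhibits it as an inner integral, to which Fubini applies.\<close>

lemma measurable_pr:
  assumes "i \<in> U" shows "(\<lambda>\<omega>. act_prob \<omega> i) \<in> borel_measurable Om"
proof -
  let ?J = "slot_coords 0"
  let ?f = "\<lambda>\<omega>. indicator {\<omega>. act \<omega> i (sig \<omega> i 0)} \<omega> :: ennreal"
  have "?f \<in> borel_measurable Om"
    using assms by (intro measurable_indicator_pred pred_act_Om) auto
  from measurable_resample[OF this, of ?J]
  have "(\<lambda>\<omega>. \<integral>\<^sup>+\<omega>'. ?f (mix ?J \<omega> \<omega>') \<partial>Om) \<in> borel_measurable Om" .
  moreover have "(\<integral>\<^sup>+\<omega>'. ?f (mix ?J \<omega> \<omega>') \<partial>Om) = ennreal (act_prob \<omega> i)" if "\<omega> \<in> space Om" for \<omega>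
  proof -
    have "act (mix ?J \<omega> \<omega>') i x = act \<omega> i x" for \<omega>' x
      by (rule act_mix[OF _ _ assms]) (auto simp: train_def)
    moreover have "sig (mix ?J \<omega> \<omega>') i 0 = sig \<omega>' i 0" for \<omega>' by (simp add: sig_def mix_def)
    ultimately show ?thesis using prob_act_slot[OF that assms, of 0] by (simp add: indicator_def)
  qed
  ultimately have "(\<lambda>\<omega>. ennreal (act_prob \<omega> i)) \<in> borel_measurable Om" by (simp cong: measurable_cong)
  then have "(\<lambda>\<omega>. enn2real (ennreal (act_prob \<omega> i))) \<in> borel_measurable Om" by measurable
  then show ?thesis using act_prob_bounds by simp
qed

text \<open>The conditional mean of \<open>ztest F\<close> given the coins and the training
  slots.\<close>

definition test_weight :: "nat set \<Rightarrow> (coord \<Rightarrow> real) \<Rightarrow> real" where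
  "test_weight F \<omega> = (\<Sum>i\<in>F. real (card ({1..L} - train \<omega> i)) * act_prob \<omega> i)"

text \<open>The chord bound for a convex function. The right side is the expectation of
  \<open>y ^ X\<close> for a Bernoulli variable \<open>X\<close> with mean \<open>p\<close>.\<close>

lemma powr_le_affine:
  fixes y p :: real
  assumes "1 \<le> y" "0 \<le> p" "p \<le> 1"
  shows "y powr p \<le> 1 + (y - 1) * p"
proof -
  have "exp (ln y * ((1 - p) *\<^sub>R 0 + p *\<^sub>R 1)) \<le> (1 - p) * exp (ln y * 0) + p * exp (ln y * 1)"
    using assms by (intro convex_onD[OF convex_on_exp]) auto
  then show ?thesis using assms by (simp add: powr_def mult.commute algebra_simps)
qed

text \<open>A conditional Jensen inequality. Given the training data, the test slots are
  independently active, so the integral factorizes, and each factor is at least \<open>y\<close> to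
  the power of its mean.\<close>

lemma test_integral_ge:
  assumes y: "1 \<le> y" and F: "F \<subseteq> U" and \<omega>: "\<omega> \<in> space Om"
    and J: "J = {(\<kappa>, j, l). \<kappa> \<le> 1 \<and> l \<in> {1..L} \<and> l \<notin> train \<omega> j}"
  shows "ennreal (y powr test_weight F \<omega>) \<le> (\<integral>\<^sup>+\<omega>'. ennreal (y ^ ztest F (mix J \<omega> \<omega>')) \<partial>Om)"
proof -
  define S where "S = {s \<in> U \<times> {1..L}. \<not> label \<omega> s \<and> fst s \<in> F}"
  have fS: "finite S" unfolding S_def by simp
  let ?a = "\<lambda>s \<omega>'. act \<omega> (fst s) (sig \<omega>' (fst s) (snd s))"
  let ?f = "\<lambda>s \<omega>'. ennreal (if ?a s \<omega>' then y else 1)"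
  have SU: "fst s \<in> U" "snd s \<le> num_samples" "snd s \<in> {1..L}" if "s \<in> S" for s
    using that L_le_num_samples unfolding S_def by auto
  have z: "ztest F (mix J \<omega> \<omega>') = card {s \<in> S. ?a s \<omega>'}" for \<omega>'
  proof -
    have 1: "label (mix J \<omega> \<omega>') = label \<omega>" by (auto simp: label_def fun_eq_iff mix_def J)
    have 2: "act (mix J \<omega> \<omega>') i x = act \<omega> i x" if "i \<in> U" for i x
      by (rule act_mix[OF _ _ that]) (auto simp: J train_def)
    have 3: "sig (mix J \<omega> \<omega>') (fst s) (snd s) = sig \<omega>' (fst s) (snd s)" if "s \<in> S" for s
      using that by (auto simp: S_def sig_def mix_def J label_def train_def)
    have "act (mix J \<omega> \<omega>') (fst s) (sig (mix J \<omega> \<omega>') (fst s) (snd s)) = ?a s \<omega>'" if "s \<in> S" for s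
      unfolding 3[OF that] by (rule 2[OF SU(1)[OF that]])
    then show ?thesis unfolding ztest_def 1
      by (intro arg_cong[of _ _ card] Collect_cong) (auto simp: S_def)
  qed
  have "ennreal (y powr test_weight F \<omega>) = (\<Prod>s\<in>S. ennreal (y powr act_prob \<omega> (fst s)))"
  proof -
    have "S = Sigma F (\<lambda>i. {1..L} - train \<omega> i)"
      using F unfolding S_def label_def train_def by auto
    then have "(\<Sum>s\<in>S. act_prob \<omega> (fst s)) = (\<Sum>i\<in>F. \<Sum>l\<in>{1..L} - train \<omega> i. act_prob \<omega> i)"
      using sum.Sigma[of F "\<lambda>i. {1..L} - train \<omega> i" "\<lambda>i l. act_prob \<omega> i"] finite_subset[OF F]
      by (simp add: case_prod_beta')
    then have "test_weight F \<omega> = (\<Sum>s\<in>S. act_prob \<omega> (fst s))" unfolding test_weight_def by simp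
    then show ?thesis using y by (simp add: powr_sum prod_ennreal)
  qed
  also have "\<dots> \<le> (\<Prod>s\<in>S. \<integral>\<^sup>+\<omega>'. ?f s \<omega>' \<partial>Om)"
  proof (rule prod_mono_ennreal)
    fix s assume s: "s \<in> S"
    have m: "(indicator {\<omega>'. ?a s \<omega>'} :: _ \<Rightarrow> ennreal) \<in> borel_measurable Om"
      using SU[OF s] \<omega> by (intro measurable_indicator_pred pred_act_slot) auto
    have "1 + ennreal (y - 1) = ennreal y" using y ennreal_plus[of 1 "y - 1"] by simp
    then have "(\<integral>\<^sup>+\<omega>'. ?f s \<omega>' \<partial>Om) = (\<integral>\<^sup>+\<omega>'. 1 + ennreal (y - 1) * indicator {\<omega>'. ?a s \<omega>'} \<omega>' \<partial>Om)"
      by (intro nn_integral_cong) (auto simp: indicator_def)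
    also have "\<dots> = 1 + ennreal (y - 1) * ennreal (act_prob \<omega> (fst s))"
      using m by (simp add: nn_integral_add nn_integral_cmult prob_act_slot[OF \<omega> SU(1,2)[OF s]] P.emeasure_space_1)
    also have "\<dots> = ennreal (1 + (y - 1) * act_prob \<omega> (fst s))"
      using y act_prob_bounds by (simp add: ennreal_mult[symmetric] ennreal_1[symmetric] ennreal_plus[symmetric] del: ennreal_1 ennreal_plus)
    finally show "ennreal (y powr act_prob \<omega> (fst s)) \<le> (\<integral>\<^sup>+\<omega>'. ?f s \<omega>' \<partial>Om)"
      using powr_le_affine[OF y act_prob_bounds] by (simp add: ennreal_leI)
  qed
  also have "\<dots> = (\<integral>\<^sup>+\<omega>'. (\<Prod>s\<in>S. ?f s \<omega>') \<partial>Om)"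
  proof (rule P.indep_vars_nn_integral[OF fS, symmetric])
    show "P.indep_vars (\<lambda>_. borel) ?f S"
    proof (rule indep_vars_local)
      fix s assume s: "s \<in> S"
      show "?f s \<in> borel_measurable Om"
        using pred_act_slot[OF \<omega> SU(1,2)[OF s]] by measurable
      show "{(0, fst s, snd s), (1, fst s, snd s)} \<subseteq> Idx" using SU[OF s] by (cases s) auto
      fix \<omega>1 \<omega>2 :: "coord \<Rightarrow> real" assume "\<And>i. i \<in> {(0, fst s, snd s), (1, fst s, snd s)} \<Longrightarrow> \<omega>1 i = \<omega>2 i"
      then have "sig \<omega>1 (fst s) (snd s) = sig \<omega>2 (fst s) (snd s)" unfolding sig_def by auto
      then show "?f s \<omega>1 = ?f s \<omega>2" by simp
    qed (auto simp: disjoint_family_on_def)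
  qed simp
  also have "\<dots> = (\<integral>\<^sup>+\<omega>'. ennreal (y ^ ztest F (mix J \<omega> \<omega>')) \<partial>Om)"
  proof (rule nn_integral_cong)
    fix \<omega>'
    have "(\<Prod>s\<in>S. if ?a s \<omega>' then y else 1) = y ^ card {s \<in> S. ?a s \<omega>'}"
      using fS by (simp add: prod.If_cases Int_def)
    moreover have "(\<Prod>s\<in>S. ?f s \<omega>') = ennreal (\<Prod>s\<in>S. if ?a s \<omega>' then y else 1)"
      using y by (intro prod_ennreal) auto
    ultimately show "(\<Prod>s\<in>S. ?f s \<omega>') = ennreal (y ^ ztest F (mix J \<omega> \<omega>'))" unfolding z by simp
  qed
  finally show ?thesis .
qed

lemma measurable_train_card:
  assumes "i \<in> U" shows "(\<lambda>\<omega>. train \<omega> i) \<in> Om \<rightarrow>\<^sub>M count_space UNIV"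
  by (rule measurable_pattern[where S = "{1..L}" and P = "\<lambda>l \<omega>. \<omega> (2, i, l) > 1/2"])
    (use assms pred_label_Om in \<open>auto simp: train_def\<close>)

lemma measurable_test_weight: "F \<subseteq> U \<Longrightarrow> test_weight F \<in> borel_measurable Om"
proof -
  assume F: "F \<subseteq> U"
  have "(\<lambda>\<omega>. real (card ({1..L} - train \<omega> i))) \<in> borel_measurable Om" if "i \<in> F" for i
    by (rule measurable_compose[OF measurable_train_card]) (use F that in auto)
  moreover have "(\<lambda>\<omega>. act_prob \<omega> i) \<in> borel_measurable Om" if "i \<in> F" for i
    using F that by (intro measurable_pr) auto
  ultimately show ?thesis unfolding test_weight_def[abs_def] by (intro borel_measurable_sum borel_measurable_times)
qed

lemma test_weight_mgf:
  assumes y: "1 \<le> y" "y < 2" and F: "F \<subseteq> U"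
  shows "(\<integral>\<^sup>+\<omega>. ennreal (y powr test_weight F \<omega>) \<partial>Om) \<le> ennreal ((1 / (2 - y)) ^ (C * rk F))"
proof -
  let ?A = "{x. fst x \<noteq> 2} :: coord set"
  let ?J = "\<lambda>\<omega>. {(\<kappa>, j, l). \<kappa> \<le> 1 \<and> l \<in> {1..L} \<and> l \<notin> train \<omega> j} :: coord set"
  let ?W = "\<lambda>\<omega>. ennreal (y powr test_weight F \<omega>)" and ?Z = "\<lambda>\<omega>. ennreal (y ^ ztest F \<omega>)"
  have mW: "?W \<in> borel_measurable Om" using measurable_test_weight[OF F] by measurable
  have mZ: "?Z \<in> borel_measurable Om" by (rule measurable_compose[OF measurable_ztest]) simp
  \<comment> \<open>The set \<open>?J\<close> of test coordinates depends on the coins, whereas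
    \<open>resample\<close> takes a fixed set. Reading the coins from \<omega>0 first makes
    \<open>?J \<omega>0\<close> constant in the inner integrals.\<close>
  have "(\<integral>\<^sup>+\<omega>. ?W \<omega> \<partial>Om) = (\<integral>\<^sup>+\<omega>0. \<integral>\<^sup>+\<omega>. ?W (mix ?A \<omega>0 \<omega>) \<partial>Om \<partial>Om)" by (rule resample[OF mW])
  also have "\<dots> \<le> (\<integral>\<^sup>+\<omega>0. \<integral>\<^sup>+\<omega>. \<integral>\<^sup>+\<omega>'. ?Z (mix ?A \<omega>0 (mix (?J \<omega>0) \<omega> \<omega>')) \<partial>Om \<partial>Om \<partial>Om)"
  proof (intro nn_integral_mono)
    fix \<omega>0 \<omega> assume w: "\<omega>0 \<in> space Om" "\<omega> \<in> space Om"
    have "?J (mix ?A \<omega>0 \<omega>) = ?J \<omega>0" by (auto simp: train_def mix_def)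
    moreover have "mix ?A \<omega>0 (mix (?J \<omega>0) \<omega> \<omega>') = mix (?J \<omega>0) (mix ?A \<omega>0 \<omega>) \<omega>'" for \<omega>'
      by (auto simp: mix_def fun_eq_iff)
    ultimately show "?W (mix ?A \<omega>0 \<omega>) \<le> (\<integral>\<^sup>+\<omega>'. ?Z (mix ?A \<omega>0 (mix (?J \<omega>0) \<omega> \<omega>')) \<partial>Om)"
      using test_integral_ge[OF y(1) F mix_space[OF w], of "?J \<omega>0" ?A] by simp
  qed
  also have "\<dots> = (\<integral>\<^sup>+\<omega>0. \<integral>\<^sup>+\<omega>. ?Z (mix ?A \<omega>0 \<omega>) \<partial>Om \<partial>Om)"
    by (intro nn_integral_cong resample[symmetric] measurable_compose[OF measurable_mix2 mZ])
  also have "\<dots> = (\<integral>\<^sup>+\<omega>. ?Z \<omega> \<partial>Om)" by (rule resample[OF mZ, symmetric])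
  also have "\<dots> \<le> ennreal ((1 / (2 - y)) ^ (C * rk F))" by (rule ztest_mgf[OF y F])
  finally show ?thesis .
qed

section \<open>Tail bounds for labels and occupancy\<close>

definition lab_good :: "(coord \<Rightarrow> real) \<Rightarrow> bool" where
  "lab_good \<omega> \<longleftrightarrow> (\<forall>i\<in>U. \<bar>real (card (train \<omega> i)) - 2 * C\<bar> \<le> e * C)"

definition occ_good :: "(coord \<Rightarrow> real) \<Rightarrow> bool" where
  "occ_good \<omega> \<longleftrightarrow> (\<forall>F\<subseteq>U. (\<Sum>i\<in>F. act_prob \<omega> i) \<le> 1/2 * (1 + e) * rk F)"

lemma pred_lab_good: "Measurable.pred Om lab_good"
  unfolding lab_good_def[abs_def]
  by (intro pred_intros_finite measurable_compose[OF measurable_train_card]) auto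

lemma pred_occ: "F \<subseteq> U \<Longrightarrow> Measurable.pred Om (\<lambda>\<omega>. (\<Sum>i\<in>F. act_prob \<omega> i) \<le> c)"
proof -
  assume F: "F \<subseteq> U"
  then have [measurable]: "i \<in> F \<Longrightarrow> (\<lambda>\<omega>. act_prob \<omega> i) \<in> borel_measurable Om" for i
    using measurable_pr[of i] by auto
  show ?thesis by measurable
qed

lemma pred_occ_good: "Measurable.pred Om occ_good"
proof -
  have "Measurable.pred Om (\<lambda>\<omega>. \<forall>F\<in>Pow U. (\<Sum>i\<in>F. act_prob \<omega> i) \<le> 1/2 * (1 + e) * rk F)"
    by (intro pred_intros_finite pred_occ) auto
  then show ?thesis by (simp add: occ_good_def[abs_def] Ball_def)
qed

text \<open>Chernoff's method. With good labels each item has at least \<open>(2 - e) * C\<close>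
  test slots, so excess occupancy forces \<open>test_weight F\<close> above
  \<open>(1 - e/2) * (1 + e) * (C * rk F)\<close>, and \<open>test_weight_mgf\<close> bounds its
  exponential moment.\<close>

lemma occupancy_single:
  assumes y: "1 < y" "y < 2" and F: "F \<subseteq> U" and L: "L = 4 * C" and e: "0 < e" "e \<le> 1"
  shows "emeasure Om {\<omega> \<in> space Om. lab_good \<omega> \<and> \<not> (\<Sum>i\<in>F. act_prob \<omega> i) \<le> 1/2 * (1 + e) * rk F}
    \<le> ennreal ((1 / (2 - y) * y powr (- ((1 - e/2) * (1 + e)))) ^ (C * rk F))" (is "emeasure Om ?bad \<le> _")
proof -
  let ?c = "(1 - e/2) * (1 + e) * (C * rk F)"
  have m: "?bad \<in> sets Om"
    using pred_lab_good pred_occ[OF F, of "1/2 * (1 + e) * rk F"] by measurable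
  have W: "?c \<le> test_weight F \<omega>" if "\<omega> \<in> ?bad" for \<omega>
  proof -
    have "(2 * C - e * C) * act_prob \<omega> i \<le> real (card ({1..L} - train \<omega> i)) * act_prob \<omega> i" if "i \<in> F" for i
    proof (rule mult_right_mono[OF _ act_prob_bounds(1)])
      have "\<bar>real (card (train \<omega> i)) - 2 * C\<bar> \<le> e * C"
        using \<open>\<omega> \<in> ?bad\<close> F that unfolding lab_good_def by auto
      moreover have "train \<omega> i \<subseteq> {1..L}" by (auto simp: train_def)
      then have "card ({1..L} - train \<omega> i) = L - card (train \<omega> i)" "card (train \<omega> i) \<le> L"
        using card_mono[of "{1..L}" "train \<omega> i"] by (simp_all add: card_Diff_subset finite_subset)
      ultimately show "2 * C - e * C \<le> real (card ({1..L} - train \<omega> i))" using L by (simp add: of_nat_diff)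
    qed
    then have "(\<Sum>i\<in>F. (2 * C - e * C) * act_prob \<omega> i) \<le> test_weight F \<omega>"
      unfolding test_weight_def by (rule sum_mono)
    moreover have "(2 * C - e * C) * (1/2 * (1 + e) * rk F) \<le> (2 * C - e * C) * (\<Sum>i\<in>F. act_prob \<omega> i)"
    proof (rule mult_left_mono)
      have "e * C \<le> 1 * real C" using e by (intro mult_right_mono) auto
      then show "0 \<le> real (2 * C) - e * real C" by simp
    qed (use that in auto)
    moreover have "?c = (2 * C - e * C) * (1/2 * (1 + e) * rk F)" by (simp add: field_simps)
    ultimately show ?thesis unfolding sum_distrib_left[symmetric] by linarith
  qed
  have "emeasure Om ?bad = (\<integral>\<^sup>+\<omega>. indicator ?bad \<omega> \<partial>Om)" using m by simp
  also have "\<dots> \<le> (\<integral>\<^sup>+\<omega>. ennreal (y powr (- ?c)) * ennreal (y powr test_weight F \<omega>) \<partial>Om)"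
  proof (rule nn_integral_mono)
    fix \<omega>
    have "1 \<le> y powr (- ?c + test_weight F \<omega>)" if "\<omega> \<in> ?bad"
      using W[OF that] y by (intro ge_one_powr_ge_zero) auto
    then show "indicator ?bad \<omega> \<le> ennreal (y powr (- ?c)) * ennreal (y powr test_weight F \<omega>)"
      by (auto simp: indicator_def ennreal_mult[symmetric] powr_add[symmetric] simp flip: ennreal_1 intro!: ennreal_leI)
  qed
  also have "\<dots> = ennreal (y powr (- ?c)) * (\<integral>\<^sup>+\<omega>. ennreal (y powr test_weight F \<omega>) \<partial>Om)"
    by (intro nn_integral_cmult measurable_compose[OF measurable_test_weight[OF F]]) measurable
  also have "\<dots> \<le> ennreal (y powr (- ?c)) * ennreal ((1 / (2 - y)) ^ (C * rk F))"
    using y F by (intro mult_left_mono test_weight_mgf) auto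
  also have "\<dots> = ennreal (y powr (- ?c) * (1 / (2 - y)) ^ (C * rk F))"
    using y by (simp add: ennreal_mult)
  also have "y powr (- ?c) = (y powr (- ((1 - e/2) * (1 + e)))) ^ (C * rk F)"
    using y by (simp add: powr_powr powr_realpow[symmetric])
  finally show ?thesis by (simp add: power_mult_distrib[symmetric] mult.commute)
qed

lemma act_prob_loop: "i \<in> U \<Longrightarrow> i \<in> spn {} \<Longrightarrow> act_prob \<omega> i = 0"
  unfolding act_prob_def act_def using loop_blocked by simp

text \<open>A violated constraint on \<open>F\<close> is also violated on the span of a basis of
  \<open>F\<close>, so a union bound over nonempty independent sets is enough. Summing
  \<open>q ^ card B\<close> over all nonempty subsets gives the binomial expression. The empty basis
  drops out since its span consists of loops.\<close>

lemma occupancy: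
  assumes y: "1 < y" "y < 2" and L: "L = 4 * C" and e: "0 < e" "e \<le> 1"
    and q: "q = (1 / (2 - y) * y powr (- ((1 - e/2) * (1 + e)))) ^ C"
  shows "emeasure Om {\<omega> \<in> space Om. lab_good \<omega> \<and> \<not> occ_good \<omega>} \<le> ennreal ((1 + q) ^ n - 1)"
proof -
  let ?bad = "\<lambda>F. {\<omega> \<in> space Om. lab_good \<omega> \<and> \<not> (\<Sum>i\<in>F. act_prob \<omega> i) \<le> 1/2 * (1 + e) * rk F}"
  have q0: "q \<ge> 0" unfolding q using y by simp
  have bad: "?bad F \<in> sets Om" if "F \<subseteq> U" for F
    using pred_lab_good pred_occ[OF that, of "1/2 * (1 + e) * rk F"] by measurable
  have spnU: "spn B \<subseteq> U" for B by (auto simp: spn_def)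
  have "{\<omega> \<in> space Om. lab_good \<omega> \<and> \<not> occ_good \<omega>} \<subseteq> (\<Union>B\<in>Ind - {{}}. ?bad (spn B))"
  proof
    fix \<omega> assume \<omega>: "\<omega> \<in> {\<omega> \<in> space Om. lab_good \<omega> \<and> \<not> occ_good \<omega>}"
    then obtain F where F: "F \<subseteq> U" "\<not> (\<Sum>i\<in>F. act_prob \<omega> i) \<le> 1/2 * (1 + e) * rk F" unfolding occ_good_def by auto
    obtain B where B: "B \<in> Ind" "B \<subseteq> F" "card B = rk F" "F \<subseteq> spn B" by (rule spanning_Ind_obtain[OF F(1)])
    have "B \<noteq> {}"
    proof
      assume "B = {}"
      then have "(\<Sum>i\<in>F. act_prob \<omega> i) = 0" using B(4) F(1) by (intro sum.neutral) (auto intro: act_prob_loop)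
      then show False using F(2) e by auto
    qed
    moreover have "(\<Sum>i\<in>F. act_prob \<omega> i) \<le> (\<Sum>i\<in>spn B. act_prob \<omega> i)"
      using B(4) spnU finite_U act_prob_bounds by (intro sum_mono2) (auto intro: finite_subset)
    moreover have "rk (spn B) = rk F" using rk_spn[OF Ind_sub[OF B(1)]] rk_Ind[OF B(1)] B(3) by simp
    ultimately show "\<omega> \<in> (\<Union>B\<in>Ind - {{}}. ?bad (spn B))" using \<omega> F(2) B(1)
      by (intro UN_I[of B]) auto
  qed
  then have "emeasure Om {\<omega> \<in> space Om. lab_good \<omega> \<and> \<not> occ_good \<omega>} \<le> emeasure Om (\<Union>B\<in>Ind - {{}}. ?bad (spn B))"
    using bad[OF spnU] finite_Ind by (intro emeasure_mono) auto
  also have "\<dots> \<le> (\<Sum>B\<in>Ind - {{}}. emeasure Om (?bad (spn B)))"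
    using bad[OF spnU] finite_Ind by (intro emeasure_subadditive_finite) auto
  also have "\<dots> \<le> (\<Sum>B\<in>Ind - {{}}. ennreal (q ^ card B))"
  proof (rule sum_mono)
    fix B assume "B \<in> Ind - {{}}"
    then have "rk (spn B) = card B" using rk_spn[OF Ind_sub] rk_Ind by auto
    then show "emeasure Om (?bad (spn B)) \<le> ennreal (q ^ card B)"
      using occupancy_single[OF y spnU L e, of B] unfolding q by (simp add: power_mult)
  qed
  also have "\<dots> = ennreal (\<Sum>B\<in>Ind - {{}}. q ^ card B)" using q0 by (intro sum_ennreal) simp
  also have "\<dots> \<le> ennreal (\<Sum>B\<in>Pow U - {{}}. q ^ card B)"
    using q0 Ind_sub by (intro ennreal_leI sum_mono2) auto
  also have "(\<Sum>B\<in>Pow U - {{}}. q ^ card B) = (1 + q) ^ n - 1"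
    using sum_Pow_power_card[of U q] by (simp add: sum_diff1)
  finally show ?thesis .
qed

lemma lab_good_prob:
  assumes L: "L = 4 * C" and C: "C > 0" and e: "e > 0"
  shows "emeasure Om {\<omega> \<in> space Om. \<not> lab_good \<omega>} \<le> ennreal (n * (2 * exp (- (e\<^sup>2 * C / 2))))"
proof -
  \<comment> \<open>With \<open>L = 4 * C\<close>, relative deviation \<open>e/4\<close> is the
    absolute deviation \<open>e * C\<close> of \<open>lab_good\<close>.\<close>
  let ?bad = "\<lambda>i. {\<omega> \<in> space Om. \<bar>real (card {l \<in> {1..L}. \<omega> (2, i, l) > 1/2}) - card {1..L} * (1/2)\<bar> \<ge> e/4 * card {1..L}}"
  have b: "emeasure Om (?bad i) \<le> ennreal (2 * exp (- (e\<^sup>2 * C / 2)))" if i: "i \<in> U" for i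
  proof -
    have "emeasure Om (?bad i) \<le> ennreal (2 * exp (- 2 * (e/4)\<^sup>2 * card {1..L}))"
    proof (rule Hoeffding_events[where K = "\<lambda>l. {(2, i, l)}"])
      fix l assume l: "l \<in> {1..L}"
      show "Measurable.pred Om (\<lambda>\<omega>. \<omega> (2, i, l) > 1/2)" by (rule pred_label_Om[OF i l])
      have "emeasure Om {\<omega> \<in> space Om. \<omega> (2, i, l) > 1/2} = (\<integral>\<^sup>+\<omega>. indicator {1/2<..} (\<omega> (2, i, l)) \<partial>Om)"
        by (subst nn_integral_indicator_pred[OF pred_label_Om[OF i l], symmetric])
          (auto intro!: nn_integral_cong simp: indicator_def)
      also have "\<dots> = emeasure (mu (2, i, l)) {1/2<..}" using i l by (intro nn_integral_coord) auto
      also have "mu (2, i, l) = unif" by (simp add: mu_def)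
      finally have "P.prob {\<omega> \<in> space Om. \<omega> (2, i, l) > 1/2} = enn2real (ennreal (1/2))"
        unfolding emeasure_unif_greater measure_def by (rule arg_cong)
      then show "P.prob {\<omega> \<in> space Om. \<omega> (2, i, l) > 1/2} = 1/2"
        by (subst (asm) enn2real_ennreal) simp_all
      show "{(2, i, l)} \<subseteq> Idx" using i l by simp
    next
      show "{1..L} \<noteq> {}" using L C by auto
    qed (use e in \<open>auto simp: disjoint_family_on_def\<close>)
    also have "- 2 * (e/4)\<^sup>2 * card {1..L} = - (e\<^sup>2 * C / 2)" using L by (simp add: power2_eq_square)
    finally show ?thesis .
  qed
  have "{\<omega> \<in> space Om. \<not> lab_good \<omega>} \<subseteq> (\<Union>i\<in>U. ?bad i)"
    unfolding lab_good_def train_def using L by auto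
  moreover have bs: "?bad i \<in> sets Om" if "i \<in> U" for i
    using measurable_train_card[OF that] unfolding train_def by measurable
  ultimately have "emeasure Om {\<omega> \<in> space Om. \<not> lab_good \<omega>} \<le> emeasure Om (\<Union>i\<in>U. ?bad i)"
    by (intro emeasure_mono) auto
  also have "\<dots> \<le> (\<Sum>i\<in>U. emeasure Om (?bad i))"
    using bs by (intro emeasure_subadditive_finite) auto
  also have "\<dots> \<le> (\<Sum>i\<in>U. ennreal (2 * exp (- (e\<^sup>2 * C / 2))))" by (intro sum_mono b)
  also have "\<dots> = ennreal (n * (2 * exp (- (e\<^sup>2 * C / 2))))"
    by (subst sum_ennreal) auto
  finally show ?thesis .
qed

end

section \<open>The value of the active items\<close>

lemma pred_eq:
  fixes a b :: "'z \<Rightarrow> real"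
  assumes [measurable]: "a \<in> borel_measurable M" "b \<in> borel_measurable M"
  shows "Measurable.pred M (\<lambda>x. a x = b x)"
  by measurable

lemma ennreal_sum_le: "ennreal (\<Sum>i\<in>S. f i) \<le> (\<Sum>i\<in>S. ennreal (f i))"
proof -
  have "ennreal (\<Sum>i\<in>S. f i) \<le> ennreal (\<Sum>i\<in>S. max 0 (f i))"
    by (intro ennreal_leI sum_mono) simp
  also have "\<dots> = (\<Sum>i\<in>S. ennreal (max 0 (f i)))" by (intro sum_ennreal[symmetric]) simp
  finally show ?thesis by simp
qed

context finite_matroid
begin

definition opt :: "('a \<Rightarrow> real) \<Rightarrow> real" where
  "opt v = (MAX S\<in>Ind. \<Sum>i\<in>S. v i)"

lemma opt_obtain: obtains S where "S \<in> Ind" "opt v = (\<Sum>i\<in>S. v i)"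
proof -
  have "opt v \<in> (\<lambda>S. \<Sum>i\<in>S. v i) ` Ind"
    unfolding opt_def using finite_Ind empty_Ind by (intro Max_in) auto
  then show thesis using that by auto
qed

lemma opt_ge: "S \<in> Ind \<Longrightarrow> (\<Sum>i\<in>S. v i) \<le> opt v"
  unfolding opt_def using finite_Ind by (intro Max_ge) auto

lemma opt_cong: "(\<And>i. i \<in> U \<Longrightarrow> v i = v' i) \<Longrightarrow> opt v = opt v'"
  unfolding opt_def using Ind_sub by (intro arg_cong[of _ _ Max] image_cong sum.cong) auto

text \<open>The optimal independent sets of \<open>C\<close> columns use distinct slots, and
  together at most \<open>C * rk F\<close> of them have items in \<open>F\<close>. Their union is
  thus a competitor that the greedy rule on the polymatroid must match.\<close>

lemma columns_le_greedy:
  fixes \<sigma> :: "'a \<Rightarrow> nat \<Rightarrow> 'l" and v :: "'a \<times> 'l \<Rightarrow> real"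
  assumes E: "finite E" "fst ` E \<subseteq> U"
    and total: "\<And>x y. R x y \<or> R y x" and trans: "\<And>x y z. R x y \<Longrightarrow> R y z \<Longrightarrow> R x z"
    and w: "\<And>e f. e \<in> E \<Longrightarrow> f \<in> E \<Longrightarrow> R e f \<Longrightarrow> v e \<le> v f"
    and \<sigma>: "\<And>i. i \<in> U \<Longrightarrow> inj_on (\<sigma> i) {..<C}" "\<And>i c. i \<in> U \<Longrightarrow> c < C \<Longrightarrow> (i, \<sigma> i c) \<in> E"
  shows "(\<Sum>c<C. ennreal (opt (\<lambda>i. v (i, \<sigma> i c)))) \<le> (\<Sum>e\<in>E. if blocked C (\<lambda>j. card {f \<in> E. fst f = j \<and> \<not> R f e}) (fst e) then 0 else ennreal (v e))"
proof -
  have "\<forall>c. \<exists>S. S \<in> Ind \<and> opt (\<lambda>i. v (i, \<sigma> i c)) = (\<Sum>i\<in>S. v (i, \<sigma> i c))"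
  proof
    fix c show "\<exists>S. S \<in> Ind \<and> opt (\<lambda>i. v (i, \<sigma> i c)) = (\<Sum>i\<in>S. v (i, \<sigma> i c))"
      by (rule opt_obtain[of "\<lambda>i. v (i, \<sigma> i c)"]) blast
  qed
  from choice[OF this] obtain S where S: "S c \<in> Ind" "opt (\<lambda>i. v (i, \<sigma> i c)) = (\<Sum>i\<in>S c. v (i, \<sigma> i c))" for c by blast
  define g where "g = (\<lambda>(c, i). (i, \<sigma> i c))"
  let ?D = "Sigma {..<C} S"
  have SU: "S c \<subseteq> U" "finite (S c)" for c using S(1) Ind_sub finite_in_Ind by auto
  have inj: "inj_on g ?D"
  proof (rule inj_onI)
    fix x y assume "x \<in> ?D" "y \<in> ?D" "g x = g y"
    then show "x = y" using \<sigma>(1) SU(1) unfolding g_def by (auto dest: inj_onD)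
  qed
  have "(\<Sum>c<C. ennreal (opt (\<lambda>i. v (i, \<sigma> i c)))) \<le> (\<Sum>c<C. \<Sum>i\<in>S c. ennreal (v (i, \<sigma> i c)))"
    unfolding S(2) by (intro sum_mono ennreal_sum_le)
  also have "\<dots> = (\<Sum>x\<in>?D. ennreal (v (g x)))"
    using SU by (subst sum.Sigma) (auto simp: g_def intro!: sum.cong)
  also have "\<dots> = (\<Sum>e\<in>g ` ?D. ennreal (v e))"
    using inj by (simp add: sum.reindex)
  also have "\<dots> \<le> (\<Sum>e\<in>E. if blocked C (\<lambda>j. card {f \<in> E. fst f = j \<and> \<not> R f e}) (fst e) then 0 else ennreal (v e))"
  proof (rule greedy_optimal[OF E total trans])
    show "g ` ?D \<subseteq> E" using \<sigma>(2) SU(1) unfolding g_def by auto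
    show "ennreal (v e) \<le> ennreal (v f)" if "e \<in> E" "f \<in> E" "R e f" for e f using w[OF that] by (rule ennreal_leI)
    fix F assume F: "F \<subseteq> U"
    have "{e \<in> g ` ?D. fst e \<in> F} \<subseteq> (\<Union>c\<in>{..<C}. (\<lambda>i. g (c, i)) ` (S c \<inter> F))"
      unfolding g_def by auto
    then have "card {e \<in> g ` ?D. fst e \<in> F} \<le> card (\<Union>c\<in>{..<C}. (\<lambda>i. g (c, i)) ` (S c \<inter> F))"
      using SU by (intro card_mono) auto
    also have "\<dots> \<le> (\<Sum>c<C. card ((\<lambda>i. g (c, i)) ` (S c \<inter> F)))" by (rule card_UN_le) simp
    also have "\<dots> \<le> (\<Sum>c<C. rk F)"
    proof (rule sum_mono)
      fix c
      have "card ((\<lambda>i. g (c, i)) ` (S c \<inter> F)) \<le> card (S c \<inter> F)" using SU by (intro card_image_le) auto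
      also have "\<dots> \<le> rk F" by (intro rk_ge Ind_down[OF S(1)[of c]]) auto
      finally show "card ((\<lambda>i. g (c, i)) ` (S c \<inter> F)) \<le> rk F" .
    qed
    finally show "card {e \<in> g ` ?D. fst e \<in> F} \<le> C * rk F" by simp
  qed
  finally show ?thesis .
qed

end

context prophet_instance
begin

definition OPT :: ennreal where "OPT = expected_opt n Ind D"

lemma measurable_opt: "opt \<in> borel_measurable (PiM U D)"
proof -
  have v: "(\<lambda>v. v i) \<in> borel_measurable (PiM U D)" if "i \<in> U" for i
  proof -
    have "(\<lambda>v. v i) \<in> PiM U D \<rightarrow>\<^sub>M D i" by (rule measurable_component_singleton[OF that])
    moreover have "sets (D i) = sets borel" using D[OF that] by (simp add: nonneg_distribution_def)
    ultimately show ?thesis using measurable_cong_sets[OF refl, of "D i" borel] by blast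
  qed
  have "(\<lambda>v. \<Sum>i\<in>S. v i) \<in> borel_measurable (PiM U D)" if "S \<in> Ind" for S
    using Ind_sub[OF that] by (intro borel_measurable_sum v) blast
  then have "(\<lambda>v. MAX S\<in>Ind. \<Sum>i\<in>S. v i) \<in> borel_measurable (PiM U D)"
    using finite_Ind by (intro borel_measurable_Max)
  then show ?thesis unfolding opt_def[abs_def] .
qed

lemma OPT_column:
  assumes "\<And>i. i \<in> U \<Longrightarrow> s i \<le> num_samples"
  shows "(\<integral>\<^sup>+\<omega>. ennreal (opt (\<lambda>i. \<omega> (0, i, s i))) \<partial>Om) = OPT"
    and "(\<lambda>\<omega>. ennreal (opt (\<lambda>i. \<omega> (0, i, s i)))) \<in> borel_measurable Om"
proof -
  let ?s = "\<lambda>i. (0, i, s i) :: coord"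
  have M: "PiM U (\<lambda>i. mu (?s i)) = PiM U D" by (intro PiM_cong) (auto simp: mu_def)
  have s: "inj_on ?s U" "?s ` U \<subseteq> Idx" using assms by (auto simp: inj_on_def)
  have f: "(\<lambda>v. ennreal (opt v)) \<in> borel_measurable (PiM U (\<lambda>i. mu (?s i)))"
    unfolding M by (rule measurable_compose[OF measurable_opt]) simp
  have eq: "opt (\<lambda>i. \<omega> (0, i, s i)) = opt (\<lambda>i\<in>U. \<omega> (?s i))" for \<omega> by (rule opt_cong) simp
  show "(\<lambda>\<omega>. ennreal (opt (\<lambda>i. \<omega> (0, i, s i)))) \<in> borel_measurable Om"
    unfolding eq by (rule measurable_compose[OF reindex(2)[OF s f] f])
  show "(\<integral>\<^sup>+\<omega>. ennreal (opt (\<lambda>i. \<omega> (0, i, s i))) \<partial>Om) = OPT"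
    unfolding eq using reindex(1)[OF s f] unfolding M OPT_def expected_opt_def opt_def .
qed

section \<open>Absence of ties and the expected gain of active items\<close>

lemma emeasure_unif_singleton: "emeasure unif {a} = 0"
proof -
  have "emeasure lborel ({0..1} \<inter> {a}) \<le> emeasure lborel {a}" by (intro emeasure_mono) auto
  then show ?thesis unfolding unif_def by simp
qed

lemma AE_coord_neq:
  assumes x: "x \<in> Idx" and y: "y \<in> Idx" and ne: "x \<noteq> y" and mu: "mu y = unif"
  shows "AE \<omega> in Om. \<omega> x \<noteq> \<omega> y"
proof -
  have [measurable]: "(\<lambda>\<omega>. \<omega> x) \<in> borel_measurable Om" "(\<lambda>\<omega>. \<omega> y) \<in> borel_measurable Om"
    by (rule coord_measurable[OF x], rule coord_measurable[OF y])
  have m: "Measurable.pred Om (\<lambda>\<omega>. \<omega> x = \<omega> y)" by (rule pred_eq) fact+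
  have "emeasure Om {\<omega> \<in> space Om. \<omega> x = \<omega> y} = (\<integral>\<^sup>+\<omega>. indicator {\<omega>. \<omega> x = \<omega> y} \<omega> \<partial>Om)"
    by (rule nn_integral_indicator_pred[OF m, symmetric])
  also have "\<dots> = (\<integral>\<^sup>+\<omega>. \<integral>\<^sup>+\<omega>'. indicator {\<omega>. \<omega> x = \<omega> y} (mix {y} \<omega> \<omega>') \<partial>Om \<partial>Om)"
    by (rule resample[OF measurable_indicator_pred[OF m]])
  also have "\<dots> = (\<integral>\<^sup>+\<omega>. \<integral>\<^sup>+\<omega>'. indicator {\<omega> x} (\<omega>' y) \<partial>Om \<partial>Om)"
    using ne by (intro nn_integral_cong) (auto simp: mix_def indicator_def)
  also have "\<dots> = (\<integral>\<^sup>+\<omega>. emeasure unif {\<omega> x} \<partial>Om)"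
    by (intro nn_integral_cong) (subst nn_integral_coord[OF y], auto simp: mu)
  also have "\<dots> = 0" by (simp add: emeasure_unif_singleton)
  finally have "emeasure Om {\<omega> \<in> space Om. \<omega> x = \<omega> y} = 0" .
  then show ?thesis
    by (intro AE_I[of _ _ "{\<omega> \<in> space Om. \<omega> x = \<omega> y}"]) (use m in auto)
qed

lemma AE_no_ties:
  "AE \<omega> in Om. \<forall>e\<in>U \<times> {0..num_samples}. \<forall>f\<in>U \<times> {0..num_samples}. e \<noteq> f \<longrightarrow> \<not> (beats (sig \<omega> (fst e) (snd e)) (sig \<omega> (fst f) (snd f)) \<and> beats (sig \<omega> (fst f) (snd f)) (sig \<omega> (fst e) (snd e)))"
proof -
  have "AE \<omega> in Om. e \<noteq> f \<longrightarrow> \<not> (beats (sig \<omega> (fst e) (snd e)) (sig \<omega> (fst f) (snd f)) \<and> beats (sig \<omega> (fst f) (snd f)) (sig \<omega> (fst e) (snd e)))"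
    if ef: "e \<in> U \<times> {0..num_samples}" "f \<in> U \<times> {0..num_samples}" for e f
  proof (cases "e = f")
    case False
    then have "AE \<omega> in Om. \<omega> (1, fst e, snd e) \<noteq> \<omega> (1, fst f, snd f)"
      using ef by (intro AE_coord_neq) (auto simp: mu_def prod_eq_iff)
    then show ?thesis by eventually_elim (auto simp: beats_def sig_def)
  qed simp
  then show ?thesis by (intro AE_finite_allI) auto
qed

definition val :: "nat \<Rightarrow> (coord \<Rightarrow> real) \<Rightarrow> ennreal" where
  "val i \<omega> = ennreal (\<omega> (0, i, 0)) * indicator {\<omega>. act \<omega> i (sig \<omega> i 0)} \<omega>"

lemma measurable_val: "i \<in> U \<Longrightarrow> val i \<in> borel_measurable Om"
proof -
  assume i: "i \<in> U"
  have "(\<lambda>\<omega>. ennreal (\<omega> (0, i, 0))) \<in> borel_measurable Om"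
    using i by (intro measurable_compose[OF coord_measurable]) auto
  moreover have "(indicator {\<omega>. act \<omega> i (sig \<omega> i 0)} :: _ \<Rightarrow> ennreal) \<in> borel_measurable Om"
    using i by (intro measurable_indicator_pred pred_act_Om) auto
  ultimately show ?thesis unfolding val_def[abs_def] by (rule borel_measurable_times_ennreal)
qed

text \<open>Given the labels in \<open>\<omega>0\<close>, slot 0 of item \<open>i\<close> is exchangeable with its training slots.\<close>

lemma slot_value_le:
  assumes w0: "\<omega>0 \<in> space Om" and i: "i \<in> U" and l: "l \<in> insert 0 (train \<omega>0 i)"
    and E: "E = Sigma U (\<lambda>j. insert 0 (train \<omega>0 j))"
  shows "(\<integral>\<^sup>+\<omega>. (if blocked C (\<lambda>j. card {f \<in> E. fst f = j \<and> \<not> beats (sig \<omega> i l) (sig \<omega> (fst f) (snd f))}) i then 0 else ennreal (\<omega> (0, i, l))) \<partial>Om)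
    \<le> (\<integral>\<^sup>+\<omega>. val i (mix {x. fst x \<noteq> 2} \<omega>0 \<omega>) \<partial>Om)"
proof -
  let ?A = "{x. fst x \<noteq> 2} :: coord set"
  let ?sw = "\<lambda>\<omega>. \<lambda>x\<in>Idx. \<omega> (swap_slot i 0 l x) :: real"
  have tr: "train \<omega>0 j \<subseteq> {1..L}" for j by (auto simp: train_def)
  have lk: "l \<le> num_samples" using l tr L_le_num_samples by force
  have "(\<integral>\<^sup>+\<omega>. val i (mix ?A \<omega>0 \<omega>) \<partial>Om) = (\<integral>\<^sup>+\<omega>. val i (mix ?A \<omega>0 (?sw \<omega>)) \<partial>Om)"
    by (rule nn_integral_swap_slot[symmetric]) (use i lk measurable_compose[OF measurable_mix2[OF w0] measurable_val[OF i]] in auto)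
  moreover have "(\<integral>\<^sup>+\<omega>. (if blocked C (\<lambda>j. card {f \<in> E. fst f = j \<and> \<not> beats (sig \<omega> i l) (sig \<omega> (fst f) (snd f))}) i then 0 else ennreal (\<omega> (0, i, l))) \<partial>Om)
    \<le> (\<integral>\<^sup>+\<omega>. val i (mix ?A \<omega>0 (?sw \<omega>)) \<partial>Om)"
  proof (rule nn_integral_mono_AE, rule AE_mp[OF AE_no_ties], rule AE_I2, rule impI)
    fix \<omega>
    assume ties: "\<forall>e\<in>U \<times> {0..num_samples}. \<forall>f\<in>U \<times> {0..num_samples}. e \<noteq> f \<longrightarrow> \<not> (beats (sig \<omega> (fst e) (snd e)) (sig \<omega> (fst f) (snd f)) \<and> beats (sig \<omega> (fst f) (snd f)) (sig \<omega> (fst e) (snd e)))"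
    let ?m = "mix ?A \<omega>0 (?sw \<omega>)"
    let ?c = "\<lambda>j. card {f \<in> E. fst f = j \<and> \<not> beats (sig \<omega> i l) (sig \<omega> (fst f) (snd f))}"
    have s0: "sig ?m i 0 = sig \<omega> i l" "?m (0, i, 0) = \<omega> (0, i, l)"
      using i by (auto simp: sig_def mix_def swap_slot_def)
    have tm: "train ?m j = train \<omega>0 j" for j by (auto simp: train_def mix_def)
    have "cnt ?m (sig \<omega> i l) j \<le> ?c j" if j: "j \<in> U" for j
    proof -
      \<comment> \<open>After the exchange, training slot \<open>l\<close> of item \<open>i\<close>
        holds what slot 0 held before. \<open>?h\<close> returns each training slot to the origin of
        its content, which shows that the exchanged counts are at most the greedy counts.\<close>
      let ?h = "\<lambda>l'. (j, if j = i \<and> l' = l then 0 else l')"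
      have "{l' \<in> train \<omega>0 j. beats (sig ?m j l') (sig \<omega> i l)} \<subseteq> train \<omega>0 j" by auto
      have "?h l' \<in> {f \<in> E. fst f = j \<and> \<not> beats (sig \<omega> i l) (sig \<omega> (fst f) (snd f))}"
        if l': "l' \<in> train \<omega>0 j" "beats (sig ?m j l') (sig \<omega> i l)" for l'
      proof -
        have pos: "l' \<noteq> 0" "l' \<le> num_samples" using l'(1) tr[of j] L_le_num_samples by force+
        have sg: "sig ?m j l' = sig \<omega> (fst (?h l')) (snd (?h l'))"
          using j pos by (auto simp: sig_def mix_def swap_slot_def)
        have ne: "(i, l) \<noteq> ?h l'" using pos by auto
        have mem: "?h l' \<in> U \<times> {0..num_samples}" "(i, l) \<in> U \<times> {0..num_samples}" using i j lk pos by auto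
        from mp[OF bspec[OF bspec[OF ties mem(2)] mem(1)] ne] have "\<not> (beats (sig \<omega> i l) (sig \<omega> (fst (?h l')) (snd (?h l'))) \<and> beats (sig \<omega> (fst (?h l')) (snd (?h l'))) (sig \<omega> i l))"
          by simp
        then have "\<not> beats (sig \<omega> i l) (sig \<omega> (fst (?h l')) (snd (?h l')))" using l'(2) unfolding sg by simp
        moreover have "?h l' \<in> E" using j l'(1) unfolding E by auto
        ultimately show ?thesis by simp
      qed
      then have sub: "?h ` {l' \<in> train \<omega>0 j. beats (sig ?m j l') (sig \<omega> i l)} \<subseteq> {f \<in> E. fst f = j \<and> \<not> beats (sig \<omega> i l) (sig \<omega> (fst f) (snd f))}"
        by blast
      have inj: "inj_on ?h {l' \<in> train \<omega>0 j. beats (sig ?m j l') (sig \<omega> i l)}"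
        using tr[of j] by (auto simp: inj_on_def split: if_splits)
      have "finite E" unfolding E using tr by (auto intro!: finite_SigmaI finite_subset[of _ "{1..L}"])
      then have fin: "finite {f \<in> E. fst f = j \<and> \<not> beats (sig \<omega> i l) (sig \<omega> (fst f) (snd f))}" by simp
      show ?thesis unfolding cnt_def tm by (rule card_inj_on_le[OF inj sub fin])
    qed
    then have "blocked C ?c i" if "blocked C (cnt ?m (sig \<omega> i l)) i" by (rule blocked_mono[OF that])
    then show "(if blocked C ?c i then 0 else ennreal (\<omega> (0, i, l))) \<le> val i ?m"
      unfolding val_def act_def using s0 by (auto simp: indicator_def)
  qed
  ultimately show ?thesis by simp
qed

text \<open>Each item offers its training slots and slot 0, enough for \<open>C\<close> disjoint
  columns. The greedy bound covers their \<open>C\<close> optima; every slot earns at most the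
  expected online value of its item, and an item has at most \<open>M\<close> slots.\<close>

lemma gain_fixed_labels:
  assumes w0: "\<omega>0 \<in> space Om" and M: "\<And>i. i \<in> U \<Longrightarrow> real (card (train \<omega>0 i)) + 1 \<le> M"
    and CC: "\<And>i. i \<in> U \<Longrightarrow> C \<le> card (train \<omega>0 i) + 1"
  shows "ennreal C * OPT \<le> ennreal M * (\<Sum>i\<in>U. \<integral>\<^sup>+\<omega>. val i (mix {x. fst x \<noteq> 2} \<omega>0 \<omega>) \<partial>Om)"
proof -
  define E where "E = Sigma U (\<lambda>j. insert 0 (train \<omega>0 j))"
  have tr: "train \<omega>0 j \<subseteq> {1..L}" for j by (auto simp: train_def)
  have ft: "finite (train \<omega>0 j)" for j using tr finite_subset by blast
  have ct: "card (insert 0 (train \<omega>0 j)) = card (train \<omega>0 j) + 1" for j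
    using tr[of j] ft[of j] by (subst card_insert_disjoint) auto
  have "\<forall>i\<in>U. \<exists>s. inj_on s {..<C} \<and> s ` {..<C} \<subseteq> insert 0 (train \<omega>0 i)"
  proof
    fix i assume i: "i \<in> U"
    show "\<exists>s. inj_on s {..<C} \<and> s ` {..<C} \<subseteq> insert 0 (train \<omega>0 i)"
      using card_le_inj[of "{..<C}" "insert 0 (train \<omega>0 i)"] CC[OF i] ct[of i] ft[of i] by auto
  qed
  from bchoice[OF this] obtain \<sigma> where s0: "\<forall>i\<in>U. inj_on (\<sigma> i) {..<C} \<and> \<sigma> i ` {..<C} \<subseteq> insert 0 (train \<omega>0 i)" ..
  have \<sigma>: "inj_on (\<sigma> i) {..<C}" "\<sigma> i ` {..<C} \<subseteq> insert 0 (train \<omega>0 i)" if "i \<in> U" for i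
    by (rule conjunct1[OF bspec[OF s0 that]], rule conjunct2[OF bspec[OF s0 that]])
  have fE: "finite E" unfolding E_def using ft by auto
  have k: "\<sigma> i c \<le> num_samples" if "i \<in> U" "c < C" for i c
  proof -
    have "\<sigma> i c \<in> insert 0 {1..L}" using \<sigma>(2)[OF that(1)] that(2) tr[of i] by blast
    then show ?thesis using L_le_num_samples by auto
  qed
  let ?G = "\<lambda>i. \<integral>\<^sup>+\<omega>. val i (mix {x. fst x \<noteq> 2} \<omega>0 \<omega>) \<partial>Om"
  let ?b = "\<lambda>e \<omega>. if blocked C (\<lambda>j. card {f \<in> E. fst f = j \<and> \<not> beats (sig \<omega> (fst e) (snd e)) (sig \<omega> (fst f) (snd f))}) (fst e) then 0 else ennreal (\<omega> (0, fst e, snd e))"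
  have mb: "?b e \<in> borel_measurable Om" if e: "e \<in> E" for e
  proof -
    have slot: "fst f \<in> U" "snd f \<le> num_samples" if "f \<in> E" for f
    proof -
      have "fst f \<in> U \<and> snd f \<in> insert 0 {1..L}" using that tr[of "fst f"] unfolding E_def by (cases f) auto
      then show "fst f \<in> U" "snd f \<le> num_samples" using L_le_num_samples by auto
    qed
    have "(\<lambda>\<omega>. blocked C (\<lambda>j. card {f \<in> E. fst f = j \<and> \<not> beats (sig \<omega> (fst e) (snd e)) (sig \<omega> (fst f) (snd f))}) (fst e)) \<in> Om \<rightarrow>\<^sub>M count_space UNIV"
    proof (rule measurable_pattern[where S = E and P = "\<lambda>f \<omega>. beats (sig \<omega> (fst e) (snd e)) (sig \<omega> (fst f) (snd f))"])
      show "Measurable.pred Om (\<lambda>\<omega>. beats (sig \<omega> (fst e) (snd e)) (sig \<omega> (fst f) (snd f)))" if "f \<in> E" for f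
        unfolding measurable_Om_iff using slot[OF e] slot[OF that] by (intro pred_beats)
      fix \<omega> \<omega>' assume *: "\<And>f. f \<in> E \<Longrightarrow> beats (sig \<omega> (fst e) (snd e)) (sig \<omega> (fst f) (snd f)) = beats (sig \<omega>' (fst e) (snd e)) (sig \<omega>' (fst f) (snd f))"
      have "{f \<in> E. fst f = j \<and> \<not> beats (sig \<omega> (fst e) (snd e)) (sig \<omega> (fst f) (snd f))} = {f \<in> E. fst f = j \<and> \<not> beats (sig \<omega>' (fst e) (snd e)) (sig \<omega>' (fst f) (snd f))}" for j
        using * by blast
      then show "blocked C (\<lambda>j. card {f \<in> E. fst f = j \<and> \<not> beats (sig \<omega> (fst e) (snd e)) (sig \<omega> (fst f) (snd f))}) (fst e) = blocked C (\<lambda>j. card {f \<in> E. fst f = j \<and> \<not> beats (sig \<omega>' (fst e) (snd e)) (sig \<omega>' (fst f) (snd f))}) (fst e)"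
        by simp
    qed (rule fE)
    moreover have "(\<lambda>\<omega>. ennreal (\<omega> (0, fst e, snd e))) \<in> borel_measurable Om"
      using slot[OF e] by (intro measurable_compose[OF coord_measurable]) (cases e, auto)
    ultimately show ?thesis by measurable
  qed
  have "ennreal C * OPT = (\<Sum>c<C. OPT)" by (simp add: ennreal_of_nat_eq_real_of_nat)
  also have "\<dots> = (\<Sum>c<C. \<integral>\<^sup>+\<omega>. ennreal (opt (\<lambda>i. \<omega> (0, i, \<sigma> i c))) \<partial>Om)"
    using k by (intro sum.cong OPT_column(1)[symmetric]) auto
  also have "\<dots> = (\<integral>\<^sup>+\<omega>. (\<Sum>c<C. ennreal (opt (\<lambda>i. \<omega> (0, i, \<sigma> i c)))) \<partial>Om)"
    using k by (intro nn_integral_sum[symmetric] OPT_column(2)) auto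
  also have "\<dots> \<le> (\<integral>\<^sup>+\<omega>. (\<Sum>e\<in>E. ?b e \<omega>) \<partial>Om)"
  proof (rule nn_integral_mono)
    fix \<omega>
    have "(\<Sum>c<C. ennreal (opt (\<lambda>i. (\<lambda>e. \<omega> (0, fst e, snd e)) (i, \<sigma> i c)))) \<le> (\<Sum>e\<in>E. ?b e \<omega>)"
    \<comment> \<open>The arguments are swapped because \<open>R\<close> points from lighter to
      heavier slots.\<close>
    proof (rule columns_le_greedy[where R = "\<lambda>e f. beats (sig \<omega> (fst f) (snd f)) (sig \<omega> (fst e) (snd e))" and E = E and v = "\<lambda>e. \<omega> (0, fst e, snd e)"])
      show "beats (sig \<omega> (fst z) (snd z)) (sig \<omega> (fst x) (snd x))"
        if "beats (sig \<omega> (fst y) (snd y)) (sig \<omega> (fst x) (snd x))" "beats (sig \<omega> (fst z) (snd z)) (sig \<omega> (fst y) (snd y))" for x y z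
        using that by (blast intro: beats_trans)
      show "(i, \<sigma> i c) \<in> E" if "i \<in> U" "c < C" for i c
        using \<sigma>(2)[OF that(1)] that unfolding E_def by blast
    qed (use fE \<sigma>(1) beats_total in \<open>auto simp: E_def beats_def sig_def\<close>)
    then show "(\<Sum>c<C. ennreal (opt (\<lambda>i. \<omega> (0, i, \<sigma> i c)))) \<le> (\<Sum>e\<in>E. ?b e \<omega>)" by simp
  qed
  also have "\<dots> = (\<Sum>e\<in>E. \<integral>\<^sup>+\<omega>. ?b e \<omega> \<partial>Om)" using mb by (intro nn_integral_sum) auto
  also have "\<dots> \<le> (\<Sum>e\<in>E. ?G (fst e))"
    by (intro sum_mono slot_value_le[OF w0]) (auto simp: E_def)
  also have "\<dots> = (\<Sum>i\<in>U. \<Sum>l\<in>insert 0 (train \<omega>0 i). ?G i)"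
    using sum.Sigma[of U "\<lambda>j. insert 0 (train \<omega>0 j)" "\<lambda>i l. ?G i"] ft unfolding E_def by (simp add: case_prod_beta')
  also have "\<dots> \<le> (\<Sum>i\<in>U. ennreal M * ?G i)"
  proof (rule sum_mono)
    fix i assume i: "i \<in> U"
    have "(\<Sum>l\<in>insert 0 (train \<omega>0 i). ?G i) = of_nat (card (train \<omega>0 i) + 1) * ?G i"
      using ct[of i] by simp
    also have "of_nat (card (train \<omega>0 i) + 1) = ennreal (real (card (train \<omega>0 i)) + 1)"
      unfolding ennreal_of_nat_eq_real_of_nat by simp
    also have "\<dots> \<le> ennreal M" using M[OF i] by (rule ennreal_leI)
    finally show "(\<Sum>l\<in>insert 0 (train \<omega>0 i). ?G i) \<le> ennreal M * ?G i" by (simp add: mult_right_mono)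
  qed
  finally show ?thesis by (simp add: sum_distrib_left)
qed

lemma gain_total:
  assumes M: "2 * C + e * C + 1 \<le> M" and e: "0 < e" "e \<le> 1"
  shows "ennreal C * OPT * emeasure Om {\<omega> \<in> space Om. lab_good \<omega>}
    \<le> ennreal M * (\<Sum>i\<in>U. \<integral>\<^sup>+\<omega>. val i \<omega> * indicator {\<omega>. lab_good \<omega>} \<omega> \<partial>Om)"
proof -
  let ?A = "{x. fst x \<noteq> 2} :: coord set"
  have ml: "(indicator {\<omega>. lab_good \<omega>} :: _ \<Rightarrow> ennreal) \<in> borel_measurable Om"
    by (rule measurable_indicator_pred[OF pred_lab_good])
  have mv: "val i \<in> borel_measurable Om" if "i \<in> U" for i using measurable_val[OF that] .
  have lg: "lab_good (mix ?A \<omega>0 \<omega>) = lab_good \<omega>0" for \<omega>0 \<omega>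
  proof -
    have "train (mix ?A \<omega>0 \<omega>) i = train \<omega>0 i" for i by (auto simp: train_def mix_def)
    then show ?thesis unfolding lab_good_def by simp
  qed
  have "ennreal C * OPT * emeasure Om {\<omega> \<in> space Om. lab_good \<omega>} = (\<integral>\<^sup>+\<omega>0. ennreal C * OPT * indicator {\<omega>. lab_good \<omega>} \<omega>0 \<partial>Om)"
    using ml nn_integral_indicator_pred[OF pred_lab_good] by (subst nn_integral_cmult) auto
  also have "\<dots> \<le> (\<integral>\<^sup>+\<omega>0. ennreal M * (\<Sum>i\<in>U. \<integral>\<^sup>+\<omega>. val i (mix ?A \<omega>0 \<omega>) * indicator {\<omega>. lab_good \<omega>} (mix ?A \<omega>0 \<omega>) \<partial>Om) \<partial>Om)"
  proof (rule nn_integral_mono)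
    fix \<omega>0 assume w0: "\<omega>0 \<in> space Om"
    show "ennreal C * OPT * indicator {\<omega>. lab_good \<omega>} \<omega>0 \<le> ennreal M * (\<Sum>i\<in>U. \<integral>\<^sup>+\<omega>. val i (mix ?A \<omega>0 \<omega>) * indicator {\<omega>. lab_good \<omega>} (mix ?A \<omega>0 \<omega>) \<partial>Om)"
    proof (cases "lab_good \<omega>0")
      case True
      then have b: "\<bar>real (card (train \<omega>0 i)) - 2 * C\<bar> \<le> e * C" if "i \<in> U" for i
        using that unfolding lab_good_def by auto
      have eC: "e * C \<le> C" using e mult_right_mono[of e 1 "real C"] by simp
      have "ennreal C * OPT \<le> ennreal M * (\<Sum>i\<in>U. \<integral>\<^sup>+\<omega>. val i (mix ?A \<omega>0 \<omega>) \<partial>Om)"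
      proof (rule gain_fixed_labels[OF w0])
        show "real (card (train \<omega>0 i)) + 1 \<le> M" if "i \<in> U" for i using b[OF that] M by linarith
        show "C \<le> card (train \<omega>0 i) + 1" if "i \<in> U" for i
        proof -
          have "real C \<le> real (card (train \<omega>0 i) + 1)" using b[OF that] eC by simp
          then show ?thesis by simp
        qed
      qed
      then show ?thesis using True unfolding indicator_def mem_Collect_eq lg by simp
    qed simp
  qed
  also have "\<dots> = ennreal M * (\<Sum>i\<in>U. \<integral>\<^sup>+\<omega>0. \<integral>\<^sup>+\<omega>. val i (mix ?A \<omega>0 \<omega>) * indicator {\<omega>. lab_good \<omega>} (mix ?A \<omega>0 \<omega>) \<partial>Om \<partial>Om)"
    using ml mv by (subst nn_integral_cmult, intro borel_measurable_sum measurable_resample, simp, subst nn_integral_sum)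
      (auto intro!: measurable_resample)
  also have "\<dots> = ennreal M * (\<Sum>i\<in>U. \<integral>\<^sup>+\<omega>. val i \<omega> * indicator {\<omega>. lab_good \<omega>} \<omega> \<partial>Om)"
    using ml mv by (intro arg_cong[of _ _ "(*) (ennreal M)"] sum.cong refl resample[symmetric]) auto
  finally show ?thesis .
qed

end

section \<open>Survival of an active item\<close>

context prophet_instance
begin

section \<open>The chain with fixed thresholds and what it depends on\<close>

definition QQ :: "(coord \<Rightarrow> real) \<Rightarrow> (coord \<Rightarrow> real) \<Rightarrow> nat \<Rightarrow> nat set" where
  "QQ \<omega> \<omega>' b = {j \<in> U. act \<omega> j (sig \<omega>' j b)}"

definition NQ :: "(coord \<Rightarrow> real) \<Rightarrow> (coord \<Rightarrow> real) \<Rightarrow> nat \<Rightarrow> nat set" where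
  "NQ \<omega> \<omega>' d = NN (QQ \<omega> \<omega>') (stp \<omega>') d"

definition SQ :: "(coord \<Rightarrow> real) \<Rightarrow> (coord \<Rightarrow> real) \<Rightarrow> nat \<Rightarrow> nat \<Rightarrow> nat set" where
  "SQ \<omega> \<omega>' d t = stage (Suc L) K T e (QQ \<omega> \<omega>') d (NQ \<omega> \<omega>' d) t"

definition span_prob :: "(coord \<Rightarrow> real) \<Rightarrow> nat set \<Rightarrow> nat set \<Rightarrow> nat \<Rightarrow> real" where
  "span_prob \<omega> N S i = P.prob {\<omega>' \<in> space Om. i \<in> spn ((QQ \<omega> \<omega>' 0 \<inter> N - {i}) \<union> S)}"

text \<open>Stronger than the span test in \<open>acc\<close>: all other active items of the level
  count, not only the earlier ones. This matches the event estimated by the sample columns and is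
  independent of the online value of \<open>i\<close>.\<close>

definition surv :: "(coord \<Rightarrow> real) \<Rightarrow> nat \<Rightarrow> (coord \<Rightarrow> real) \<Rightarrow> bool" where
  "surv \<omega> i \<omega>' \<longleftrightarrow> (\<exists>d<Dp. i \<in> NQ \<omega> \<omega>' d - NQ \<omega> \<omega>' (Suc d) \<and>
     i \<notin> spn ((QQ \<omega> \<omega>' 0 \<inter> NQ \<omega> \<omega>' d - {i}) \<union> NQ \<omega> \<omega>' (Suc d)))"

definition dev :: "(coord \<Rightarrow> real) \<Rightarrow> nat \<Rightarrow> nat \<Rightarrow> nat \<Rightarrow> (coord \<Rightarrow> real) \<Rightarrow> bool" where
  "dev \<omega> d t i \<omega>' \<longleftrightarrow> e * K \<le> \<bar>real (card (spanned_cols K (QQ \<omega> \<omega>') (Suc L + (d * T + t) * K) (NQ \<omega> \<omega>' d) (SQ \<omega> \<omega>' d t) i))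
     - K * span_prob \<omega> (NQ \<omega> \<omega>' d) (SQ \<omega> \<omega>' d t) i\<bar>"

lemma NQ_Suc: "NQ \<omega> \<omega>' (Suc d) = SQ \<omega> \<omega>' d (Suc (stp \<omega>' d))"
  unfolding NQ_def SQ_def NN_def by (simp del: stage.simps)

lemma NQ_0: "NQ \<omega> \<omega>' 0 = U" unfolding NQ_def NN_def by simp

lemma NQ_subset: "NQ \<omega> \<omega>' d \<subseteq> U" unfolding NQ_def by (rule NN_subset)

lemma SQ_subset: "SQ \<omega> \<omega>' d t \<subseteq> NQ \<omega> \<omega>' d" unfolding SQ_def by (rule stage_subset)

lemma col_le_num_samples: "d < Dp \<Longrightarrow> t < T \<Longrightarrow> Suc L + (d * T + t) * K + K \<le> Suc num_samples"
proof -
  assume "d < Dp" "t < T"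
  then have "d * T + t + 1 \<le> Suc d * T" by simp
  also have "\<dots> \<le> Dp * T" using \<open>d < Dp\<close> by (intro mult_right_mono) auto
  finally have "(d * T + t + 1) * K \<le> Dp * T * K" by (rule mult_right_mono) simp
  then show ?thesis unfolding num_samples_def by (simp add: algebra_simps)
qed

lemma NQ_cong:
  assumes "\<And>c. c \<in> {Suc L..num_samples} \<Longrightarrow> QQ \<omega> \<omega>1 c = QQ \<omega> \<omega>2 c" "\<And>d'. d' < Dp \<Longrightarrow> stp \<omega>1 d' = stp \<omega>2 d'" "d \<le> Dp"
  shows "NQ \<omega> \<omega>1 d = NQ \<omega> \<omega>2 d"
  unfolding NQ_def by (rule NN_cong) (use assms in auto)

text \<open>Complements \<open>NQ_cong\<close>: that one shows independence of the online column,
  this one independence of the blocks and stopping times from level \<open>d\<close> on.\<close>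

lemma NQ_cong_below:
  assumes "\<And>c. c < Suc L + d * T * K \<Longrightarrow> QQ \<omega> \<omega>1 c = QQ \<omega> \<omega>2 c" "\<And>d'. d' < d \<Longrightarrow> stp \<omega>1 d' = stp \<omega>2 d'"
  shows "NQ \<omega> \<omega>1 d = NQ \<omega> \<omega>2 d"
  unfolding NQ_def NN_def by (rule chain_cong) (use assms in auto)

lemma SQ_cong_below:
  assumes "\<And>c. c < Suc L + (d * T + t) * K \<Longrightarrow> QQ \<omega> \<omega>1 c = QQ \<omega> \<omega>2 c" "\<And>d'. d' < d \<Longrightarrow> stp \<omega>1 d' = stp \<omega>2 d'"
  shows "SQ \<omega> \<omega>1 d t = SQ \<omega> \<omega>2 d t"
proof -
  have "d * T * K \<le> (d * T + t) * K" by (rule mult_right_mono) auto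
  then have "NQ \<omega> \<omega>1 d = NQ \<omega> \<omega>2 d" by (intro NQ_cong_below assms) linarith+
  then show ?thesis unfolding SQ_def using stage_cong[OF assms(1)] by simp
qed

lemma SQ_cong:
  assumes "\<And>c. c \<in> {Suc L..num_samples} \<Longrightarrow> QQ \<omega> \<omega>1 c = QQ \<omega> \<omega>2 c" "\<And>d'. d' < Dp \<Longrightarrow> stp \<omega>1 d' = stp \<omega>2 d'" "d < Dp" "t \<le> T"
  shows "SQ \<omega> \<omega>1 d t = SQ \<omega> \<omega>2 d t"
proof -
  have N: "NQ \<omega> \<omega>1 d = NQ \<omega> \<omega>2 d" using assms by (intro NQ_cong) auto
  show ?thesis using \<open>t \<le> T\<close>
  proof (induction t)
    case 0 then show ?case by (simp add: SQ_def)
  next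
    case (Suc t)
    then have IH: "SQ \<omega> \<omega>1 d t = SQ \<omega> \<omega>2 d t" by simp
    have "spanned_cols K (QQ \<omega> \<omega>1) (Suc L + (d * T + t) * K) N S i = spanned_cols K (QQ \<omega> \<omega>2) (Suc L + (d * T + t) * K) N S i" for N S i
      unfolding spanned_cols_def
    proof (intro Collect_cong conj_cong refl)
      fix b assume "b \<in> {Suc L + (d * T + t) * K..<Suc L + (d * T + t) * K + K}"
      then have "b \<in> {Suc L..num_samples}" using col_le_num_samples[OF assms(3), of t] Suc.prems by auto
      then show "i \<in> spn ((QQ \<omega> \<omega>1 b \<inter> N - {i}) \<union> S) \<longleftrightarrow> i \<in> spn ((QQ \<omega> \<omega>2 b \<inter> N - {i}) \<union> S)" using assms(1) by simp
    qed
    then show ?case using IH N unfolding SQ_def by simp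
  qed
qed

lemma pattern_QQ:
  assumes "\<omega> \<in> space Om"
    and h: "\<And>\<omega>1 \<omega>2. (\<And>b. b \<le> num_samples \<Longrightarrow> QQ \<omega> \<omega>1 b = QQ \<omega> \<omega>2 b) \<Longrightarrow> (\<And>d. d < Dp \<Longrightarrow> stp \<omega>1 d = stp \<omega>2 d) \<Longrightarrow> h \<omega>1 = h \<omega>2"
  shows "h \<in> Om \<rightarrow>\<^sub>M count_space UNIV"
proof (rule measurable_pattern)
  let ?S = "Inl ` (U \<times> {0..num_samples}) \<union> Inr ` ({..<Dp} \<times> {..<T})"
  let ?P = "\<lambda>s \<omega>'. case s of Inl (j, c) \<Rightarrow> act \<omega> j (sig \<omega>' j c) | Inr (d, t) \<Rightarrow> stp \<omega>' d = t"
  show "finite ?S" by simp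
  show "Measurable.pred Om (?P s)" if "s \<in> ?S" for s
    using that pred_act_slot[OF assms(1)] pred_stp unfolding measurable_Om_iff by auto
  show "h \<omega>1 = h \<omega>2" if *: "\<And>s. s \<in> ?S \<Longrightarrow> ?P s \<omega>1 = ?P s \<omega>2" for \<omega>1 \<omega>2
  proof (rule h)
    show "QQ \<omega> \<omega>1 b = QQ \<omega> \<omega>2 b" if "b \<le> num_samples" for b
      using *[of "Inl (_, b)"] that unfolding QQ_def by (intro Collect_cong conj_cong refl) auto
    show "stp \<omega>1 d = stp \<omega>2 d" if "d < Dp" for d
      using *[of "Inr (d, stp \<omega>1 d)"] that by simp
  qed
qed

text \<open>Spanning events involve all items jointly, so a whole column is exchanged with the
  online column, not the slot of one item.\<close>

definition swap_col :: "nat \<Rightarrow> coord \<Rightarrow> coord" where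
  "swap_col b = (\<lambda>(\<kappa>, j, k). if \<kappa> \<le> 1 then (\<kappa>, j, if k = 0 then b else if k = b then 0 else k) else (\<kappa>, j, k))"

lemma nn_integral_swap_col:
  assumes f: "f \<in> borel_measurable Om" and b: "b \<le> num_samples"
  shows "(\<integral>\<^sup>+\<omega>. f (\<lambda>x\<in>Idx. \<omega> (swap_col b x)) \<partial>Om) = (\<integral>\<^sup>+\<omega>. f \<omega> \<partial>Om)"
proof (rule permute[OF f])
  have s: "swap_col b \<in> Idx \<rightarrow> Idx"
    using b unfolding Idx_def swap_col_def by (auto split: if_splits)
  have "swap_col b (swap_col b x) = x" for x by (auto simp: swap_col_def split: prod.splits)
  then show "bij_betw (swap_col b) Idx Idx" by (intro bij_betwI[OF s s])
  show "mu (swap_col b x) = mu x" for x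
    unfolding mu_def swap_col_def by (auto split: prod.splits)
qed

lemma prob_column:
  assumes \<omega>: "\<omega> \<in> space Om" and b: "b \<le> num_samples"
  shows "P.prob {\<omega>' \<in> space Om. H (QQ \<omega> \<omega>' b)} = P.prob {\<omega>' \<in> space Om. H (QQ \<omega> \<omega>' 0)}"
proof -
  have m: "Measurable.pred Om (\<lambda>\<omega>'. H (QQ \<omega> \<omega>' c))" if "c \<le> num_samples" for c
    by (rule pattern_QQ[OF \<omega>]) (use that in simp)
  have "(\<integral>\<^sup>+\<omega>'. indicator {\<omega>'. H (QQ \<omega> \<omega>' b)} \<omega>' \<partial>Om) = (\<integral>\<^sup>+\<omega>'. indicator {\<omega>'. H (QQ \<omega> \<omega>' 0)} (\<lambda>x\<in>Idx. \<omega>' (swap_col b x)) \<partial>Om)"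
  proof (rule nn_integral_cong)
    fix \<omega>'
    have "QQ \<omega> (\<lambda>x\<in>Idx. \<omega>' (swap_col b x)) 0 = QQ \<omega> \<omega>' b"
      unfolding QQ_def by (intro Collect_cong conj_cong refl) (simp add: sig_def swap_col_def)
    then show "indicator {\<omega>'. H (QQ \<omega> \<omega>' b)} \<omega>' = (indicator {\<omega>'. H (QQ \<omega> \<omega>' 0)} (\<lambda>x\<in>Idx. \<omega>' (swap_col b x)) :: ennreal)"
      by (simp add: indicator_def)
  qed
  also have "\<dots> = (\<integral>\<^sup>+\<omega>'. indicator {\<omega>'. H (QQ \<omega> \<omega>' 0)} \<omega>' \<partial>Om)"
    by (intro nn_integral_swap_col measurable_indicator_pred m b) simp
  finally show ?thesis
    unfolding nn_integral_indicator_pred[OF m[OF b]] nn_integral_indicator_pred[OF m[of 0, simplified]]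
    by (simp add: measure_def)
qed

section \<open>Concentration of the empirical spanning frequencies\<close>

lemma span_prob_bounds: "0 \<le> span_prob \<omega> N S i" "span_prob \<omega> N S i \<le> 1" unfolding span_prob_def by simp_all

lemma span_prob_mono:
  assumes "\<omega> \<in> space Om" "S \<subseteq> S'" shows "span_prob \<omega> N S i \<le> span_prob \<omega> N S' i"
  unfolding span_prob_def
proof (rule P.finite_measure_mono)
  have "(QQ \<omega> \<omega>' 0 \<inter> N - {i}) \<union> S \<subseteq> (QQ \<omega> \<omega>' 0 \<inter> N - {i}) \<union> S'" for \<omega>' using assms(2) by auto
  then show "{\<omega>' \<in> space Om. i \<in> spn ((QQ \<omega> \<omega>' 0 \<inter> N - {i}) \<union> S)} \<subseteq> {\<omega>' \<in> space Om. i \<in> spn ((QQ \<omega> \<omega>' 0 \<inter> N - {i}) \<union> S')}"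
    using spn_mono by blast
  have "Measurable.pred Om (\<lambda>\<omega>'. i \<in> spn ((QQ \<omega> \<omega>' 0 \<inter> N - {i}) \<union> S'))"
    by (rule pattern_QQ[OF assms(1)]) simp
  then show "{\<omega>' \<in> space Om. i \<in> spn ((QQ \<omega> \<omega>' 0 \<inter> N - {i}) \<union> S')} \<in> P.events" by measurable
qed

lemma pred_dev: "\<omega> \<in> space Om \<Longrightarrow> d < Dp \<Longrightarrow> t < T \<Longrightarrow> Measurable.pred Om (dev \<omega> d t i)"
proof (rule pattern_QQ)
  fix \<omega>1 \<omega>2 assume *: "\<And>b. b \<le> num_samples \<Longrightarrow> QQ \<omega> \<omega>1 b = QQ \<omega> \<omega>2 b" "\<And>d. d < Dp \<Longrightarrow> stp \<omega>1 d = stp \<omega>2 d" "d < Dp" "t < T"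
  have N: "NQ \<omega> \<omega>1 d = NQ \<omega> \<omega>2 d" using * by (intro NQ_cong) auto
  have S: "SQ \<omega> \<omega>1 d t = SQ \<omega> \<omega>2 d t" using * by (intro SQ_cong) auto
  have "spanned_cols K (QQ \<omega> \<omega>1) (Suc L + (d * T + t) * K) N S i = spanned_cols K (QQ \<omega> \<omega>2) (Suc L + (d * T + t) * K) N S i" for N S i
    unfolding spanned_cols_def
  proof (intro Collect_cong conj_cong refl)
    fix b assume "b \<in> {Suc L + (d * T + t) * K..<Suc L + (d * T + t) * K + K}"
    then have "b \<le> num_samples" using col_le_num_samples[OF *(3,4)] by auto
    then show "i \<in> spn ((QQ \<omega> \<omega>1 b \<inter> N - {i}) \<union> S) \<longleftrightarrow> i \<in> spn ((QQ \<omega> \<omega>2 b \<inter> N - {i}) \<union> S)" using *(1) by simp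
  qed
  then show "dev \<omega> d t i \<omega>1 = dev \<omega> d t i \<omega>2" unfolding dev_def N S by simp
qed

text \<open>The level and the stage are determined by columns before the block of this round and by
  stops of earlier levels. Resampling the block therefore leaves them fixed, and Hoeffding's
  inequality applies to the \<open>K\<close> independent columns.\<close>

lemma dev_prob:
  assumes \<omega>: "\<omega> \<in> space Om" and dt: "d < Dp" "t < T" and e: "e > 0" and K: "K > 0"
  shows "(\<integral>\<^sup>+\<omega>'. indicator {\<omega>'. dev \<omega> d t i \<omega>'} \<omega>' \<partial>Om) \<le> ennreal (2 * exp (- 2 * e\<^sup>2 * K))"
proof -
  define c where "c = Suc L + (d * T + t) * K"
  have ck: "b \<le> num_samples" "Suc L \<le> b" if "b \<in> {c..<c + K}" for b using that col_le_num_samples[OF dt] unfolding c_def by auto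
  let ?J = "{x. fst x \<le> 1 \<and> snd (snd x) \<in> {c..<c + K}} :: coord set"
  have "(\<integral>\<^sup>+\<omega>'. indicator {\<omega>'. dev \<omega> d t i \<omega>'} \<omega>' \<partial>Om)
      = (\<integral>\<^sup>+\<omega>'. \<integral>\<^sup>+\<omega>''. indicator {\<omega>'. dev \<omega> d t i \<omega>'} (mix ?J \<omega>' \<omega>'') \<partial>Om \<partial>Om)"
    by (intro resample measurable_indicator_pred pred_dev \<omega> dt)
  also have "\<dots> \<le> (\<integral>\<^sup>+\<omega>'. ennreal (2 * exp (- 2 * e\<^sup>2 * K)) \<partial>Om)"
  proof (rule nn_integral_mono)
    fix \<omega>' assume w': "\<omega>' \<in> space Om"
    let ?N = "NQ \<omega> \<omega>' d" and ?S = "SQ \<omega> \<omega>' d t"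
    let ?A = "\<lambda>b \<omega>''. i \<in> spn ((QQ \<omega> \<omega>'' b \<inter> ?N - {i}) \<union> ?S)"
    have mA: "Measurable.pred Om (?A b)" if "b \<in> {c..<c + K}" for b
      by (rule pattern_QQ[OF \<omega>]) (use ck(1)[OF that] in simp)
    have q: "QQ \<omega> (mix ?J \<omega>' \<omega>'') b = QQ \<omega> \<omega>' b" if "b < c" for b \<omega>''
      unfolding QQ_def using that by (intro Collect_cong conj_cong refl) (simp add: sig_def mix_def)
    have q': "QQ \<omega> (mix ?J \<omega>' \<omega>'') b = QQ \<omega> \<omega>'' b" if "b \<in> {c..<c + K}" for b \<omega>''
      unfolding QQ_def using that by (intro Collect_cong conj_cong refl) (simp add: sig_def mix_def)
    have st: "stp (mix ?J \<omega>' \<omega>'') d' = stp \<omega>' d'" for d' \<omega>''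
      unfolding stp_def mix_def by simp
    have "Suc L + d * T * K \<le> c" unfolding c_def by (simp add: algebra_simps)
    then have N: "NQ \<omega> (mix ?J \<omega>' \<omega>'') d = ?N" for \<omega>''
      by (intro NQ_cong_below q st) linarith
    have S: "SQ \<omega> (mix ?J \<omega>' \<omega>'') d t = ?S" for \<omega>''
      by (intro SQ_cong_below q st) (simp add: c_def)
    have cols: "spanned_cols K (QQ \<omega> (mix ?J \<omega>' \<omega>'')) c ?N ?S i = {b \<in> {c..<c + K}. ?A b \<omega>''}" for \<omega>''
      unfolding spanned_cols_def using q' by (intro Collect_cong conj_cong refl) simp
    have "(\<integral>\<^sup>+\<omega>''. indicator {\<omega>'. dev \<omega> d t i \<omega>'} (mix ?J \<omega>' \<omega>'') \<partial>Om)
        = (\<integral>\<^sup>+\<omega>''. indicator {\<omega>'' \<in> space Om. e * card {c..<c + K} \<le> \<bar>real (card {b \<in> {c..<c + K}. ?A b \<omega>''}) - card {c..<c + K} * span_prob \<omega> ?N ?S i\<bar>} \<omega>'' \<partial>Om)"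
    proof (rule nn_integral_cong)
      fix \<omega>'' assume "\<omega>'' \<in> space Om"
      moreover have "dev \<omega> d t i (mix ?J \<omega>' \<omega>'') \<longleftrightarrow> e * card {c..<c + K} \<le> \<bar>real (card {b \<in> {c..<c + K}. ?A b \<omega>''}) - card {c..<c + K} * span_prob \<omega> ?N ?S i\<bar>"
        unfolding dev_def c_def[symmetric] N S cols by simp
      ultimately show "indicator {\<omega>'. dev \<omega> d t i \<omega>'} (mix ?J \<omega>' \<omega>'') = (indicator {\<omega>'' \<in> space Om. e * card {c..<c + K} \<le> \<bar>real (card {b \<in> {c..<c + K}. ?A b \<omega>''}) - card {c..<c + K} * span_prob \<omega> ?N ?S i\<bar>} \<omega>'' :: ennreal)"
        unfolding indicator_def mem_Collect_eq by simp
    qed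
    also have "\<dots> = emeasure Om {\<omega>'' \<in> space Om. e * card {c..<c + K} \<le> \<bar>real (card {b \<in> {c..<c + K}. ?A b \<omega>''}) - card {c..<c + K} * span_prob \<omega> ?N ?S i\<bar>}"
    proof (rule nn_integral_indicator)
      have "(\<lambda>\<omega>''. {b \<in> {c..<c + K}. ?A b \<omega>''}) \<in> Om \<rightarrow>\<^sub>M count_space UNIV"
        by (rule measurable_pattern[where S = "{c..<c + K}" and P = ?A]) (use mA in auto)
      then show "{\<omega>'' \<in> space Om. e * card {c..<c + K} \<le> \<bar>real (card {b \<in> {c..<c + K}. ?A b \<omega>''}) - card {c..<c + K} * span_prob \<omega> ?N ?S i\<bar>} \<in> sets Om"
        by measurable
    qed
    also have "\<dots> \<le> ennreal (2 * exp (- 2 * e\<^sup>2 * card {c..<c + K}))"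
    proof (rule Hoeffding_events[where K = "\<lambda>b. {0, 1} \<times> U \<times> {b}"])
      show "?A b \<omega>1 = ?A b \<omega>2" if "\<And>x. x \<in> {0, 1} \<times> U \<times> {b} \<Longrightarrow> \<omega>1 x = \<omega>2 x" for b and \<omega>1 \<omega>2 :: "coord \<Rightarrow> real"
      proof -
        have "QQ \<omega> \<omega>1 b = QQ \<omega> \<omega>2 b"
          unfolding QQ_def using that by (intro Collect_cong conj_cong refl) (simp add: sig_def)
        then show ?thesis by simp
      qed
      show "P.prob {\<omega>'' \<in> space Om. ?A b \<omega>''} = span_prob \<omega> ?N ?S i" if "b \<in> {c..<c + K}" for b
        unfolding span_prob_def by (rule prob_column[OF \<omega> ck(1)[OF that], of "\<lambda>X. i \<in> spn ((X \<inter> ?N - {i}) \<union> ?S)"])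
      show "{0, 1} \<times> U \<times> {b} \<subseteq> Idx" if "b \<in> {c..<c + K}" for b using ck[OF that] by (auto simp: Idx_def)
    qed (use mA K e in \<open>auto simp: disjoint_family_on_def\<close>)
    finally show "(\<integral>\<^sup>+\<omega>''. indicator {\<omega>'. dev \<omega> d t i \<omega>'} (mix ?J \<omega>' \<omega>'') \<partial>Om) \<le> ennreal (2 * exp (- 2 * e\<^sup>2 * K))" by simp
  qed
  also have "\<dots> = ennreal (2 * exp (- 2 * e\<^sup>2 * K))" by (simp add: P.emeasure_space_1)
  finally show ?thesis .
qed

section \<open>The random stopping round\<close>

lemma stp_prob:
  assumes d: "d < Dp" shows "(\<integral>\<^sup>+\<omega>. indicator {\<omega>. stp \<omega> d = t} \<omega> \<partial>Om) \<le> ennreal (1 / T)"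
proof (cases "t < T")
  case False
  then have "\<omega> \<notin> {\<omega>. stp \<omega> d = t}" for \<omega> using stp_less[of \<omega> d] by auto
  then show ?thesis by (simp add: indicator_def)
next
  case True
  let ?B = "{u. min (T - 1) (nat \<lfloor>real T * u\<rfloor>) = t} :: real set"
  have B: "?B \<in> sets borel" by measurable
  have "{0..1} \<inter> ?B \<subseteq> {t / T..(t + 1) / T}"
  proof
    fix u assume u: "u \<in> {0..1} \<inter> ?B"
    have T0: "real T > 0" using T_pos by simp
    have fl: "real (nat \<lfloor>real T * u\<rfloor>) = of_int \<lfloor>real T * u\<rfloor>" using u T0 by simp
    have "t \<le> nat \<lfloor>real T * u\<rfloor>" using u by auto
    then have "real t \<le> real (nat \<lfloor>real T * u\<rfloor>)" by (simp only: of_nat_le_iff)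
    then have 1: "real t \<le> real T * u" unfolding fl using of_int_floor_le[of "real T * u"] by linarith
    have 2: "real T * u \<le> real t + 1"
    proof (cases "nat \<lfloor>real T * u\<rfloor> = t")
      case True
      then have "real_of_int \<lfloor>real T * u\<rfloor> = t" using fl by simp
      then show ?thesis using floor_correct[of "real T * u"] by linarith
    next
      case False
      \<comment> \<open>The truncation acts only at the last index, where the bound
        \<open>u \<le> 1\<close> replaces the floor.\<close>
      then have "t = T - 1" using u by (auto simp: min_def split: if_splits)
      then have "real t + 1 = real T" using T_pos by simp
      moreover have "real T * u \<le> real T * 1" using u T0 by (intro mult_left_mono) auto
      ultimately show ?thesis by simp
    qed
    show "u \<in> {t / T..(t + 1) / T}" using 1 2 T0 by (simp add: field_simps)
  qed
  then have "emeasure lborel ({0..1} \<inter> ?B) \<le> emeasure lborel {t / T..(t + 1) / T}"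
    by (intro emeasure_mono) auto
  also have "\<dots> = ennreal (1 / T)" using T_pos by (subst emeasure_lborel_Icc) (auto simp: field_simps)
  finally have "emeasure unif ?B \<le> ennreal (1 / T)" unfolding unif_def using B by (simp add: divide_ennreal_def)
  moreover have "(\<integral>\<^sup>+\<omega>. indicator {\<omega>. stp \<omega> d = t} \<omega> \<partial>Om) = (\<integral>\<^sup>+\<omega>. indicator ?B (\<omega> (3, d, 0)) \<partial>Om)"
    by (intro nn_integral_cong) (simp add: indicator_def stp_def)
  moreover have "\<dots> = emeasure (mu (3, d, 0)) ?B" using d B by (intro nn_integral_coord) auto
  moreover have "mu (3, d, 0) = unif" by (simp add: mu_def)
  ultimately show ?thesis by simp
qed

text \<open>At \<open>t = stp \<omega>' d\<close> this is the gap between the spanning probability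
  tested in the last round and the one that decides survival.\<close>

definition incr :: "(coord \<Rightarrow> real) \<Rightarrow> nat \<Rightarrow> nat \<Rightarrow> (coord \<Rightarrow> real) \<Rightarrow> nat \<Rightarrow> real" where
  "incr \<omega> i d \<omega>' t = span_prob \<omega> (NQ \<omega> \<omega>' d) (SQ \<omega> \<omega>' d (Suc t)) i - span_prob \<omega> (NQ \<omega> \<omega>' d) (SQ \<omega> \<omega>' d t) i"

lemma SQ_mono: "t \<le> t' \<Longrightarrow> SQ \<omega> \<omega>' d t \<subseteq> SQ \<omega> \<omega>' d t'"
  unfolding SQ_def by (rule stage_mono)

lemma incr_nonneg: "\<omega> \<in> space Om \<Longrightarrow> 0 \<le> incr \<omega> i d \<omega>' t"
  unfolding incr_def using span_prob_mono[OF _ SQ_mono[of t "Suc t"]] by simp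

lemma measurable_incr:
  assumes "\<omega> \<in> space Om" "d < Dp"
  shows "(\<lambda>\<omega>'. incr \<omega> i d \<omega>' (stp \<omega>' d)) \<in> Om \<rightarrow>\<^sub>M count_space UNIV"
proof (rule pattern_QQ[OF assms(1)])
  fix \<omega>1 \<omega>2 assume *: "\<And>b. b \<le> num_samples \<Longrightarrow> QQ \<omega> \<omega>1 b = QQ \<omega> \<omega>2 b" "\<And>d. d < Dp \<Longrightarrow> stp \<omega>1 d = stp \<omega>2 d"
  have "NQ \<omega> \<omega>1 d = NQ \<omega> \<omega>2 d" using * assms by (intro NQ_cong) auto
  moreover have S: "SQ \<omega> \<omega>1 d t = SQ \<omega> \<omega>2 d t" if "t \<le> T" for t using * assms that by (intro SQ_cong) auto
  moreover have "stp \<omega>1 d = stp \<omega>2 d" using * assms by auto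
  moreover have "SQ \<omega> \<omega>1 d (stp \<omega>2 d) = SQ \<omega> \<omega>2 d (stp \<omega>2 d)" "SQ \<omega> \<omega>1 d (Suc (stp \<omega>2 d)) = SQ \<omega> \<omega>2 d (Suc (stp \<omega>2 d))"
    by (rule S[OF less_imp_le[OF stp_less]], rule S[OF Suc_leI[OF stp_less]])
  ultimately show "incr \<omega> i d \<omega>1 (stp \<omega>1 d) = incr \<omega> i d \<omega>2 (stp \<omega>2 d)" unfolding incr_def by simp
qed

text \<open>The spanning probability of a fixed item only grows from round to round, so a uniformly random
  round increases it by at most \<open>1 / T\<close> on average.\<close>

lemma incr_integral:
  assumes \<omega>: "\<omega> \<in> space Om" and d: "d < Dp"
  shows "(\<integral>\<^sup>+\<omega>'. ennreal (incr \<omega> i d \<omega>' (stp \<omega>' d)) \<partial>Om) \<le> ennreal (1 / T)"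
proof -
  \<comment> \<open>Level \<open>d\<close> and all its stages depend on the stops of earlier levels
    only, so this single coordinate can be resampled with the increments held fixed.\<close>
  let ?J = "{(3, d, 0)} :: coord set"
  have "(\<integral>\<^sup>+\<omega>'. ennreal (incr \<omega> i d \<omega>' (stp \<omega>' d)) \<partial>Om)
     = (\<integral>\<^sup>+\<omega>'. \<integral>\<^sup>+\<omega>''. ennreal (incr \<omega> i d (mix ?J \<omega>' \<omega>'') (stp (mix ?J \<omega>' \<omega>'') d)) \<partial>Om \<partial>Om)"
    by (rule resample[OF measurable_compose[OF measurable_incr[OF \<omega> d]]]) simp
  also have "\<dots> \<le> (\<integral>\<^sup>+\<omega>'. ennreal (1 / T) \<partial>Om)"
  proof (rule nn_integral_mono)
    fix \<omega>'
    have q: "QQ \<omega> (mix ?J \<omega>' \<omega>'') b = QQ \<omega> \<omega>' b" for b \<omega>''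
      unfolding QQ_def by (intro Collect_cong conj_cong refl) (simp add: sig_def mix_def)
    have N: "NQ \<omega> (mix ?J \<omega>' \<omega>'') d = NQ \<omega> \<omega>' d" for \<omega>''
      by (intro NQ_cong_below q) (simp add: stp_def mix_def)
    have S: "SQ \<omega> (mix ?J \<omega>' \<omega>'') d t = SQ \<omega> \<omega>' d t" for t \<omega>''
      by (intro SQ_cong_below q) (simp add: stp_def mix_def)
    have st: "stp (mix ?J \<omega>' \<omega>'') d = stp \<omega>'' d" for \<omega>'' by (simp add: stp_def mix_def)
    have inc: "incr \<omega> i d (mix ?J \<omega>' \<omega>'') t = incr \<omega> i d \<omega>' t" for t \<omega>'' unfolding incr_def N S ..
    have "(\<integral>\<^sup>+\<omega>''. ennreal (incr \<omega> i d (mix ?J \<omega>' \<omega>'') (stp (mix ?J \<omega>' \<omega>'') d)) \<partial>Om)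
       = (\<integral>\<^sup>+\<omega>''. (\<Sum>t<T. ennreal (incr \<omega> i d \<omega>' t) * indicator {\<omega>. stp \<omega> d = t} \<omega>'') \<partial>Om)"
    proof (rule nn_integral_cong)
      fix \<omega>''
      have "(\<Sum>t<T. ennreal (incr \<omega> i d \<omega>' t) * indicator {\<omega>. stp \<omega> d = t} \<omega>'') = (\<Sum>t<T. if t = stp \<omega>'' d then ennreal (incr \<omega> i d \<omega>' t) else 0)"
        by (intro sum.cong) (auto simp: indicator_def)
      then show "ennreal (incr \<omega> i d (mix ?J \<omega>' \<omega>'') (stp (mix ?J \<omega>' \<omega>'') d)) = (\<Sum>t<T. ennreal (incr \<omega> i d \<omega>' t) * indicator {\<omega>. stp \<omega> d = t} \<omega>'')"
        unfolding st inc by simp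
    qed
    also have "\<dots> = (\<Sum>t<T. ennreal (incr \<omega> i d \<omega>' t) * (\<integral>\<^sup>+\<omega>''. indicator {\<omega>. stp \<omega> d = t} \<omega>'' \<partial>Om))"
      using measurable_indicator_pred[OF pred_stp[OF d, folded measurable_Om_iff]]
      by (subst nn_integral_sum) (auto intro!: sum.cong nn_integral_cmult)
    also have "\<dots> \<le> (\<Sum>t<T. ennreal (incr \<omega> i d \<omega>' t) * ennreal (1 / T))"
      by (intro sum_mono mult_left_mono stp_prob d) auto
    also have "\<dots> = (\<Sum>t<T. ennreal (incr \<omega> i d \<omega>' t * (1 / T)))"
      using incr_nonneg[OF \<omega>] by (intro sum.cong refl ennreal_mult[symmetric]) auto
    also have "\<dots> = ennreal (\<Sum>t<T. incr \<omega> i d \<omega>' t * (1 / T))"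
      using incr_nonneg[OF \<omega>] by (intro sum_ennreal) auto
    also have "(\<Sum>t<T. incr \<omega> i d \<omega>' t * (1 / T)) = (\<Sum>t<T. incr \<omega> i d \<omega>' t) * (1 / T)"
      by (rule sum_distrib_right[symmetric])
    also have "(\<Sum>t<T. incr \<omega> i d \<omega>' t) = span_prob \<omega> (NQ \<omega> \<omega>' d) (SQ \<omega> \<omega>' d T) i - span_prob \<omega> (NQ \<omega> \<omega>' d) (SQ \<omega> \<omega>' d 0) i"
      unfolding incr_def by (rule sum_lessThan_telescope)
    also have "ennreal ((span_prob \<omega> (NQ \<omega> \<omega>' d) (SQ \<omega> \<omega>' d T) i - span_prob \<omega> (NQ \<omega> \<omega>' d) (SQ \<omega> \<omega>' d 0) i) * (1 / T)) \<le> ennreal (1 * (1 / T))"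
      using span_prob_bounds[of \<omega> "NQ \<omega> \<omega>' d" "SQ \<omega> \<omega>' d T" i] span_prob_bounds[of \<omega> "NQ \<omega> \<omega>' d" "SQ \<omega> \<omega>' d 0" i]
      by (intro ennreal_leI mult_right_mono) auto
    finally show "(\<integral>\<^sup>+\<omega>''. ennreal (incr \<omega> i d (mix ?J \<omega>' \<omega>'') (stp (mix ?J \<omega>' \<omega>'') d)) \<partial>Om) \<le> ennreal (1 / T)" by simp
  qed
  also have "\<dots> = ennreal (1 / T)" by (simp add: P.emeasure_space_1)
  finally show ?thesis .
qed

text \<open>The threshold \<open>1/2 + 3 * e\<close> leaves an estimation error \<open>e\<close> on
  both sides: \<open>4 * e\<close> for items left out, which enters the survival bound, and
  \<open>2 * e\<close> for collected ones, which enters the rank count.\<close>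

lemma SQ_out:
  assumes dev: "\<not> dev \<omega> d t i \<omega>'" and K: "K > 0" and i: "i \<in> NQ \<omega> \<omega>' d" "i \<notin> SQ \<omega> \<omega>' d (Suc t)"
  shows "span_prob \<omega> (NQ \<omega> \<omega>' d) (SQ \<omega> \<omega>' d t) i \<le> 1/2 + 4 * e"
proof -
  let ?c = "real (card (spanned_cols K (QQ \<omega> \<omega>') (Suc L + (d * T + t) * K) (NQ \<omega> \<omega>' d) (SQ \<omega> \<omega>' d t) i))"
  have "?c < (1/2 + 3 * e) * K" using i unfolding SQ_def by auto
  moreover have "\<bar>?c - K * span_prob \<omega> (NQ \<omega> \<omega>' d) (SQ \<omega> \<omega>' d t) i\<bar> < e * K" using dev unfolding dev_def by simp
  ultimately have "span_prob \<omega> (NQ \<omega> \<omega>' d) (SQ \<omega> \<omega>' d t) i * K \<le> (1/2 + 4 * e) * K" by (simp add: algebra_simps)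
  then show ?thesis using K by simp
qed

lemma SQ_in:
  assumes dev: "\<not> dev \<omega> d t i \<omega>'" and K: "K > 0" and i: "i \<in> SQ \<omega> \<omega>' d (Suc t)" "i \<notin> SQ \<omega> \<omega>' d t"
  shows "1/2 + 2 * e \<le> span_prob \<omega> (NQ \<omega> \<omega>' d) (SQ \<omega> \<omega>' d t) i"
proof -
  let ?c = "real (card (spanned_cols K (QQ \<omega> \<omega>') (Suc L + (d * T + t) * K) (NQ \<omega> \<omega>' d) (SQ \<omega> \<omega>' d t) i))"
  have "(1/2 + 3 * e) * K \<le> ?c" using i unfolding SQ_def by auto
  moreover have "\<bar>?c - K * span_prob \<omega> (NQ \<omega> \<omega>' d) (SQ \<omega> \<omega>' d t) i\<bar> < e * K" using dev unfolding dev_def by simp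
  ultimately have "(1/2 + 2 * e) * K \<le> span_prob \<omega> (NQ \<omega> \<omega>' d) (SQ \<omega> \<omega>' d t) i * K" by (simp add: algebra_simps)
  then show ?thesis using K by simp
qed

section \<open>Rank contraction from level to level\<close>

lemma integrable_QQ:
  assumes "\<omega> \<in> space Om" shows "integrable Om (\<lambda>\<omega>'. real (h (QQ \<omega> \<omega>' 0)))"
proof (rule P.integrable_const_bound)
  have "(\<lambda>\<omega>'. h (QQ \<omega> \<omega>' 0)) \<in> Om \<rightarrow>\<^sub>M count_space UNIV"
  proof (rule pattern_QQ[OF assms])
    fix \<omega>1 \<omega>2 assume "\<And>b. b \<le> num_samples \<Longrightarrow> QQ \<omega> \<omega>1 b = QQ \<omega> \<omega>2 b"
    from this[of 0] show "h (QQ \<omega> \<omega>1 0) = h (QQ \<omega> \<omega>2 0)" by simp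
  qed
  then show "(\<lambda>\<omega>'. real (h (QQ \<omega> \<omega>' 0))) \<in> borel_measurable Om"
    by (rule measurable_compose) simp
  have "QQ \<omega> \<omega>' 0 \<in> Pow U" for \<omega>' unfolding QQ_def by blast
  then have "h (QQ \<omega> \<omega>' 0) \<le> Max (h ` Pow U)" for \<omega>'
    by (intro Max_ge imageI) simp
  then show "AE \<omega>' in Om. norm (real (h (QQ \<omega> \<omega>' 0))) \<le> real (Max (h ` Pow U))" by (intro AE_I2) simp
qed

lemma pred_QQ0: "\<omega> \<in> space Om \<Longrightarrow> Measurable.pred Om (\<lambda>\<omega>'. H (QQ \<omega> \<omega>' 0))"
proof (rule pattern_QQ)
  fix \<omega>1 \<omega>2 assume "\<And>b. b \<le> num_samples \<Longrightarrow> QQ \<omega> \<omega>1 b = QQ \<omega> \<omega>2 b"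
  from this[of 0] show "H (QQ \<omega> \<omega>1 0) = H (QQ \<omega> \<omega>2 0)" by simp
qed

lemma expectation_card:
  assumes \<omega>: "\<omega> \<in> space Om" and B: "finite B"
  shows "P.expectation (\<lambda>\<omega>'. real (card {b \<in> B. H b (QQ \<omega> \<omega>' 0)})) = (\<Sum>b\<in>B. P.prob {\<omega>' \<in> space Om. H b (QQ \<omega> \<omega>' 0)})"
proof -
  have m: "{\<omega>' \<in> space Om. H b (QQ \<omega> \<omega>' 0)} \<in> P.events" for b using pred_QQ0[OF \<omega>, of "H b"] by measurable
  have "P.expectation (\<lambda>\<omega>'. real (card {b \<in> B. H b (QQ \<omega> \<omega>' 0)}))
      = P.expectation (\<lambda>\<omega>'. \<Sum>b\<in>B. indicator {\<omega>' \<in> space Om. H b (QQ \<omega> \<omega>' 0)} \<omega>')"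
    using B by (intro Bochner_Integration.integral_cong) (auto simp: indicator_def sum.If_cases Int_def)
  also have "\<dots> = (\<Sum>b\<in>B. P.expectation (\<lambda>\<omega>'. indicator {\<omega>' \<in> space Om. H b (QQ \<omega> \<omega>' 0)} \<omega>'))"
    using m by (intro Bochner_Integration.integral_sum) (auto simp: P.emeasure_eq_measure)
  also have "\<dots> = (\<Sum>b\<in>B. P.prob {\<omega>' \<in> space Om. H b (QQ \<omega> \<omega>' 0)})"
    using m by simp
  finally show ?thesis .
qed

text \<open>The rank that a new stage adds to the active items and the previous stage is at most the
  number of unspanned elements of a complementary basis \<open>B\<close>. Each collected item is
  spanned with probability at least \<open>1/2 + 2 * e\<close>, so it counts with probability at
  most \<open>1/2 - 2 * e\<close>.\<close>

lemma stage_rank_gain: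
  assumes \<omega>: "\<omega> \<in> space Om" and K: "K > 0" and e: "0 < e" "e \<le> 1/4"
    and dev: "\<And>t i. t < T \<Longrightarrow> i \<in> U \<Longrightarrow> \<not> dev \<omega> d t i \<omega>'" and t: "t \<le> T"
  shows "P.expectation (\<lambda>\<omega>''. real (rk ((QQ \<omega> \<omega>'' 0 \<inter> NQ \<omega> \<omega>' d) \<union> SQ \<omega> \<omega>' d t)))
    \<le> P.expectation (\<lambda>\<omega>''. real (rk (QQ \<omega> \<omega>'' 0 \<inter> NQ \<omega> \<omega>' d))) + (1/2 - 2 * e) * rk (SQ \<omega> \<omega>' d t)"
  using t
proof (induction t)
  case 0 then show ?case by (simp add: SQ_def)
next
  case (Suc t)
  let ?N = "NQ \<omega> \<omega>' d" and ?S = "SQ \<omega> \<omega>' d"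
  let ?X = "\<lambda>\<omega>''. (QQ \<omega> \<omega>'' 0 \<inter> ?N) \<union> ?S t"
  have sub: "?S t \<subseteq> ?S (Suc t)" "?S (Suc t) \<subseteq> U"
    by (rule SQ_mono, simp) (rule subset_trans[OF SQ_subset NQ_subset])
  have "\<exists>B. B \<subseteq> ?S (Suc t) \<and> card B + rk (?S t) = rk (?S (Suc t)) \<and>
      (\<forall>A. ?S t \<subseteq> A \<longrightarrow> rk (A \<union> ?S (Suc t)) = rk (A \<union> B))"
    by (rule rk_complement_obtain[OF sub]) (intro exI conjI allI impI)
  then obtain B where B: "B \<subseteq> ?S (Suc t)" "card B + rk (?S t) = rk (?S (Suc t))"
    "\<And>A. ?S t \<subseteq> A \<Longrightarrow> rk (A \<union> ?S (Suc t)) = rk (A \<union> B)" by (elim exE conjE) simp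
  have BU: "B \<subseteq> U" by (rule subset_trans[OF B(1) sub(2)])
  note fB = finite_subset[OF BU finite_U] BU
  have "real (rk ((QQ \<omega> \<omega>'' 0 \<inter> ?N) \<union> ?S (Suc t))) \<le> real (rk (?X \<omega>'')) + real (card {b \<in> B. b \<notin> spn (?X \<omega>'')})" for \<omega>''
  proof -
    have "(QQ \<omega> \<omega>'' 0 \<inter> ?N) \<union> ?S (Suc t) = ?X \<omega>'' \<union> ?S (Suc t)" using sub by blast
    then have "rk ((QQ \<omega> \<omega>'' 0 \<inter> ?N) \<union> ?S (Suc t)) = rk (?X \<omega>'' \<union> B)" using B(3)[of "?X \<omega>''"] by simp
    also have "\<dots> \<le> rk (?X \<omega>'') + card {b \<in> B. b \<notin> spn (?X \<omega>'')}" by (rule rk_Un_le_card[OF fB])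
    finally show ?thesis by simp
  qed
  then have "P.expectation (\<lambda>\<omega>''. real (rk ((QQ \<omega> \<omega>'' 0 \<inter> ?N) \<union> ?S (Suc t))))
    \<le> P.expectation (\<lambda>\<omega>''. real (rk (?X \<omega>'')) + real (card {b \<in> B. b \<notin> spn (?X \<omega>'')}))"
    by (intro integral_mono Bochner_Integration.integrable_add integrable_QQ[OF \<omega>, of "\<lambda>q. rk ((q \<inter> ?N) \<union> ?S (Suc t))"]
        integrable_QQ[OF \<omega>, of "\<lambda>q. rk ((q \<inter> ?N) \<union> ?S t)"] integrable_QQ[OF \<omega>, of "\<lambda>q. card {b \<in> B. b \<notin> spn ((q \<inter> ?N) \<union> ?S t)}"])
  also have "\<dots> = P.expectation (\<lambda>\<omega>''. real (rk (?X \<omega>''))) + P.expectation (\<lambda>\<omega>''. real (card {b \<in> B. b \<notin> spn (?X \<omega>'')}))"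
    by (intro Bochner_Integration.integral_add integrable_QQ[OF \<omega>, of "\<lambda>q. rk ((q \<inter> ?N) \<union> ?S t)"] integrable_QQ[OF \<omega>, of "\<lambda>q. card {b \<in> B. b \<notin> spn ((q \<inter> ?N) \<union> ?S t)}"])
  also have "P.expectation (\<lambda>\<omega>''. real (card {b \<in> B. b \<notin> spn (?X \<omega>'')})) = (\<Sum>b\<in>B. P.prob {\<omega>'' \<in> space Om. b \<notin> spn (?X \<omega>'')})"
    by (rule expectation_card[OF \<omega> fB(1), of "\<lambda>b q. b \<notin> spn ((q \<inter> ?N) \<union> ?S t)"])
  also have "\<dots> \<le> (\<Sum>b\<in>B. 1/2 - 2 * e)"
  proof (rule sum_mono)
    fix b assume b: "b \<in> B"
    show "P.prob {\<omega>'' \<in> space Om. b \<notin> spn (?X \<omega>'')} \<le> 1/2 - 2 * e"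
    proof (cases "b \<in> ?S t")
      case True
      have "b \<in> spn (?X \<omega>'')" for \<omega>''
        using subset_spn[of "?X \<omega>''"] NQ_subset[of \<omega> \<omega>' d] sub True by blast
      then show ?thesis using e by simp
    next
      case False
      let ?Y = "\<lambda>\<omega>''. (QQ \<omega> \<omega>'' 0 \<inter> ?N - {b}) \<union> ?S t"
      have mX: "{\<omega>'' \<in> space Om. b \<in> spn (?X \<omega>'')} \<in> P.events"
        using pred_QQ0[OF \<omega>, of "\<lambda>q. b \<in> spn ((q \<inter> ?N) \<union> ?S t)"] by measurable
      have "1/2 + 2 * e \<le> span_prob \<omega> ?N (?S t) b"
        using False b B(1) sub Suc.prems by (intro SQ_in[OF dev K]) auto
      also have "\<dots> \<le> P.prob {\<omega>'' \<in> space Om. b \<in> spn (?X \<omega>'')}"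
        unfolding span_prob_def
      proof (rule P.finite_measure_mono[OF _ mX])
        have "spn (?Y \<omega>'') \<subseteq> spn (?X \<omega>'')" for \<omega>'' by (rule spn_mono) auto
        then show "{\<omega>'' \<in> space Om. b \<in> spn (?Y \<omega>'')} \<subseteq> {\<omega>'' \<in> space Om. b \<in> spn (?X \<omega>'')}" by blast
      qed
      finally have "1/2 + 2 * e \<le> P.prob {\<omega>'' \<in> space Om. b \<in> spn (?X \<omega>'')}" .
      moreover have "P.prob {\<omega>'' \<in> space Om. b \<notin> spn (?X \<omega>'')} = 1 - P.prob {\<omega>'' \<in> space Om. b \<in> spn (?X \<omega>'')}"
        using P.prob_neg[OF mX] .
      ultimately show ?thesis by simp
    qed
  qed
  also have "(\<Sum>b\<in>B. 1/2 - 2 * e) = (1/2 - 2 * e) * (real (rk (?S (Suc t))) - rk (?S t))"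
    unfolding B(2)[symmetric] by simp
  finally show ?case using Suc.IH Suc.prems by (simp add: algebra_simps)
qed

text \<open>The new set's rank is at most the mean rank of its union with the active items, hence at
  most the mean number of active items plus \<open>1/2 - 2 * e\<close> times itself. Occupancy
  bounds the former by \<open>(1 + e) / 2\<close> times the old rank; solving for the new rank gives
  the factor.\<close>

lemma level_contraction:
  assumes \<omega>: "\<omega> \<in> space Om" "occ_good \<omega>" and K: "K > 0" and e: "0 < e" "e \<le> 1/4"
    and dev: "\<And>t i. t < T \<Longrightarrow> i \<in> U \<Longrightarrow> \<not> dev \<omega> d t i \<omega>'"
  shows "real (rk (NQ \<omega> \<omega>' (Suc d))) \<le> (1 - e) * rk (NQ \<omega> \<omega>' d)"
proof -
  let ?N = "NQ \<omega> \<omega>' d" and ?S = "NQ \<omega> \<omega>' (Suc d)"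
  have SS: "?S = SQ \<omega> \<omega>' d (Suc (stp \<omega>' d))" by (rule NQ_Suc)
  have "real (rk ?S) = P.expectation (\<lambda>_. real (rk ?S))" by (simp add: P.prob_space)
  also have "\<dots> \<le> P.expectation (\<lambda>\<omega>''. real (rk ((QQ \<omega> \<omega>'' 0 \<inter> ?N) \<union> ?S)))"
    by (intro integral_mono integrable_QQ[OF \<omega>(1), of "\<lambda>_. rk ?S"] integrable_QQ[OF \<omega>(1), of "\<lambda>q. rk ((q \<inter> ?N) \<union> ?S)"])
      (simp add: rk_mono)
  also have "\<dots> \<le> P.expectation (\<lambda>\<omega>''. real (rk (QQ \<omega> \<omega>'' 0 \<inter> ?N))) + (1/2 - 2 * e) * rk ?S"
    unfolding SS by (intro stage_rank_gain[OF \<omega>(1) K e dev]) (auto simp: Suc_le_eq)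
  also have "P.expectation (\<lambda>\<omega>''. real (rk (QQ \<omega> \<omega>'' 0 \<inter> ?N))) \<le> P.expectation (\<lambda>\<omega>''. real (card {b \<in> ?N. b \<in> QQ \<omega> \<omega>'' 0}))"
  proof (intro integral_mono integrable_QQ[OF \<omega>(1), of "\<lambda>q. rk (q \<inter> ?N)"] integrable_QQ[OF \<omega>(1), of "\<lambda>q. card {b \<in> ?N. b \<in> q}"])
    fix \<omega>''
    have "{b \<in> ?N. b \<in> QQ \<omega> \<omega>'' 0} = QQ \<omega> \<omega>'' 0 \<inter> ?N" by auto
    moreover have "finite (QQ \<omega> \<omega>'' 0 \<inter> ?N)" by (simp add: QQ_def)
    ultimately show "real (rk (QQ \<omega> \<omega>'' 0 \<inter> ?N)) \<le> real (card {b \<in> ?N. b \<in> QQ \<omega> \<omega>'' 0})" using rk_le_card by simp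
  qed
  also have "P.expectation (\<lambda>\<omega>''. real (card {b \<in> ?N. b \<in> QQ \<omega> \<omega>'' 0})) = (\<Sum>b\<in>?N. act_prob \<omega> b)"
  proof -
    have "finite ?N" using NQ_subset finite_U by (rule finite_subset)
    moreover have "P.prob {\<omega>'' \<in> space Om. b \<in> QQ \<omega> \<omega>'' 0} = act_prob \<omega> b" if "b \<in> ?N" for b
      unfolding act_prob_def using that NQ_subset[of \<omega> \<omega>' d] by (intro arg_cong[of _ _ P.prob] Collect_cong) (auto simp: QQ_def)
    ultimately show ?thesis using expectation_card[OF \<omega>(1), of ?N "\<lambda>b q. b \<in> q"] by simp
  qed
  also have "(\<Sum>b\<in>?N. act_prob \<omega> b) \<le> 1/2 * (1 + e) * rk ?N" using \<omega>(2) NQ_subset unfolding occ_good_def by simp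
  finally have "real (rk ?S) \<le> 1/2 * (1 + e) * rk ?N + (1/2 - 2 * e) * rk ?S" by simp
  moreover have "real (rk ?S) * (1/2 + 2 * e) = real (rk ?S) - (1/2 - 2 * e) * rk ?S" by (simp add: field_simps)
  ultimately have 1: "real (rk ?S) * (1/2 + 2 * e) \<le> 1/2 * (1 + e) * rk ?N" by linarith
  \<comment> \<open>The difference of the two sides is \<open>e * (1 - 2 * e)\<close>.\<close>
  have "1/2 * (1 + e) \<le> (1 - e) * (1/2 + 2 * e)"
  proof -
    have "0 \<le> e * (1 - 2 * e)" using e by (intro mult_nonneg_nonneg) auto
    then show ?thesis by (simp add: field_simps)
  qed
  then have "1/2 * (1 + e) * rk ?N \<le> (1 - e) * (1/2 + 2 * e) * rk ?N" by (rule mult_right_mono) simp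
  with 1 have "real (rk ?S) * (1/2 + 2 * e) \<le> ((1 - e) * rk ?N) * (1/2 + 2 * e)" by (simp add: mult_ac)
  then show ?thesis using e by (simp add: mult_le_cancel_right)
qed

text \<open>After \<open>Dp\<close> contractions the rank is an integer below 1, so only loops can
  remain; every other item leaves the chain at some level.\<close>

lemma exit_level:
  assumes \<omega>: "\<omega> \<in> space Om" "occ_good \<omega>" and K: "K > 0" and e: "0 < e" "e \<le> 1/4"
    and dev: "\<And>d t i. d < Dp \<Longrightarrow> t < T \<Longrightarrow> i \<in> U \<Longrightarrow> \<not> dev \<omega> d t i \<omega>'"
    and i: "i \<in> U" "i \<notin> spn {}" and Dp: "(1 - e) ^ Dp * n < 1"
  obtains d where "d < Dp" "i \<in> NQ \<omega> \<omega>' d - NQ \<omega> \<omega>' (Suc d)"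
proof -
  have "real (rk (NQ \<omega> \<omega>' d)) \<le> (1 - e) ^ d * n" if "d \<le> Dp" for d
    using that
  proof (induction d)
    case 0
    have "rk U \<le> n" using rk_le_card[OF finite_U] by simp
    then show ?case by (simp add: NQ_0)
  next
    case (Suc d)
    have "real (rk (NQ \<omega> \<omega>' (Suc d))) \<le> (1 - e) * rk (NQ \<omega> \<omega>' d)"
      using Suc.prems by (intro level_contraction[OF \<omega> K e dev]) auto
    also have "\<dots> \<le> (1 - e) * ((1 - e) ^ d * n)" using Suc e by (intro mult_left_mono) auto
    finally show ?case by (simp add: mult_ac)
  qed
  from this[of Dp] have "rk (NQ \<omega> \<omega>' Dp) = 0" using Dp by simp
  moreover have "rk {i} = 1" using i rk_insert[of i "{}"] by simp
  ultimately have out: "i \<notin> NQ \<omega> \<omega>' Dp" using rk_mono[of "{i}" "NQ \<omega> \<omega>' Dp"] by auto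
  define d where "d = (LEAST d. i \<notin> NQ \<omega> \<omega>' d)"
  have d: "i \<notin> NQ \<omega> \<omega>' d" unfolding d_def by (rule LeastI[of _ Dp]) (rule out)
  have "d \<le> Dp" unfolding d_def by (rule Least_le) (rule out)
  have "d \<noteq> 0"
  proof
    assume "d = 0" then show False using d i(1) by (simp add: NQ_0)
  qed
  then obtain d' where d': "d = Suc d'" by (cases d) auto
  have "i \<in> NQ \<omega> \<omega>' d'" using not_less_Least[of d' "\<lambda>d. i \<notin> NQ \<omega> \<omega>' d"] d' unfolding d_def by auto
  then show thesis using that[of d'] d d' \<open>d \<le> Dp\<close> by auto
qed

lemma pred_surv: "\<omega> \<in> space Om \<Longrightarrow> Measurable.pred Om (surv \<omega> i)"
proof (rule pattern_QQ)
  fix \<omega>1 \<omega>2 assume *: "\<And>b. b \<le> num_samples \<Longrightarrow> QQ \<omega> \<omega>1 b = QQ \<omega> \<omega>2 b" "\<And>d. d < Dp \<Longrightarrow> stp \<omega>1 d = stp \<omega>2 d"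
  have "NQ \<omega> \<omega>1 d = NQ \<omega> \<omega>2 d" if "d \<le> Dp" for d using * that by (intro NQ_cong) auto
  moreover have "QQ \<omega> \<omega>1 0 = QQ \<omega> \<omega>2 0" using * by simp
  ultimately show "surv \<omega> i \<omega>1 = surv \<omega> i \<omega>2" unfolding surv_def by (intro ex_cong1 conj_cong refl) auto
qed

text \<open>An item leaving at level \<open>d\<close> is spanned with probability at most
  \<open>1/2 + 4 * e\<close> against the stage tested last, and at most \<open>incr\<close> more
  against the next set. The remaining terms bound the mean increments and the chance that some
  frequency is off.\<close>

lemma survival:
  assumes \<omega>: "\<omega> \<in> space Om" "occ_good \<omega>" and K: "K > 0" and e: "0 < e" "e \<le> 1/4"
    and i: "i \<in> U" "i \<notin> spn {}" and Dp: "(1 - e) ^ Dp * n < 1"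
  shows "(\<integral>\<^sup>+\<omega>'. indicator {\<omega>'. \<not> surv \<omega> i \<omega>'} \<omega>' \<partial>Om)
    \<le> ennreal (1/2 + 4 * e + Dp / T + Dp * T * n * (2 * exp (- 2 * e\<^sup>2 * K)))"
proof -
  \<comment> \<open>The chain is built from sample columns only, so the online column can be
    resampled with all levels fixed.\<close>
  let ?J = "slot_coords 0"
  let ?Z = "{..<Dp} \<times> {..<T} \<times> U"
  let ?bad = "\<lambda>\<omega>'. (\<Sum>(d, t, j)\<in>?Z. indicator {\<omega>'. dev \<omega> d t j \<omega>'} \<omega>' :: ennreal)"
  let ?inc = "\<lambda>\<omega>'. (\<Sum>d<Dp. ennreal (incr \<omega> i d \<omega>' (stp \<omega>' d)))"
  have ms: "Measurable.pred Om (\<lambda>\<omega>'. \<not> surv \<omega> i \<omega>')" using pred_surv[OF \<omega>(1)] by measurable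
  have mdev: "(indicator {\<omega>'. dev \<omega> d t j \<omega>'} :: _ \<Rightarrow> ennreal) \<in> borel_measurable Om" if "(d, t, j) \<in> ?Z" for d t j
    using that by (intro measurable_indicator_pred pred_dev \<omega>) auto
  have minc: "(\<lambda>\<omega>'. ennreal (incr \<omega> i d \<omega>' (stp \<omega>' d))) \<in> borel_measurable Om" if "d < Dp" for d
    by (rule measurable_compose[OF measurable_incr[OF \<omega>(1) that]]) simp
  have mbad: "?bad \<in> borel_measurable Om" using mdev by (intro borel_measurable_sum) auto
  have minc': "?inc \<in> borel_measurable Om" using minc by (intro borel_measurable_sum) auto
  have "(\<integral>\<^sup>+\<omega>'. indicator {\<omega>'. \<not> surv \<omega> i \<omega>'} \<omega>' \<partial>Om)
      = (\<integral>\<^sup>+\<omega>'. \<integral>\<^sup>+\<omega>''. indicator {\<omega>'. \<not> surv \<omega> i \<omega>'} (mix ?J \<omega>' \<omega>'') \<partial>Om \<partial>Om)"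
    by (rule resample[OF measurable_indicator_pred[OF ms]])
  also have "\<dots> \<le> (\<integral>\<^sup>+\<omega>'. ?bad \<omega>' + (ennreal (1/2 + 4 * e) + ?inc \<omega>') \<partial>Om)"
  proof (rule nn_integral_mono)
    fix \<omega>' assume w': "\<omega>' \<in> space Om"
    show "(\<integral>\<^sup>+\<omega>''. indicator {\<omega>'. \<not> surv \<omega> i \<omega>'} (mix ?J \<omega>' \<omega>'') \<partial>Om) \<le> ?bad \<omega>' + (ennreal (1/2 + 4 * e) + ?inc \<omega>')"
    proof (cases "\<exists>d t j. (d, t, j) \<in> ?Z \<and> dev \<omega> d t j \<omega>'")
      case True
      then obtain z where z: "z \<in> ?Z" "case z of (d, t, j) \<Rightarrow> dev \<omega> d t j \<omega>'" by auto
      have "(\<integral>\<^sup>+\<omega>''. indicator {\<omega>'. \<not> surv \<omega> i \<omega>'} (mix ?J \<omega>' \<omega>'') \<partial>Om) \<le> (\<integral>\<^sup>+\<omega>''. 1 \<partial>Om)"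
        by (intro nn_integral_mono) (simp add: indicator_def)
      also have "\<dots> = 1" by (simp add: P.emeasure_space_1)
      also have "(1 :: ennreal) = (case z of (d, t, j) \<Rightarrow> indicator {\<omega>'. dev \<omega> d t j \<omega>'} \<omega>')" using z(2) by (auto split: prod.splits)
      also have "\<dots> \<le> ?bad \<omega>'" by (rule member_le_sum[OF z(1)]) auto
      finally show ?thesis by (simp add: add_increasing2)
    next
      case False
      then have nd: "\<And>d t j. d < Dp \<Longrightarrow> t < T \<Longrightarrow> j \<in> U \<Longrightarrow> \<not> dev \<omega> d t j \<omega>'" by auto
      obtain d where d: "d < Dp" "i \<in> NQ \<omega> \<omega>' d - NQ \<omega> \<omega>' (Suc d)"
        by (rule exit_level[OF \<omega> K e nd i Dp])
      let ?t = "stp \<omega>' d" and ?N = "NQ \<omega> \<omega>' d"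
      have q: "QQ \<omega> (mix ?J \<omega>' \<omega>'') c = QQ \<omega> \<omega>' c" if "c \<in> {Suc L..num_samples}" for c \<omega>''
        unfolding QQ_def using that by (intro Collect_cong conj_cong refl) (simp add: sig_def mix_def)
      have q0: "QQ \<omega> (mix ?J \<omega>' \<omega>'') 0 = QQ \<omega> \<omega>'' 0" for \<omega>''
        unfolding QQ_def by (intro Collect_cong conj_cong refl) (simp add: sig_def mix_def)
      have N: "NQ \<omega> (mix ?J \<omega>' \<omega>'') d' = NQ \<omega> \<omega>' d'" if "d' \<le> Dp" for d' \<omega>''
        by (intro NQ_cong q that) (simp_all add: stp_def mix_def)
      have "surv \<omega> i (mix ?J \<omega>' \<omega>'')" if "i \<notin> spn ((QQ \<omega> \<omega>'' 0 \<inter> ?N - {i}) \<union> NQ \<omega> \<omega>' (Suc d))" for \<omega>''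
        unfolding surv_def q0 using d that N[of d \<omega>''] N[of "Suc d" \<omega>''] by (intro exI[of _ d]) auto
      then have "(\<integral>\<^sup>+\<omega>''. indicator {\<omega>'. \<not> surv \<omega> i \<omega>'} (mix ?J \<omega>' \<omega>'') \<partial>Om)
        \<le> (\<integral>\<^sup>+\<omega>''. indicator {\<omega>''. i \<in> spn ((QQ \<omega> \<omega>'' 0 \<inter> ?N - {i}) \<union> NQ \<omega> \<omega>' (Suc d))} \<omega>'' \<partial>Om)"
        by (intro nn_integral_mono) (auto simp: indicator_def)
      also have "\<dots> = ennreal (span_prob \<omega> ?N (NQ \<omega> \<omega>' (Suc d)) i)"
        unfolding span_prob_def using pred_QQ0[OF \<omega>(1), of "\<lambda>q. i \<in> spn ((q \<inter> ?N - {i}) \<union> NQ \<omega> \<omega>' (Suc d))"]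
        by (subst nn_integral_indicator_pred) (simp_all add: P.emeasure_eq_measure)
      also have "span_prob \<omega> ?N (NQ \<omega> \<omega>' (Suc d)) i = span_prob \<omega> ?N (SQ \<omega> \<omega>' d ?t) i + incr \<omega> i d \<omega>' ?t"
        unfolding incr_def NQ_Suc by simp
      also have "ennreal \<dots> \<le> ennreal (1/2 + 4 * e + incr \<omega> i d \<omega>' ?t)"
        using SQ_out[OF nd[OF d(1) stp_less i(1)] K] d(2) unfolding NQ_Suc by (intro ennreal_leI) auto
      also have "\<dots> = ennreal (1/2 + 4 * e) + ennreal (incr \<omega> i d \<omega>' ?t)"
        using e incr_nonneg[OF \<omega>(1)] by (intro ennreal_plus) auto
      \<comment> \<open>The exit level is itself random, so its increment is bounded by the sum over
        all levels. This costs \<open>Dp / T\<close> and is the reason why \<open>T\<close> must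
        exceed \<open>Dp / e\<close>.\<close>
      also have "\<dots> \<le> ennreal (1/2 + 4 * e) + ?inc \<omega>'"
        using d(1) by (intro add_left_mono member_le_sum[where f = "\<lambda>d. ennreal (incr \<omega> i d \<omega>' (stp \<omega>' d))"]) auto
      finally show ?thesis by (simp add: add_increasing)
    qed
  qed
  also have "\<dots> = (\<integral>\<^sup>+\<omega>'. ?bad \<omega>' \<partial>Om) + (ennreal (1/2 + 4 * e) + (\<integral>\<^sup>+\<omega>'. ?inc \<omega>' \<partial>Om))"
    using mbad minc' by (simp add: nn_integral_add P.emeasure_space_1)
  also have "(\<integral>\<^sup>+\<omega>'. ?bad \<omega>' \<partial>Om) \<le> (\<Sum>z\<in>?Z. ennreal (2 * exp (- 2 * e\<^sup>2 * K)))"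
  proof -
    have "(\<integral>\<^sup>+\<omega>'. ?bad \<omega>' \<partial>Om) = (\<Sum>z\<in>?Z. \<integral>\<^sup>+\<omega>'. (case z of (d, t, j) \<Rightarrow> indicator {\<omega>'. dev \<omega> d t j \<omega>'} \<omega>') \<partial>Om)"
      using mdev by (intro nn_integral_sum) (auto split: prod.splits)
    also have "\<dots> \<le> (\<Sum>z\<in>?Z. ennreal (2 * exp (- 2 * e\<^sup>2 * K)))"
    proof (rule sum_mono)
      fix z assume z: "z \<in> ?Z"
      obtain d t j where dtj: "z = (d, t, j)" by (cases z)
      show "(\<integral>\<^sup>+\<omega>'. (case z of (d, t, j) \<Rightarrow> indicator {\<omega>'. dev \<omega> d t j \<omega>'} \<omega>') \<partial>Om) \<le> ennreal (2 * exp (- 2 * e\<^sup>2 * K))"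
        unfolding dtj prod.case by (rule dev_prob[OF \<omega>(1) _ _ e(1) K]) (use z dtj in auto)
    qed
    finally show ?thesis .
  qed
  also have "(\<Sum>z\<in>?Z. ennreal (2 * exp (- 2 * e\<^sup>2 * K))) = ennreal (Dp * T * n * (2 * exp (- 2 * e\<^sup>2 * K)))"
    by (subst sum_ennreal) (auto simp: card_cartesian_product)
  also have "(\<integral>\<^sup>+\<omega>'. ?inc \<omega>' \<partial>Om) \<le> (\<Sum>d<Dp. ennreal (1 / T))"
  proof -
    have "(\<integral>\<^sup>+\<omega>'. ?inc \<omega>' \<partial>Om) = (\<Sum>d<Dp. \<integral>\<^sup>+\<omega>'. ennreal (incr \<omega> i d \<omega>' (stp \<omega>' d)) \<partial>Om)"
      using minc by (intro nn_integral_sum) auto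
    also have "\<dots> \<le> (\<Sum>d<Dp. ennreal (1 / T))"
      by (rule sum_mono) (rule incr_integral[OF \<omega>(1)], simp)
    finally show ?thesis .
  qed
  also have "(\<Sum>d<Dp. ennreal (1 / T)) = ennreal (Dp / T)" by (subst sum_ennreal) auto
  also have "ennreal (Dp * T * n * (2 * exp (- 2 * e\<^sup>2 * K))) + (ennreal (1/2 + 4 * e) + ennreal (Dp / T))
     = ennreal (1/2 + 4 * e + Dp / T + Dp * T * n * (2 * exp (- 2 * e\<^sup>2 * K)))"
    using e by (subst ennreal_plus[symmetric], simp, simp, subst ennreal_plus[symmetric]) (auto simp: add.commute)
  finally show ?thesis by (auto simp: add_mono)
qed

end

section \<open>Competitiveness\<close>

context prophet_instance
begin

definition fresh :: "coord set" where
  "fresh = {x. \<not> (fst x = 2 \<or> (fst x \<le> 1 \<and> snd (snd x) \<in> {1..L}))}"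

lemma fresh_iff [simp]: "(2, j, l) \<notin> fresh" "(3, j, l) \<in> fresh"
  "(0, j, l) \<in> fresh \<longleftrightarrow> l \<notin> {1..L}" "(1, j, l) \<in> fresh \<longleftrightarrow> l \<notin> {1..L}"
  by (auto simp: fresh_def)

abbreviation good :: "(coord \<Rightarrow> real) \<Rightarrow> bool" where
  "good \<omega> \<equiv> lab_good \<omega> \<and> occ_good \<omega>"

lemma train_fresh: "train (mix fresh \<omega> \<omega>') j = train \<omega> j"
  by (auto simp: train_def mix_def)

lemma act_fresh: "i \<in> U \<Longrightarrow> act (mix fresh \<omega> \<omega>') i x = act \<omega> i x"
  by (rule act_mix) (auto simp: train_def)

lemma good_fresh: "lab_good (mix fresh \<omega> \<omega>') = lab_good \<omega>" "occ_good (mix fresh \<omega> \<omega>') = occ_good \<omega>"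
proof -
  show "lab_good (mix fresh \<omega> \<omega>') = lab_good \<omega>" unfolding lab_good_def train_fresh ..
  have "act_prob (mix fresh \<omega> \<omega>') i = act_prob \<omega> i" if "i \<in> U" for i by (rule act_prob_cong) (rule act_fresh[OF that])
  then have "(\<Sum>i\<in>F. act_prob (mix fresh \<omega> \<omega>') i) = (\<Sum>i\<in>F. act_prob \<omega> i)" if "F \<subseteq> U" for F
    using that by (intro sum.cong) auto
  then show "occ_good (mix fresh \<omega> \<omega>') = occ_good \<omega>" unfolding occ_good_def by auto
qed

lemma sig_fresh: "b \<notin> {1..L} \<Longrightarrow> sig (mix fresh \<omega> \<omega>') j b = sig \<omega>' j b"
  by (simp add: sig_def mix_def)

lemma val_fresh: "i \<in> U \<Longrightarrow> val i (mix fresh \<omega> \<omega>') = ennreal (\<omega>' (0, i, 0)) * indicator {\<omega>'. act \<omega> i (sig \<omega>' i 0)} \<omega>'"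
  using sig_fresh[of 0 \<omega> \<omega>' i] by (simp add: val_def act_fresh indicator_def mix_def[of fresh \<omega> \<omega>' , THEN fun_cong])

lemma acc_if_surv:
  assumes i: "i \<in> U" and a: "act \<omega> i (sig \<omega>' i 0)" and s: "surv \<omega> i \<omega>'"
  shows "acc (mix fresh \<omega> \<omega>') i"
proof -
  let ?m = "mix fresh \<omega> \<omega>'"
  have Q: "Q ?m b = QQ \<omega> \<omega>' b" if "b \<notin> {1..L}" for b
    unfolding Q_def QQ_def using that by (intro Collect_cong conj_cong refl) (simp add: sig_fresh act_fresh)
  have st: "stp ?m d = stp \<omega>' d" for d by (simp add: stp_def mix_def)
  have N: "NN (Q ?m) (stp ?m) d = NQ \<omega> \<omega>' d" if "d \<le> Dp" for d
    unfolding NQ_def by (rule NN_cong) (use that in \<open>auto simp: Q st\<close>)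
  obtain d where d: "d < Dp" "i \<in> NQ \<omega> \<omega>' d - NQ \<omega> \<omega>' (Suc d)"
    "i \<notin> spn ((QQ \<omega> \<omega>' 0 \<inter> NQ \<omega> \<omega>' d - {i}) \<union> NQ \<omega> \<omega>' (Suc d))"
    using s unfolding surv_def by blast
  have "(Q ?m 0 \<inter> {..<i} \<inter> NQ \<omega> \<omega>' d) \<union> NQ \<omega> \<omega>' (Suc d) \<subseteq> (QQ \<omega> \<omega>' 0 \<inter> NQ \<omega> \<omega>' d - {i}) \<union> NQ \<omega> \<omega>' (Suc d)"
    using Q[of 0] by auto
  then have "i \<notin> spn ((Q ?m 0 \<inter> {..<i} \<inter> NQ \<omega> \<omega>' d) \<union> NQ \<omega> \<omega>' (Suc d))" using d(3) spn_mono by blast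
  moreover have "i \<in> Q ?m 0" using Q[of 0] i a by (simp add: QQ_def)
  ultimately show ?thesis unfolding acc_def using d N[of d] N[of "Suc d"] by (intro conjI exI[of _ d]) auto
qed

text \<open>Given the thresholds, value and activity of \<open>i\<close> depend on its own slot 0,
  while \<open>surv\<close> reads everything except that slot. Independence multiplies the value by
  the survival probability.\<close>

lemma item_value_ge:
  assumes \<omega>: "\<omega> \<in> space Om" "occ_good \<omega>" and K: "K > 0" and e: "0 < e" "e \<le> 1/4"
    and i: "i \<in> U" "i \<notin> spn {}" and Dp: "(1 - e) ^ Dp * n < 1"
    and fb: "1/2 + 4 * e + Dp / T + Dp * T * n * (2 * exp (- 2 * e\<^sup>2 * K)) \<le> 1 - s" and s: "0 \<le> s"
  shows "ennreal s * (\<integral>\<^sup>+\<omega>'. val i (mix fresh \<omega> \<omega>') \<partial>Om)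
    \<le> (\<integral>\<^sup>+\<omega>'. ennreal (mix fresh \<omega> \<omega>' (0, i, 0)) * indicator {\<omega>. acc \<omega> i} (mix fresh \<omega> \<omega>') \<partial>Om)"
proof -
  let ?J = "{(0, i, 0), (1, i, 0)} :: coord set"
  let ?v = "\<lambda>\<omega>'. val i (mix fresh \<omega> \<omega>')" and ?s = "\<lambda>\<omega>'. indicator {\<omega>'. surv \<omega> i \<omega>'} \<omega>' :: ennreal"
  have mv: "?v \<in> borel_measurable Om" by (rule measurable_compose[OF measurable_mix2[OF \<omega>(1)] measurable_val[OF i(1)]])
  have ps: "Measurable.pred Om (surv \<omega> i)" by (rule pred_surv[OF \<omega>(1)])
  have ms: "?s \<in> borel_measurable Om" by (rule measurable_indicator_pred[OF ps])
  have ms': "(\<lambda>\<omega>'. indicator {\<omega>'. \<not> surv \<omega> i \<omega>'} \<omega>' :: ennreal) \<in> borel_measurable Om"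
    by (rule measurable_indicator_pred) (use ps in measurable)
  have "1 = (\<integral>\<^sup>+\<omega>'. 1 \<partial>Om)" by (simp add: P.emeasure_space_1)
  also have "\<dots> = (\<integral>\<^sup>+\<omega>'. ?s \<omega>' + indicator {\<omega>'. \<not> surv \<omega> i \<omega>'} \<omega>' \<partial>Om)"
    by (intro nn_integral_cong) (simp add: indicator_def)
  also have "\<dots> = (\<integral>\<^sup>+\<omega>'. ?s \<omega>' \<partial>Om) + (\<integral>\<^sup>+\<omega>'. indicator {\<omega>'. \<not> surv \<omega> i \<omega>'} \<omega>' \<partial>Om)"
    by (rule nn_integral_add[OF ms ms'])
  also have "\<dots> \<le> (\<integral>\<^sup>+\<omega>'. ?s \<omega>' \<partial>Om) + ennreal (1 - s)"
    by (intro add_left_mono order_trans[OF survival[OF \<omega> K e i Dp]] ennreal_leI fb)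
  finally have 1: "1 \<le> (\<integral>\<^sup>+\<omega>'. ?s \<omega>' \<partial>Om) + ennreal (1 - s)" .
  have s1: "0 \<le> 1 - s" using fb e by (smt (verit) divide_nonneg_nonneg exp_ge_zero mult_nonneg_nonneg of_nat_0_le_iff)
  have "ennreal (1 - s) + ennreal s = 1"
    using s s1 ennreal_plus[of "1 - s" s] by simp
  then have "ennreal (1 - s) + ennreal s \<le> ennreal (1 - s) + (\<integral>\<^sup>+\<omega>'. ?s \<omega>' \<partial>Om)"
    using 1 by (simp add: add.commute)
  then have 2: "ennreal s \<le> (\<integral>\<^sup>+\<omega>'. ?s \<omega>' \<partial>Om)" by (simp add: ennreal_add_left_cancel_le)
  have q: "QQ \<omega> (mix ?J \<omega>1 \<omega>2) b - {i} = QQ \<omega> \<omega>1 b - {i}" for b \<omega>1 \<omega>2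
  proof -
    have "act \<omega> j (sig (mix ?J \<omega>1 \<omega>2) j b) = act \<omega> j (sig \<omega>1 j b)" if "j \<noteq> i" for j
      using that by (simp add: sig_def mix_def)
    then show ?thesis unfolding QQ_def by auto
  qed
  have q': "QQ \<omega> (mix ?J \<omega>1 \<omega>2) b = QQ \<omega> \<omega>1 b" if "b \<in> {Suc L..num_samples}" for b \<omega>1 \<omega>2
    unfolding QQ_def using that by (intro Collect_cong conj_cong refl) (simp add: sig_def mix_def)
  have N: "NQ \<omega> (mix ?J \<omega>1 \<omega>2) d = NQ \<omega> \<omega>1 d" if "d \<le> Dp" for d \<omega>1 \<omega>2
    by (intro NQ_cong q' that) (simp_all add: stp_def mix_def)
  have sv: "surv \<omega> i (mix ?J \<omega>1 \<omega>2) = surv \<omega> i \<omega>1" for \<omega>1 \<omega>2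
  proof -
    have "(QQ \<omega> (mix ?J \<omega>1 \<omega>2) 0 \<inter> X - {i}) = (QQ \<omega> \<omega>1 0 \<inter> X - {i})" for X
      using q[of \<omega>1 \<omega>2 0] by blast
    then show ?thesis unfolding surv_def using N by (intro ex_cong1 conj_cong refl) auto
  qed
  have "ennreal s * (\<integral>\<^sup>+\<omega>'. ?v \<omega>' \<partial>Om) \<le> (\<integral>\<^sup>+\<omega>'. ?v \<omega>' \<partial>Om) * (\<integral>\<^sup>+\<omega>'. ?s \<omega>' \<partial>Om)"
    unfolding mult.commute[of "ennreal s"] by (rule mult_left_mono[OF 2]) simp
  also have "\<dots> = (\<integral>\<^sup>+\<omega>'. ?v \<omega>' * ?s \<omega>' \<partial>Om)"
  proof (rule nn_integral_indep[OF mv ms, of ?J, symmetric])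
    fix \<omega>1 \<omega>2
    show "?v (mix ?J \<omega>1 \<omega>2) = ?v \<omega>2"
      unfolding val_fresh[OF i(1)] by (simp add: indicator_def sig_def mix_def)
    show "?s (mix ?J \<omega>1 \<omega>2) = ?s \<omega>1" by (simp add: indicator_def sv)
  qed
  also have "\<dots> \<le> (\<integral>\<^sup>+\<omega>'. ennreal (mix fresh \<omega> \<omega>' (0, i, 0)) * indicator {\<omega>. acc \<omega> i} (mix fresh \<omega> \<omega>') \<partial>Om)"
  proof (rule nn_integral_mono)
    fix \<omega>'
    have "mix fresh \<omega> \<omega>' (0, i, 0) = \<omega>' (0, i, 0)" by (simp add: mix_def)
    then show "?v \<omega>' * ?s \<omega>' \<le> ennreal (mix fresh \<omega> \<omega>' (0, i, 0)) * indicator {\<omega>. acc \<omega> i} (mix fresh \<omega> \<omega>')"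
      unfolding val_fresh[OF i(1)] using acc_if_surv[OF i(1), of \<omega> \<omega>'] by (auto simp: indicator_def)
  qed
  finally show ?thesis .
qed

section \<open>Loss on bad thresholds and infinite means\<close>

definition mean :: "nat \<Rightarrow> ennreal" where "mean i = (\<integral>\<^sup>+\<omega>. ennreal (\<omega> (0, i, 0)) \<partial>Om)"

lemma measurable_value: "i \<in> U \<Longrightarrow> (\<lambda>\<omega>. ennreal (\<omega> (0, i, 0))) \<in> borel_measurable Om"
  by (rule measurable_compose[OF coord_measurable]) auto

lemma val_loop: "i \<in> U \<Longrightarrow> i \<in> spn {} \<Longrightarrow> val i \<omega> = 0"
  using loop_blocked[of i] by (simp add: val_def act_def)

lemma mean_le_OPT: "i \<in> U \<Longrightarrow> i \<notin> spn {} \<Longrightarrow> mean i \<le> OPT"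
proof -
  assume i: "i \<in> U" "i \<notin> spn {}"
  then have "{i} \<in> Ind" using Ind_insert[OF empty_Ind] by simp
  then have "ennreal (\<omega> (0, i, 0)) \<le> ennreal (opt (\<lambda>j. \<omega> (0, j, 0)))" for \<omega>
    using opt_ge[of "{i}" "\<lambda>j. \<omega> (0, j, 0)"] by (intro ennreal_leI) simp
  then show ?thesis unfolding mean_def OPT_column(1)[of "\<lambda>_. 0", simplified, symmetric] by (rule nn_integral_mono)
qed

lemma OPT_le_means: "OPT \<le> (\<Sum>i\<in>U - spn {}. mean i)"
proof -
  have "OPT = (\<integral>\<^sup>+\<omega>. ennreal (opt (\<lambda>j. \<omega> (0, j, 0))) \<partial>Om)" using OPT_column(1)[of "\<lambda>_. 0"] by simp
  also have "\<dots> \<le> (\<integral>\<^sup>+\<omega>. (\<Sum>i\<in>U - spn {}. ennreal (\<omega> (0, i, 0))) \<partial>Om)"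
  proof (rule nn_integral_mono)
    fix \<omega>
    obtain S where S: "S \<in> Ind" "opt (\<lambda>j. \<omega> (0, j, 0)) = (\<Sum>i\<in>S. \<omega> (0, i, 0))" by (rule opt_obtain)
    have "x \<notin> spn {}" if "x \<in> S" for x
      using rk_Ind[OF Ind_down[OF S(1)], of "{x}"] that by (auto simp: spn_def)
    then have "S \<subseteq> U - spn {}" using Ind_sub[OF S(1)] by auto
    then have "(\<Sum>i\<in>S. ennreal (\<omega> (0, i, 0))) \<le> (\<Sum>i\<in>U - spn {}. ennreal (\<omega> (0, i, 0)))"
      by (intro sum_mono2) auto
    then show "ennreal (opt (\<lambda>j. \<omega> (0, j, 0))) \<le> (\<Sum>i\<in>U - spn {}. ennreal (\<omega> (0, i, 0)))"
      unfolding S(2) using ennreal_sum_le by (rule order_trans[rotated])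
  qed
  also have "\<dots> = (\<Sum>i\<in>U - spn {}. mean i)"
    unfolding mean_def by (rule nn_integral_sum) (auto intro: measurable_value)
  finally show ?thesis .
qed

definition good_value :: ennreal where
  "good_value = (\<Sum>i\<in>U. \<integral>\<^sup>+\<omega>. val i \<omega> * indicator {\<omega>. good \<omega>} \<omega> \<partial>Om)"

lemma pred_good: "Measurable.pred Om (\<lambda>\<omega>. good \<omega>)"
  using pred_lab_good pred_occ_good by measurable

lemma alg_ge:
  assumes K: "K > 0" and e: "0 < e" "e \<le> 1/4" and Dp: "(1 - e) ^ Dp * n < 1"
    and fb: "1/2 + 4 * e + Dp / T + Dp * T * n * (2 * exp (- 2 * e\<^sup>2 * K)) \<le> 1 - s" and s: "0 \<le> s"
  shows "ennreal s * good_value \<le> expected_alg n num_samples D the_alg"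
proof -
  have mg: "(indicator {\<omega>. good \<omega>} :: _ \<Rightarrow> ennreal) \<in> borel_measurable Om"
    by (rule measurable_indicator_pred[OF pred_good])
  have pa: "Measurable.pred Om (\<lambda>\<omega>. acc \<omega> i)" for i unfolding measurable_Om_iff by (rule pred_acc)
  have ma: "(\<lambda>\<omega>. ennreal (\<omega> (0, i, 0)) * indicator {\<omega>. acc \<omega> i} \<omega>) \<in> borel_measurable Om" if "i \<in> U" for i
    by (rule borel_measurable_times_ennreal[OF measurable_value[OF that] measurable_indicator_pred[OF pa]])
  have mvg: "(\<lambda>\<omega>. val i \<omega> * indicator {\<omega>. good \<omega>} \<omega>) \<in> borel_measurable Om" if "i \<in> U" for i
    by (rule borel_measurable_times_ennreal[OF measurable_val[OF that] mg])
  have "ennreal s * good_value = (\<Sum>i\<in>U. ennreal s * (\<integral>\<^sup>+\<omega>. val i \<omega> * indicator {\<omega>. good \<omega>} \<omega> \<partial>Om))"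
    unfolding good_value_def by (rule sum_distrib_left)
  also have "\<dots> \<le> (\<Sum>i\<in>U. \<integral>\<^sup>+\<omega>. ennreal (\<omega> (0, i, 0)) * indicator {\<omega>. acc \<omega> i} \<omega> \<partial>Om)"
  proof (rule sum_mono)
    fix i assume i: "i \<in> U"
    have "ennreal s * (\<integral>\<^sup>+\<omega>. val i \<omega> * indicator {\<omega>. good \<omega>} \<omega> \<partial>Om)
       = ennreal s * (\<integral>\<^sup>+\<omega>. \<integral>\<^sup>+\<omega>'. val i (mix fresh \<omega> \<omega>') * indicator {\<omega>. good \<omega>} (mix fresh \<omega> \<omega>') \<partial>Om \<partial>Om)"
      by (rule arg_cong[OF resample[OF mvg[OF i]]])
    also have "\<dots> = (\<integral>\<^sup>+\<omega>. ennreal s * (\<integral>\<^sup>+\<omega>'. val i (mix fresh \<omega> \<omega>') * indicator {\<omega>. good \<omega>} (mix fresh \<omega> \<omega>') \<partial>Om) \<partial>Om)"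
      by (rule nn_integral_cmult[symmetric]) (rule measurable_resample[OF mvg[OF i]])
    also have "\<dots> \<le> (\<integral>\<^sup>+\<omega>. \<integral>\<^sup>+\<omega>'. ennreal (mix fresh \<omega> \<omega>' (0, i, 0)) * indicator {\<omega>. acc \<omega> i} (mix fresh \<omega> \<omega>') \<partial>Om \<partial>Om)"
    proof (rule nn_integral_mono)
      fix \<omega> assume w: "\<omega> \<in> space Om"
      show "ennreal s * (\<integral>\<^sup>+\<omega>'. val i (mix fresh \<omega> \<omega>') * indicator {\<omega>. good \<omega>} (mix fresh \<omega> \<omega>') \<partial>Om)
        \<le> (\<integral>\<^sup>+\<omega>'. ennreal (mix fresh \<omega> \<omega>' (0, i, 0)) * indicator {\<omega>. acc \<omega> i} (mix fresh \<omega> \<omega>') \<partial>Om)"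
      proof (cases "good \<omega> \<and> i \<notin> spn {}")
        case True
        then show ?thesis using item_value_ge[OF w _ K e i _ Dp fb s]
          unfolding indicator_def mem_Collect_eq good_fresh by simp
      next
        case False
        then have z: "val i (mix fresh \<omega> \<omega>') * indicator {\<omega>. good \<omega>} (mix fresh \<omega> \<omega>') = 0" for \<omega>'
          using val_loop[OF i] unfolding indicator_def mem_Collect_eq good_fresh by auto
        show ?thesis unfolding z by simp
      qed
    qed
    also have "\<dots> = (\<integral>\<^sup>+\<omega>. ennreal (\<omega> (0, i, 0)) * indicator {\<omega>. acc \<omega> i} \<omega> \<partial>Om)"
      by (rule resample[OF ma[OF i], symmetric])
    finally show "ennreal s * (\<integral>\<^sup>+\<omega>. val i \<omega> * indicator {\<omega>. good \<omega>} \<omega> \<partial>Om)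
      \<le> (\<integral>\<^sup>+\<omega>. ennreal (\<omega> (0, i, 0)) * indicator {\<omega>. acc \<omega> i} \<omega> \<partial>Om)" .
  qed
  also have "\<dots> = expected_alg n num_samples D the_alg"
    unfolding expected_alg_eq using ma by (intro nn_integral_sum[symmetric]) auto
  finally show ?thesis .
qed

text \<open>The bad event is determined by the training data, hence independent of the online
  values. A non-loop loses at most its mean times \<delta>, and its mean is at most
  \<open>OPT\<close>. The crude sum over items is why \<delta> must be small compared to
  1/n.\<close>

lemma good_value_ge:
  assumes bad: "emeasure Om {\<omega> \<in> space Om. lab_good \<omega> \<and> \<not> occ_good \<omega>} \<le> \<delta>"
  shows "(\<Sum>i\<in>U. \<integral>\<^sup>+\<omega>. val i \<omega> * indicator {\<omega>. lab_good \<omega>} \<omega> \<partial>Om) \<le> good_value + of_nat n * (OPT * \<delta>)"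
proof -
  let ?B = "{\<omega>. lab_good \<omega> \<and> \<not> occ_good \<omega>}"
  have pB: "Measurable.pred Om (\<lambda>\<omega>. lab_good \<omega> \<and> \<not> occ_good \<omega>)"
    using pred_lab_good pred_occ_good by measurable
  have mB: "(indicator ?B :: _ \<Rightarrow> ennreal) \<in> borel_measurable Om" by (rule measurable_indicator_pred[OF pB])
  have mg: "(indicator {\<omega>. good \<omega>} :: _ \<Rightarrow> ennreal) \<in> borel_measurable Om"
    by (rule measurable_indicator_pred[OF pred_good])
  have "(\<integral>\<^sup>+\<omega>. val i \<omega> * indicator {\<omega>. lab_good \<omega>} \<omega> \<partial>Om)
     \<le> (\<integral>\<^sup>+\<omega>. val i \<omega> * indicator {\<omega>. good \<omega>} \<omega> \<partial>Om) + OPT * \<delta>" if i: "i \<in> U" for i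
  proof -
    have "(\<integral>\<^sup>+\<omega>. val i \<omega> * indicator {\<omega>. lab_good \<omega>} \<omega> \<partial>Om)
       = (\<integral>\<^sup>+\<omega>. val i \<omega> * indicator {\<omega>. good \<omega>} \<omega> + val i \<omega> * indicator ?B \<omega> \<partial>Om)"
      by (intro nn_integral_cong) (auto simp: indicator_def)
    also have "\<dots> = (\<integral>\<^sup>+\<omega>. val i \<omega> * indicator {\<omega>. good \<omega>} \<omega> \<partial>Om) + (\<integral>\<^sup>+\<omega>. val i \<omega> * indicator ?B \<omega> \<partial>Om)"
      by (intro nn_integral_add borel_measurable_times_ennreal measurable_val i mB mg)
    also have "(\<integral>\<^sup>+\<omega>. val i \<omega> * indicator ?B \<omega> \<partial>Om) \<le> OPT * \<delta>"
    proof (cases "i \<in> spn {}")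
      case True
      then show ?thesis using val_loop[OF i] by simp
    next
      case False
      have "(\<integral>\<^sup>+\<omega>. val i \<omega> * indicator ?B \<omega> \<partial>Om)
         = (\<integral>\<^sup>+\<omega>. \<integral>\<^sup>+\<omega>'. val i (mix fresh \<omega> \<omega>') * indicator ?B (mix fresh \<omega> \<omega>') \<partial>Om \<partial>Om)"
        by (intro resample borel_measurable_times_ennreal measurable_val i mB)
      also have "\<dots> \<le> (\<integral>\<^sup>+\<omega>. \<integral>\<^sup>+\<omega>'. ennreal (\<omega>' (0, i, 0)) * indicator ?B \<omega> \<partial>Om \<partial>Om)"
        unfolding val_fresh[OF i] by (intro nn_integral_mono) (simp add: indicator_def good_fresh)
      also have "\<dots> = (\<integral>\<^sup>+\<omega>. mean i * indicator ?B \<omega> \<partial>Om)"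
        unfolding mean_def by (intro nn_integral_cong nn_integral_multc measurable_value i)
      also have "\<dots> = mean i * emeasure Om {\<omega> \<in> space Om. lab_good \<omega> \<and> \<not> occ_good \<omega>}"
        using mB nn_integral_indicator_pred[OF pB] by (subst nn_integral_cmult) auto
      also have "\<dots> \<le> OPT * \<delta>" by (rule mult_mono[OF mean_le_OPT[OF i False] bad]) auto
      finally show ?thesis .
    qed
    finally show ?thesis by (simp add: add_left_mono)
  qed
  then have "(\<Sum>i\<in>U. \<integral>\<^sup>+\<omega>. val i \<omega> * indicator {\<omega>. lab_good \<omega>} \<omega> \<partial>Om)
     \<le> (\<Sum>i\<in>U. (\<integral>\<^sup>+\<omega>. val i \<omega> * indicator {\<omega>. good \<omega>} \<omega> \<partial>Om) + OPT * \<delta>)" by (intro sum_mono)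
  then show ?thesis unfolding good_value_def by (simp add: sum.distrib)
qed

text \<open>A value above all training samples is always active, so an infinite mean survives thresholding.\<close>

lemma good_value_infinite:
  assumes C: "C > 0" and inf: "OPT = \<infinity>" and pos: "emeasure Om {\<omega> \<in> space Om. good \<omega>} > 0"
  shows "good_value = \<infinity>"
proof -
  have "\<exists>i\<in>U - spn {}. mean i = \<infinity>"
  proof (rule ccontr)
    assume "\<not> (\<exists>i\<in>U - spn {}. mean i = \<infinity>)"
    then have *: "mean i \<noteq> \<top>" if "i \<in> U - spn {}" for i using that by auto
    have "(\<Sum>i\<in>A. mean i) \<noteq> \<top>" if "finite A" "A \<subseteq> U - spn {}" for A
      using that by (induction A rule: finite_induct) (use * in \<open>auto simp: ennreal_add_eq_top\<close>)
    from this[of "U - spn {}"] have "(\<Sum>i\<in>U - spn {}. mean i) \<noteq> \<top>" by simp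
    then show False using OPT_le_means inf by (simp add: top_unique)
  qed
  then obtain i where i: "i \<in> U" "i \<notin> spn {}" "mean i = \<infinity>" by auto
  have inf': "(\<integral>\<^sup>+\<omega>'. val i (mix fresh \<omega> \<omega>') \<partial>Om) = \<infinity>" if w: "\<omega> \<in> space Om" for \<omega>
  proof -
    \<comment> \<open>A finite level above all training values. Truncating a variable of infinite
      mean below \<open>m\<close> removes only a finite amount.\<close>
    define m where "m = (\<Sum>j\<in>U. \<Sum>l\<in>{1..L}. \<bar>\<omega> (0, j, l)\<bar>)"
    have m: "\<omega> (0, j, l) \<le> m" if "j \<in> U" "l \<in> {1..L}" for j l
    proof -
      have "\<omega> (0, j, l) \<le> \<bar>\<omega> (0, j, l)\<bar>" by simp
      also have "\<dots> \<le> (\<Sum>l\<in>{1..L}. \<bar>\<omega> (0, j, l)\<bar>)"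
        using that by (intro member_le_sum[where f = "\<lambda>l. \<bar>\<omega> (0, j, l)\<bar>"]) auto
      also have "\<dots> \<le> m" unfolding m_def
        using that by (intro member_le_sum[where f = "\<lambda>j. \<Sum>l\<in>{1..L}. \<bar>\<omega> (0, j, l)\<bar>"]) (auto intro: sum_nonneg)
      finally show ?thesis .
    qed
    have a: "act \<omega> i (sig \<omega>' i 0)" if "m < \<omega>' (0, i, 0)" for \<omega>'
    proof -
      have z: "cnt \<omega> (sig \<omega>' i 0) j = 0" if j: "j \<in> U" for j
      proof -
        have "\<not> beats (sig \<omega> j l) (sig \<omega>' i 0)" if "l \<in> train \<omega> j" for l
        proof -
          have "l \<in> {1..L}" using that by (simp add: train_def)
          then have "\<omega> (0, j, l) < \<omega>' (0, i, 0)" using m[OF j] \<open>m < _\<close> by fastforce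
          then show ?thesis by (simp add: beats_def sig_def)
        qed
        then have z: "{l \<in> train \<omega> j. beats (sig \<omega> j l) (sig \<omega>' i 0)} = {}" by blast
        show ?thesis unfolding cnt_def z by simp
      qed
      have "\<not> blocked C (cnt \<omega> (sig \<omega>' i 0)) i"
      proof
        assume "blocked C (cnt \<omega> (sig \<omega>' i 0)) i"
        then have "blocked C (\<lambda>_. 0) i" by (rule blocked_mono) (simp add: z)
        then obtain F where F: "F \<subseteq> U" "i \<in> F" "cut C (\<lambda>_. 0) F = 0" unfolding blocked_def by auto
        then have "rk F = 0" using C by (simp add: cut_def)
        moreover have "rk {i} = 1" using i rk_insert[of i "{}"] by simp
        ultimately show False using rk_mono[of "{i}" F] F(2) by simp
      qed
      then show ?thesis unfolding act_def .
    qed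
    have "mean i \<le> (\<integral>\<^sup>+\<omega>'. val i (mix fresh \<omega> \<omega>') + ennreal m \<partial>Om)"
      unfolding mean_def val_fresh[OF i(1)]
    proof (rule nn_integral_mono)
      fix \<omega>' show "ennreal (\<omega>' (0, i, 0)) \<le> ennreal (\<omega>' (0, i, 0)) * indicator {\<omega>'. act \<omega> i (sig \<omega>' i 0)} \<omega>' + ennreal m"
        using a[of \<omega>'] by (cases "m < \<omega>' (0, i, 0)") (auto simp: indicator_def intro: ennreal_leI add_increasing)
    qed
    also have "\<dots> = (\<integral>\<^sup>+\<omega>'. val i (mix fresh \<omega> \<omega>') \<partial>Om) + (\<integral>\<^sup>+\<omega>'. ennreal m \<partial>Om)"
      by (intro nn_integral_add measurable_compose[OF measurable_mix2[OF w] measurable_val[OF i(1)]]) simp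
    finally have "\<infinity> \<le> (\<integral>\<^sup>+\<omega>'. val i (mix fresh \<omega> \<omega>') \<partial>Om) + ennreal m"
      using i(3) by (simp add: P.emeasure_space_1)
    then show ?thesis by (simp add: top_unique ennreal_add_eq_top)
  qed
  have mg: "(indicator {\<omega>. good \<omega>} :: _ \<Rightarrow> ennreal) \<in> borel_measurable Om"
    by (rule measurable_indicator_pred[OF pred_good])
  have "(\<integral>\<^sup>+\<omega>. val i \<omega> * indicator {\<omega>. good \<omega>} \<omega> \<partial>Om)
     = (\<integral>\<^sup>+\<omega>. \<integral>\<^sup>+\<omega>'. val i (mix fresh \<omega> \<omega>') * indicator {\<omega>. good \<omega>} (mix fresh \<omega> \<omega>') \<partial>Om \<partial>Om)"
    by (intro resample borel_measurable_times_ennreal measurable_val i mg)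
  also have "\<dots> = (\<integral>\<^sup>+\<omega>. \<infinity> * indicator {\<omega>. good \<omega>} \<omega> \<partial>Om)"
  proof (rule nn_integral_cong)
    fix \<omega> assume "\<omega> \<in> space Om"
    then show "(\<integral>\<^sup>+\<omega>'. val i (mix fresh \<omega> \<omega>') * indicator {\<omega>. good \<omega>} (mix fresh \<omega> \<omega>') \<partial>Om) = \<infinity> * indicator {\<omega>. good \<omega>} \<omega>"
      using inf'[of \<omega>] unfolding indicator_def mem_Collect_eq good_fresh by auto
  qed
  also have "\<dots> = \<infinity> * emeasure Om {\<omega> \<in> space Om. good \<omega>}"
    using mg nn_integral_indicator_pred[OF pred_good] by (subst nn_integral_cmult) auto
  also have "\<dots> = \<infinity>" using pos by (simp add: ennreal_top_mult)
  finally have "\<infinity> \<le> good_value" unfolding good_value_def using i(1)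
    by (metis (no_types, lifting) finite_atLeastAtMost member_le_sum zero_le)
  then show ?thesis by (simp add: top_unique)
qed

text \<open>Survival contributes \<open>1/2 - 6 * e\<close> and the active value
  \<open>1/2 - 2 * e\<close>; their product is at least \<open>1/4 - 4 * e\<close>.\<close>

lemma competitive_bound:
  assumes L: "L = 4 * C" and C: "1 \<le> e * C" and K: "K > 0" and e: "0 < e" "e \<le> 1/16"
    and Dp: "(1 - e) ^ Dp * n < 1" and T1: "Dp / T \<le> e" and T2: "Dp * T * n * (2 * exp (- 2 * e\<^sup>2 * K)) \<le> e"
    and lab: "n * (2 * exp (- (e\<^sup>2 * C / 2))) \<le> e"
    and y: "1 < y" "y < 2" and occ: "n * ((1 + ((1 / (2 - y) * y powr (- ((1 - e/2) * (1 + e)))) ^ C)) ^ n - 1) \<le> e"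
  shows "ennreal (1/4 - 4 * e) * expected_opt n Ind D \<le> expected_alg n num_samples D the_alg"
proof -
  define q where "q = (1 / (2 - y) * y powr (- ((1 - e/2) * (1 + e)))) ^ C"
  define \<delta> where "\<delta> = (1 + q) ^ n - 1"
  have q0: "q \<ge> 0" unfolding q_def using y by simp
  have \<delta>0: "\<delta> \<ge> 0" unfolding \<delta>_def using q0 one_le_power[of "1 + q" n] by simp
  have C0: "C > 0" using C by (cases C) auto
  have e1: "e \<le> 1/4" "e \<le> 1" using e by auto
  have fb: "1/2 + 4 * e + Dp / T + Dp * T * n * (2 * exp (- 2 * e\<^sup>2 * K)) \<le> 1 - (1/2 - 6 * e)"
    using T1 T2 by simp
  have s0: "0 \<le> 1/2 - 6 * e" using e by simp
  have alg: "ennreal (1/2 - 6 * e) * good_value \<le> expected_alg n num_samples D the_alg"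
    by (rule alg_ge[OF K e(1) e1(1) Dp fb s0])
  have bad: "emeasure Om {\<omega> \<in> space Om. lab_good \<omega> \<and> \<not> occ_good \<omega>} \<le> ennreal \<delta>"
    unfolding \<delta>_def by (rule occupancy[OF y L e(1) e1(2) q_def])
  have nlab: "emeasure Om {\<omega> \<in> space Om. \<not> lab_good \<omega>} \<le> ennreal e"
    using lab_good_prob[OF L C0 e(1)] lab by (auto intro: order_trans ennreal_leI)
  have plab: "P.prob {\<omega> \<in> space Om. lab_good \<omega>} \<ge> 1 - e"
  proof -
    have ev: "{\<omega> \<in> space Om. lab_good \<omega>} \<in> P.events" using pred_lab_good by measurable
    have "P.prob {\<omega> \<in> space Om. \<not> lab_good \<omega>} \<le> e" using nlab e by (simp add: P.emeasure_eq_measure)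
    then show ?thesis using P.prob_neg[OF ev] by simp
  qed
  show ?thesis
  \<comment> \<open>The loss \<open>n * OPT * \<delta>\<close> can be subtracted only when it is
    finite, so infinite optima are treated through \<open>good_value_infinite\<close>.\<close>
  proof (cases "OPT = \<infinity>")
    case True
    show ?thesis
    proof (cases "n = 0")
      case True
      then have "OPT \<le> 0" using OPT_le_means by simp
      then show ?thesis using \<open>OPT = \<infinity>\<close> by simp
    next
      case False
      have "P.prob {\<omega> \<in> space Om. lab_good \<omega>} \<le> P.prob {\<omega> \<in> space Om. good \<omega>} + P.prob {\<omega> \<in> space Om. lab_good \<omega> \<and> \<not> occ_good \<omega>}"
      proof -
        have "{\<omega> \<in> space Om. lab_good \<omega>} = {\<omega> \<in> space Om. good \<omega>} \<union> {\<omega> \<in> space Om. lab_good \<omega> \<and> \<not> occ_good \<omega>}" by auto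
        moreover have "{\<omega> \<in> space Om. good \<omega>} \<in> P.events" "{\<omega> \<in> space Om. lab_good \<omega> \<and> \<not> occ_good \<omega>} \<in> P.events"
          using pred_lab_good pred_occ_good by measurable
        ultimately show ?thesis using measure_Un_le by simp
      qed
      moreover have "P.prob {\<omega> \<in> space Om. lab_good \<omega> \<and> \<not> occ_good \<omega>} \<le> \<delta>" using bad \<delta>0 by (simp add: P.emeasure_eq_measure)
      moreover have "1 * \<delta> \<le> n * \<delta>" using False \<delta>0 by (intro mult_right_mono) auto
      then have "\<delta> \<le> e" using occ unfolding \<delta>_def q_def by simp
      ultimately have "0 < P.prob {\<omega> \<in> space Om. good \<omega>}" using plab e by linarith
      then have "good_value = \<infinity>" by (intro good_value_infinite C0 True) (simp add: P.emeasure_eq_measure)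
      moreover have "ennreal (1/2 - 6 * e) \<noteq> 0" using e by simp
      ultimately have "expected_alg n num_samples D the_alg = \<infinity>" using alg by (simp add: ennreal_mult_top top_unique)
      then show ?thesis by simp
    qed
  next
    case False
    show ?thesis
    proof (cases "good_value = \<infinity>")
      case True
      moreover have "ennreal (1/2 - 6 * e) \<noteq> 0" using e by simp
      ultimately have "expected_alg n num_samples D the_alg = \<infinity>" using alg by (simp add: ennreal_mult_top top_unique)
      then show ?thesis by simp
    next
      case gv: False
      obtain o' where o': "OPT = ennreal o'" "o' \<ge> 0" using False by (cases OPT) auto
      obtain v where v: "good_value = ennreal v" "v \<ge> 0" using gv by (cases good_value) auto
      \<comment> \<open>An item has at most \<open>(2 + e) * C\<close> training slots and slot 0;
        the extra 1 is absorbed by \<open>e * C\<close>.\<close>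
      define M where "M = 2 * C * (1 + e)"
      have M0: "M > 0" unfolding M_def using C0 e by simp
      have "2 * C + e * C + 1 \<le> M" unfolding M_def using C by (simp add: algebra_simps)
      then have "ennreal C * OPT * emeasure Om {\<omega> \<in> space Om. lab_good \<omega>}
        \<le> ennreal M * (\<Sum>i\<in>U. \<integral>\<^sup>+\<omega>. val i \<omega> * indicator {\<omega>. lab_good \<omega>} \<omega> \<partial>Om)"
        by (rule gain_total[OF _ e(1) e1(2)])
      also have "\<dots> \<le> ennreal M * (good_value + of_nat n * (OPT * ennreal \<delta>))"
        by (intro mult_left_mono good_value_ge bad) simp
      finally have "ennreal (C * o' * P.prob {\<omega> \<in> space Om. lab_good \<omega>}) \<le> ennreal (M * (v + n * (o' * \<delta>)))"
        using o' v \<delta>0 M0 by (simp add: P.emeasure_eq_measure ennreal_mult ennreal_of_nat_eq_real_of_nat)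
      then have 1: "C * o' * P.prob {\<omega> \<in> space Om. lab_good \<omega>} \<le> M * (v + n * (o' * \<delta>))"
        using M0 v o' \<delta>0 by (subst (asm) ennreal_le_iff) auto
      have "C * o' * (1 - e) \<le> C * o' * P.prob {\<omega> \<in> space Om. lab_good \<omega>}"
        using plab o' by (intro mult_left_mono) auto
      also note 1
      also have "M * (v + n * (o' * \<delta>)) \<le> M * (v + o' * e)"
      proof -
        have "o' * (n * \<delta>) \<le> o' * e" using occ o' unfolding \<delta>_def q_def by (intro mult_left_mono) auto
        then show ?thesis using M0 by (simp add: mult_ac)
      qed
      finally have "C * (o' * (1 - e)) \<le> C * (2 * (1 + e) * (v + o' * e))" unfolding M_def by (simp add: mult_ac)
      then have 2: "o' * (1 - e) \<le> 2 * (1 + e) * (v + o' * e)" using C0 by simp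
      have "o' * (1/2 - 2 * e) \<le> v"
      proof -
        have "o' * ((1/2 - 2 * e) * (2 * (1 + e))) \<le> o' * ((1 - e) - 2 * (1 + e) * e)"
        proof (rule mult_left_mono[OF _ o'(2)])
          show "(1/2 - 2 * e) * (2 * (1 + e)) \<le> (1 - e) - 2 * (1 + e) * e"
            using e(1) by (simp add: algebra_simps power2_eq_square)
        qed
        also have "\<dots> \<le> 2 * (1 + e) * v" using 2 by (simp add: algebra_simps)
        finally have "(o' * (1/2 - 2 * e)) * (2 * (1 + e)) \<le> v * (2 * (1 + e))" by (simp add: mult_ac)
        then show ?thesis using e(1) by (subst (asm) mult_le_cancel_right) auto
      qed
      then have 3: "(1/2 - 6 * e) * (o' * (1/2 - 2 * e)) \<le> (1/2 - 6 * e) * v" using s0 by (rule mult_left_mono)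
      have "(1/4 - 4 * e) * o' \<le> ((1/2 - 6 * e) * (1/2 - 2 * e)) * o'"
      proof (rule mult_right_mono[OF _ o'(2)])
        show "1/4 - 4 * e \<le> (1/2 - 6 * e) * (1/2 - 2 * e)" using e(1) by (simp add: algebra_simps)
      qed
      with 3 have "(1/4 - 4 * e) * o' \<le> (1/2 - 6 * e) * v" by (simp add: mult_ac)
      then have "ennreal ((1/4 - 4 * e) * o') \<le> ennreal ((1/2 - 6 * e) * v)" by (rule ennreal_leI)
      then have "ennreal (1/4 - 4 * e) * OPT \<le> ennreal (1/2 - 6 * e) * good_value"
        unfolding o'(1) v(1) using e s0 o'(2) v(2) by (subst (asm) (1 2) ennreal_mult) auto
      then show ?thesis using alg unfolding OPT_def by (rule order_trans)
    qed
  qed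
qed

end

section \<open>Choice of the parameters\<close>

text \<open>\<open>y\<close> is the Chernoff parameter in \<open>walk_mgf\<close>, and the expression is the resulting base of the
  exponential tail of the occupancy.\<close>

lemma exists_tilt:
  fixes e :: real
  assumes e: "0 < e" "e \<le> 1/4"
  shows "\<exists>y. 1 < y \<and> y < 2 \<and> 1 / (2 - y) * y powr (- ((1 - e/2) * (1 + e))) < 1"
proof -
  \<comment> \<open>The tilt is \<open>y = 1 + x\<close>. Both logarithms agree to first order, so
    the sign is decided by the quadratic terms: \<open>b\<close> is at least
    \<open>1 + 4 * x\<close>, which leaves the margin \<open>x * (x * (1 - 4 * x))\<close>.\<close>
  define x where "x = e / 16"
  define b where "b = (1 - e/2) * (1 + e)"
  have x: "0 < x" "x \<le> 1/64" unfolding x_def using e by auto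
  have "0 \<le> e * (1/4 - e/2)" using e by (intro mult_nonneg_nonneg) auto
  then have b: "1 + e/4 \<le> b" unfolding b_def by (simp add: field_simps)
  have l1: "x - x\<^sup>2 \<le> ln (1 + x)" using x by (intro ln_one_plus_pos_lower_bound) auto
  have l2: "- x - 2 * x\<^sup>2 \<le> ln (1 - x)" using x by (intro ln_one_minus_pos_lower_bound) auto
  have "x * x \<le> x * 1" using x by (intro mult_left_mono) auto
  then have xx: "0 \<le> x - x\<^sup>2" by (simp add: power2_eq_square)
  have "0 < x * (x * (1 - 4 * x))" using x by (intro mult_pos_pos) auto
  then have "x + 2 * x\<^sup>2 < (1 + 4 * x) * (x - x\<^sup>2)" by (simp add: algebra_simps power2_eq_square)
  also have "\<dots> \<le> b * ln (1 + x)"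
  proof (intro mult_mono)
    show "1 + 4 * x \<le> b" "0 \<le> b" using b e unfolding x_def by auto
  qed (use l1 xx in auto)
  finally have "- ln (1 - x) < b * ln (1 + x)" using l2 by linarith
  then have "ln (1 / (1 - x)) + ln ((1 + x) powr (- b)) < 0"
    using x by (simp add: ln_div ln_powr)
  then have "ln (1 / (1 - x) * (1 + x) powr (- b)) < 0"
    using x by (subst ln_mult) auto
  moreover have "0 < 1 / (1 - x) * (1 + x) powr (- b)" using x by (intro mult_pos_pos) auto
  ultimately have "1 / (1 - x) * (1 + x) powr (- b) < 1" by (simp only: ln_less_zero_iff)
  then show ?thesis using x unfolding b_def by (intro exI[of _ "1 + x"]) auto
qed

section \<open>Parameters of logarithmic size\<close>

lemma ceiling_bounds:
  fixes x :: real assumes "0 \<le> x"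
  shows "x \<le> real (nat \<lceil>x\<rceil>)" "real (nat \<lceil>x\<rceil>) \<le> x + 1"
  using assms by (simp_all add: ceiling_correct)

text \<open>Shifted by one so that it is at least 1 for every \<open>n\<close>; additive constants
  and ceilings are then absorbed into multiples of it.\<close>

definition lg :: "nat \<Rightarrow> real" where "lg n = 1 + ln (real n)"

lemma lg_ge_1: "1 \<le> lg n" unfolding lg_def by (cases n) (auto intro: ln_ge_zero)

lemma le_exp_lg: "real n \<le> exp (lg n)"
proof (cases "n = 0")
  case False
  then have "real n = exp (ln (real n))" by simp
  also have "\<dots> \<le> exp (lg n)" unfolding lg_def by simp
  finally show ?thesis .
qed simp

lemma parameters_exist:
  fixes e :: real
  assumes e: "0 < e" "e \<le> 1/16"
  obtains C Dp T K :: "nat \<Rightarrow> nat" and c y :: real where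
    "\<And>n. 1 \<le> e * C n" "\<And>n. 0 < K n" "\<And>n. 0 < T n" "\<And>n. (1 - e) ^ Dp n * n < 1"
    "\<And>n. Dp n / T n \<le> e" "\<And>n. Dp n * T n * n * (2 * exp (- 2 * e\<^sup>2 * K n)) \<le> e"
    "\<And>n. n * (2 * exp (- (e\<^sup>2 * C n / 2))) \<le> e" "1 < y" "y < 2"
    "\<And>n. n * ((1 + ((1 / (2 - y) * y powr (- ((1 - e/2) * (1 + e)))) ^ C n)) ^ n - 1) \<le> e"
    "\<And>n. real (4 * C n + Dp n * T n * K n) \<le> c * lg n ^ 3"
proof -
  obtain y :: real where y: "1 < y" "y < 2" "1 / (2 - y) * y powr (- ((1 - e/2) * (1 + e))) < 1"
    using exists_tilt[of e] e by auto
  define \<theta> where "\<theta> = 1 / (2 - y) * y powr (- ((1 - e/2) * (1 + e)))"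
  have \<theta>: "0 < \<theta>" "\<theta> < 1" unfolding \<theta>_def using y by (auto intro!: mult_pos_pos divide_pos_pos)
  define lam where "lam = - ln \<theta>"
  have lam: "0 < lam" unfolding lam_def using \<theta> by simp
  define a where "a = ln (2 / e)"
  have a: "0 < a" unfolding a_def using e by simp
  have ea: "exp (- a) = e / 2" unfolding a_def using e by (simp add: exp_minus)
  \<comment> \<open>One summand for each demand on \<open>C\<close>: \<open>1 \<le> e * C\<close>,
    the label bound with a factor \<open>n\<close>, and the occupancy bound, where \<open>q\<close>
    must be of order n^-2.\<close>
  define A where "A = 1 / e + 2 * (1 + a) / e\<^sup>2 + (2 + a) / lam"
  have A: "1 / e \<le> A" "2 * (1 + a) / e\<^sup>2 \<le> A" "(2 + a) / lam \<le> A" "0 < A"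
    unfolding A_def using e a lam by (auto intro!: add_nonneg_nonneg add_pos_pos divide_nonneg_pos)
  define C where "C n = nat \<lceil>A * lg n\<rceil>" for n
  \<comment> \<open>\<open>Dp\<close> levels shrink the rank by \<open>exp (- (e * Dp))\<close>, at
    most \<open>exp (- (2 * lg n))\<close>, which beats \<open>n\<close>.\<close>
  define B where "B = 2 / e"
  have B: "0 < B" unfolding B_def using e by simp
  define Dp where "Dp n = nat \<lceil>B * lg n\<rceil>" for n
  define T where "T n = nat \<lceil>Dp n / e\<rceil>" for n
  define c1 where "c1 = (B + 1) * ((B + 1) / e + 1)"
  have c1: "0 < c1" unfolding c1_def using B e by (intro mult_pos_pos add_pos_pos divide_pos_pos) auto
  \<comment> \<open>The union bound has at most \<open>c1 * lg n ^ 2 * n\<close> events;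
    \<open>3 * lg n\<close> in the exponent cancels \<open>lg n ^ 2 * n\<close> and the logarithm
    cancels the constants.\<close>
  define G where "G = (3 + ln (1 + 2 * c1 / e)) / (2 * e\<^sup>2)"
  have lnG: "0 \<le> ln (1 + 2 * c1 / e)" using c1 e by (intro ln_ge_zero) simp
  have G: "0 < G" unfolding G_def using lnG e by (intro divide_pos_pos) auto
  define K where "K n = nat \<lceil>G * lg n\<rceil>" for n
  have l0: "0 < lg n" for n using lg_ge_1[of n] by linarith
  have Cb: "A * lg n \<le> C n" "C n \<le> A * lg n + 1" for n
    unfolding C_def using ceiling_bounds[of "A * lg n"] A(4) l0[of n] by auto
  have Db: "B * lg n \<le> Dp n" "Dp n \<le> B * lg n + 1" for n
    unfolding Dp_def using ceiling_bounds[of "B * lg n"] B l0[of n] by auto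
  have Tb: "Dp n / e \<le> T n" "T n \<le> Dp n / e + 1" for n
    unfolding T_def using ceiling_bounds[of "Dp n / e"] e by auto
  have Kb: "G * lg n \<le> K n" "K n \<le> G * lg n + 1" for n
    unfolding K_def using ceiling_bounds[of "G * lg n"] G l0[of n] by auto
  have mono1: "x \<le> x * lg n" if "0 \<le> x" for x n
    using mult_left_mono[OF lg_ge_1[of n] that] by simp
  have D1: "Dp n \<le> (B + 1) * lg n" for n using Db(2)[of n] lg_ge_1[of n] by (simp add: algebra_simps)
  have T1: "T n \<le> ((B + 1) / e + 1) * lg n" for n
  proof -
    have "Dp n / e \<le> (B + 1) * lg n / e" using D1[of n] e by (intro divide_right_mono) auto
    then show ?thesis using Tb(2)[of n] lg_ge_1[of n] by (simp add: algebra_simps)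
  qed
  have DT: "real (Dp n) * T n \<le> c1 * (lg n * lg n)" for n
    using mult_mono[OF D1[of n] T1[of n]] B l0[of n] unfolding c1_def by (simp add: mult_ac)
  have Dpos: "0 < real (Dp n)" for n using Db(1)[of n] mult_pos_pos[OF B l0[of n]] by linarith
  show thesis
  proof (rule that[of C K T Dp y "4 * (A + 1) + c1 * (G + 1)"])
    fix n
    have "1 / e * 1 \<le> A * lg n" using A(1,4) lg_ge_1[of n] by (intro mult_mono) auto
    then have "1 / e \<le> C n" using Cb(1)[of n] by simp
    then show "1 \<le> e * C n" using e by (simp add: field_simps)
    show "0 < K n" using Kb(1)[of n] mult_pos_pos[OF G l0[of n]] by (cases "K n") auto
    have "0 < real (T n)" using Tb(1)[of n] divide_pos_pos[OF Dpos[of n] e(1)] by linarith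
    then show Tpos: "0 < T n" by simp
    show "(1 - e) ^ Dp n * n < 1"
    proof -
      have "(1 - e) ^ Dp n \<le> exp (- e) ^ Dp n"
        using e exp_ge_add_one_self[of "- e"] by (intro power_mono) auto
      also have "\<dots> = exp (- (e * Dp n))" by (simp add: exp_of_nat_mult[symmetric] mult.commute)
      also have "\<dots> \<le> exp (- (2 * lg n))" using mult_left_mono[OF Db(1)[of n], of e] e unfolding B_def by simp
      finally have "(1 - e) ^ Dp n * n \<le> exp (- (2 * lg n)) * exp (lg n)"
        using le_exp_lg[of n] by (intro mult_mono) auto
      also have "\<dots> = exp (- lg n)" by (simp add: exp_add[symmetric])
      also have "\<dots> < 1" using l0[of n] by simp
      finally show ?thesis .
    qed
    show "Dp n / T n \<le> e" using Tb(1)[of n] Tpos e by (simp add: field_simps)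
    show "Dp n * T n * n * (2 * exp (- 2 * e\<^sup>2 * K n)) \<le> e"
    proof -
      have "lg n \<le> exp (lg n)" using exp_ge_add_one_self[of "lg n"] by linarith
      then have "lg n * lg n * n \<le> exp (lg n) * exp (lg n) * exp (lg n)"
        using le_exp_lg[of n] l0[of n] by (intro mult_mono) auto
      also have "\<dots> = exp (3 * lg n)" by (simp add: exp_add[symmetric])
      finally have l3: "lg n * lg n * n \<le> exp (3 * lg n)" .
      have "2 * e\<^sup>2 * (G * lg n) = 3 * lg n + ln (1 + 2 * c1 / e) * lg n"
        unfolding G_def using e by (simp add: field_simps)
      moreover have "ln (1 + 2 * c1 / e) \<le> ln (1 + 2 * c1 / e) * lg n" by (rule mono1[OF lnG])
      moreover have "2 * e\<^sup>2 * (G * lg n) \<le> 2 * e\<^sup>2 * K n" using Kb(1)[of n] by (intro mult_left_mono) auto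
      ultimately have "exp (- 2 * e\<^sup>2 * K n) \<le> exp (- (3 * lg n) - ln (1 + 2 * c1 / e))" by simp
      also have "\<dots> = exp (- (3 * lg n)) / (1 + 2 * c1 / e)"
        using c1 e by (simp add: exp_diff add_pos_pos)
      finally have ex: "exp (- 2 * e\<^sup>2 * K n) \<le> exp (- (3 * lg n)) / (1 + 2 * c1 / e)" .
      have "real (Dp n) * T n * n * (2 * exp (- 2 * e\<^sup>2 * K n)) \<le> (c1 * (lg n * lg n)) * n * (2 * (exp (- (3 * lg n)) / (1 + 2 * c1 / e)))"
        using c1 l0[of n]
        by (intro mult_mono[OF mult_mono[OF DT[of n] order_refl] mult_mono[OF order_refl ex]]) auto
      also have "\<dots> = 2 * c1 * (lg n * lg n * n * exp (- (3 * lg n))) / (1 + 2 * c1 / e)" by (simp add: mult_ac)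
      also have "\<dots> \<le> 2 * c1 * (exp (3 * lg n) * exp (- (3 * lg n))) / (1 + 2 * c1 / e)"
        using l3 c1 e by (intro divide_right_mono mult_left_mono mult_right_mono) auto
      also have "\<dots> = 2 * c1 / (1 + 2 * c1 / e)" by (simp add: exp_add[symmetric])
      also have "\<dots> \<le> e" using c1 e by (simp add: field_simps add_pos_pos)
      finally show ?thesis by simp
    qed
    show "n * (2 * exp (- (e\<^sup>2 * C n / 2))) \<le> e"
    proof -
      have "(1 + a) * lg n \<le> e\<^sup>2 / 2 * (A * lg n)"
        using mult_right_mono[OF A(2) less_imp_le[OF l0[of n]]] e
        by (simp add: field_simps del: mult_le_cancel_right mult_le_cancel_left)
      also have "\<dots> \<le> e\<^sup>2 / 2 * C n" using Cb(1)[of n] by (intro mult_left_mono) auto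
      finally have "lg n + a * lg n \<le> e\<^sup>2 * C n / 2" by (simp add: distrib_right)
      then have "lg n + a \<le> e\<^sup>2 * C n / 2" using mono1[OF less_imp_le[OF a], of n] by linarith
      then have "exp (- (e\<^sup>2 * C n / 2)) \<le> exp (- lg n + - a)" by simp
      also have "\<dots> = exp (- lg n) * (e / 2)" unfolding exp_add ea ..
      finally have "n * (2 * exp (- (e\<^sup>2 * C n / 2))) \<le> exp (lg n) * (2 * (exp (- lg n) * (e / 2)))"
        using le_exp_lg[of n] e by (intro mult_mono) auto
      also have "\<dots> = e" by (simp add: exp_minus)
      finally show ?thesis .
    qed
    show "n * ((1 + ((1 / (2 - y) * y powr (- ((1 - e/2) * (1 + e)))) ^ C n)) ^ n - 1) \<le> e"
    proof (cases "n = 0")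
      case False
      let ?q = "\<theta> ^ C n"
      have "?q = exp (- lam) ^ C n" unfolding lam_def using \<theta> by simp
      also have "\<dots> = exp (- (lam * C n))" by (simp add: exp_of_nat_mult[symmetric] mult.commute)
      finally have q: "?q = exp (- (lam * C n))" .
      have "(2 + a) * lg n \<le> lam * (A * lg n)"
        using mult_right_mono[OF A(3) less_imp_le[OF l0[of n]]] lam
        by (simp add: field_simps del: mult_le_cancel_right mult_le_cancel_left)
      also have "\<dots> \<le> lam * C n" using Cb(1)[of n] lam by (intro mult_left_mono) auto
      finally have "2 * lg n + a * lg n \<le> lam * C n" by (simp add: distrib_right)
      then have "2 * lg n + a \<le> lam * C n" using mono1[OF less_imp_le[OF a], of n] by linarith
      then have "?q \<le> exp (- (2 * lg n) + - a)" unfolding q by simp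
      also have "\<dots> = exp (- (2 * lg n)) * (e / 2)" unfolding exp_add ea ..
      finally have q2: "?q \<le> exp (- (2 * lg n)) * (e / 2)" .
      have nn: "real n * n \<le> exp (2 * lg n)"
        using mult_mono[OF le_exp_lg[of n] le_exp_lg[of n]] by (simp add: exp_add[symmetric])
      have "real n * n * ?q \<le> exp (2 * lg n) * (exp (- (2 * lg n)) * (e / 2))"
        using nn q2 \<theta> by (intro mult_mono) auto
      also have "\<dots> = e / 2" by (simp add: exp_minus)
      finally have nq: "real n * n * ?q \<le> e / 2" .
      have "1 * (n * ?q) \<le> n * (n * ?q)" using False \<theta> by (intro mult_right_mono) auto
      then have nq1: "n * ?q \<le> 1" using nq e by (simp add: mult_ac)
      have "(1 + ?q) ^ n \<le> exp ?q ^ n" using exp_ge_add_one_self[of ?q] \<theta> by (intro power_mono) auto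
      also have "\<dots> = exp (n * ?q)" by (simp add: exp_of_nat_mult[symmetric])
      \<comment> \<open>As \<open>n * ?q\<close> is at most 1, the excess over 1 is at most twice
        \<open>n * ?q\<close>; the outer factor \<open>n\<close> then calls for
        \<open>n * n * ?q \<le> e / 2\<close>.\<close>
      also have "\<dots> \<le> 1 + n * ?q + (n * ?q)\<^sup>2" using nq1 \<theta> by (intro exp_bound) auto
      also have "(n * ?q)\<^sup>2 \<le> n * ?q" using mult_left_mono[OF nq1, of "n * ?q"] \<theta> by (simp add: power2_eq_square)
      finally have "(1 + ?q) ^ n - 1 \<le> 2 * (n * ?q)" by simp
      then have "n * ((1 + ?q) ^ n - 1) \<le> n * (2 * (n * ?q))" by (intro mult_left_mono) auto
      also have "\<dots> \<le> e" using nq by (simp add: mult_ac)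
      finally show ?thesis unfolding \<theta>_def .
    qed (use e in simp)
    show "real (4 * C n + Dp n * T n * K n) \<le> (4 * (A + 1) + c1 * (G + 1)) * lg n ^ 3"
    proof -
      have l13: "lg n \<le> lg n ^ 3" using power_increasing[OF _ lg_ge_1[of n], of 1 3] by simp
      have "real (C n) \<le> (A + 1) * lg n" using Cb(2)[of n] lg_ge_1[of n] by (simp add: algebra_simps)
      also have "\<dots> \<le> (A + 1) * lg n ^ 3" using A(4) l13 by (intro mult_left_mono) auto
      finally have 1: "real (C n) \<le> (A + 1) * lg n ^ 3" .
      have "real (K n) \<le> (G + 1) * lg n" using Kb(2)[of n] lg_ge_1[of n] by (simp add: algebra_simps)
      then have "real (Dp n) * T n * K n \<le> (c1 * (lg n * lg n)) * ((G + 1) * lg n)"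
        using c1 l0[of n] by (intro mult_mono[OF DT[of n]]) auto
      also have "\<dots> = c1 * (G + 1) * lg n ^ 3" by (simp add: power3_eq_cube mult_ac)
      finally show ?thesis using 1 by (simp add: algebra_simps)
    qed
  qed (use y in auto)
qed

text \<open>From \<open>n = 3\<close> on the logarithm is at least 1, so \<open>lg n\<close> is at
  most twice the logarithm and the cube is below the fourth power up to the factor 8.\<close>

lemma lg_cube_bigo: "(\<lambda>n. lg n ^ 3) \<in> O(\<lambda>n. ln (real n) ^ 4)"
proof (rule bigoI[of _ 8], rule eventually_sequentiallyI[of 3])
  fix n :: nat assume n: "3 \<le> n"
  have "exp 1 \<le> (3::real)" using exp_le by simp
  also have "\<dots> \<le> real n" using n by simp
  finally have l: "1 \<le> ln (real n)" using n by (subst ln_ge_iff) auto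
  have "lg n ^ 3 \<le> (2 * ln (real n)) ^ 3" unfolding lg_def using l by (intro power_mono) auto
  also have "\<dots> = 8 * ln (real n) ^ 3" by (simp add: power_mult_distrib)
  also have "\<dots> \<le> 8 * ln (real n) ^ 4" using l by (intro mult_left_mono power_increasing) auto
  finally show "norm (lg n ^ 3) \<le> 8 * norm (ln (real n) ^ 4)"
    using l lg_ge_1[of n] by simp
qed

theorem theorem3p1:
  fixes \<epsilon> :: real
  assumes "\<epsilon> > 0"
  shows "\<exists>(k :: nat \<Rightarrow> nat) (alg :: nat \<Rightarrow> nat set set \<Rightarrow> online_alg).
     (\<lambda>n. real (k n)) \<in> O(\<lambda>n. ln (real n) ^ 4) \<and>
     (\<forall>n \<I>. matroid {1..n} \<I> \<longrightarrow>
        online_algorithm n (k n) \<I> (alg n \<I>) \<and>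
        competitive (1 / 4 - \<epsilon>) n (k n) \<I> (alg n \<I>))"
proof -
  \<comment> \<open>The total loss is \<open>4 * e\<close>, and \<open>competitive_bound\<close>
    requires \<open>e\<close> to be at most 1/16.\<close>
  define e where "e = min (\<epsilon> / 4) (1/16)"
  have e: "0 < e" "e \<le> 1/16" "4 * e \<le> \<epsilon>" unfolding e_def using assms by auto
  obtain C Dp T K :: "nat \<Rightarrow> nat" and c y :: real where p:
    "\<And>n. 1 \<le> e * C n" "\<And>n. 0 < K n" "\<And>n. 0 < T n" "\<And>n. (1 - e) ^ Dp n * n < 1"
    "\<And>n. Dp n / T n \<le> e" "\<And>n. Dp n * T n * n * (2 * exp (- 2 * e\<^sup>2 * K n)) \<le> e"
    "\<And>n. n * (2 * exp (- (e\<^sup>2 * C n / 2))) \<le> e" "1 < y" "y < 2"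
    "\<And>n. n * ((1 + ((1 / (2 - y) * y powr (- ((1 - e/2) * (1 + e)))) ^ C n)) ^ n - 1) \<le> e"
    "\<And>n. real (4 * C n + Dp n * T n * K n) \<le> c * lg n ^ 3"
  proof (rule parameters_exist[OF e(1,2)], goal_cases)
    case (1 C Dp T K c y)
    show ?case by (rule that[of C K T Dp y c]) (rule 1)+
  qed
  let ?k = "\<lambda>n. 4 * C n + Dp n * T n * K n"
  let ?alg = "\<lambda>n \<I>. prophet_alg.the_alg n \<I> (C n) (4 * C n) (K n) (T n) (Dp n) e"
  have "(\<lambda>n. real (?k n)) \<in> O(\<lambda>n. lg n ^ 3)"
  proof (rule bigoI[of _ "\<bar>c\<bar>"], rule always_eventually, rule allI)
    fix n
    have "0 \<le> lg n ^ 3" using lg_ge_1[of n] by simp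
    then have "c * lg n ^ 3 \<le> \<bar>c\<bar> * lg n ^ 3" by (intro mult_right_mono) auto
    then show "norm (real (?k n)) \<le> \<bar>c\<bar> * norm (lg n ^ 3)"
      using p(11)[of n] \<open>0 \<le> lg n ^ 3\<close> by simp
  qed
  then have "(\<lambda>n. real (?k n)) \<in> O(\<lambda>n. ln (real n) ^ 4)"
    by (rule landau_o.big_trans) (rule lg_cube_bigo)
  moreover have "online_algorithm n (?k n) \<I> (?alg n \<I>) \<and> competitive (1 / 4 - \<epsilon>) n (?k n) \<I> (?alg n \<I>)"
    if m: "matroid {1..n} \<I>" for n \<I>
  proof -
    interpret A: prophet_alg n \<I> "C n" "4 * C n" "K n" "T n" "Dp n" e
      by (intro prophet_alg.intro finite_matroid.intro prophet_alg_axioms.intro m p(3))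
    have "competitive (1 / 4 - \<epsilon>) n (?k n) \<I> (?alg n \<I>)"
      unfolding competitive_def
    proof (intro allI impI)
      fix D :: "nat \<Rightarrow> real measure" assume D: "\<forall>i\<in>{1..n}. nonneg_distribution (D i)"
      interpret I: prophet_instance n \<I> "C n" "4 * C n" "K n" "T n" "Dp n" e D
        by (intro prophet_instance.intro A.prophet_alg_axioms prophet_instance_axioms.intro) (use D in blast)
      have "ennreal (1 / 4 - \<epsilon>) * expected_opt n \<I> D \<le> ennreal (1 / 4 - 4 * e) * expected_opt n \<I> D"
        using e(3) by (intro mult_right_mono ennreal_leI) auto
      also have "\<dots> \<le> expected_alg n A.num_samples D A.the_alg"
        by (rule I.competitive_bound[OF refl p(1,2) e(1,2) p(4-10)])
      finally show "ennreal (1 / 4 - \<epsilon>) * expected_opt n \<I> D \<le> expected_alg n (?k n) D (?alg n \<I>)"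
        unfolding A.num_samples_def .
    qed
    then show ?thesis using A.online_the_alg unfolding A.num_samples_def by simp
  qed
  ultimately show ?thesis by (intro exI[of _ ?k] exI[of _ ?alg]) auto
qed

end
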